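(* Let $\Delta\subset\mathbb{R}^2$ be a non-degenerate convex lattice polygon, let $\mathcal{A}=\Delta\cap\mathbb{Z}^2$, let $\delta$ be a nonnegative integer that is at most the number of interior lattice points of $\Delta$, let $\mathcal{X}=\mathrm{Sev}(\Delta,\delta)$ be the Severi variety over $\mathbb{K}$, and let $\mathrm{Trop}(\mathcal{X})\subset\mathbb{R}^{\mathcal{A}}/\mathbb{R}\cdot\mathbf{1}$ be the tropical Severi variety. Suppose that there exists a non-effective $\psi\in\mathrm{Trop}(\mathcal{X})$ with the maximal rank, $\mathrm{rank}(\psi)=\dim(\mathcal{X})$. Then there is no fan structure on $\mathrm{Trop}(\mathcal{X})$ which makes $\mathrm{Trop}(\mathcal{X})$ a subfan of the secondary fan $\Sigma(\Delta)$; that is, there is no fan structure on $\mathrm{Trop}(\mathcal{X})$ such that each of its cones is a union of some cones of $\Sigma(\Delta)$.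
   Context: **Subdivisions.** $\Delta\subset\mathbb{R}^2$ is a convex lattice polygon with $\dim\Delta=2$ (non-degenerate), and $\mathcal{A}=\Delta\cap\mathbb{Z}^2$. A marked polygon is a pair $(\Delta',\mathcal{A}')$ with $\Delta'$ a convex lattice polygon and $\mathcal{A}'\subset\Delta'\cap\mathbb{Z}^2$ a finite set containing all vertices of $\Delta'$. A (marked) subdivision $S$ of $\Delta$ is a collection of marked polygons $\{(\Delta_i,\mathcal{A}_i): i=1,\dots,k\}$ such that each $\mathcal{A}_i\subset\mathcal{A}$ and each $\Delta_i$ is 2-dimensional; any intersection $\Delta_i\cap\Delta_j$ is a (possibly empty) face of both, and $\mathcal{A}_i\cap(\Delta_i\cap\Delta_j)=\mathcal{A}_j\cap(\Delta_i\cap\Delta_j)$; and $\bigcup_i\Delta_i=\Delta$. A subdivision $S=\{(\Delta_i,\mathcal{A}_i)\}$ refines $S'=\{(\Delta'_j,\mathcal{A}'_j)\}$ if for each $j$ the collection of $(\Delta_i,\mathcal{A}_i)$ with $\Delta_i\subset\Delta'_j$ forms a subdivision of $(\Delta'_j,\mathcal{A}'_j)$. **Coherent subdivisions and the secondary fan.** For $\psi\in\mathbb{R}^{\mathcal{A}}$ let $G_\psi\subset\mathbb{R}^3$ be the convex hull of $\{(a,y): a\in\mathcal{A},\ y\in\mathbb{R},\ y\le\psi(a)\}$. The concave hull of $\psi$ is the concave piecewise-linear function $\mathrm{cc}(\psi):\Delta\to\mathbb{R}$, $x\mapsto\max\{y:(x,y)\in G_\psi\}$; write $\mathrm{cc}(\psi)_{\mathcal{A}}$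 for its restriction to $\mathcal{A}$. The subdivision $\Delta_\psi=\{(\Delta_i,\mathcal{A}_i)\}$ has as $\Delta_i$ the domains of linearity of $\mathrm{cc}(\psi)$, and $\mathcal{A}_i=\{a\in\mathcal{A}\cap\Delta_i:\mathrm{cc}(\psi)(a)=\psi(a)\}$. A subdivision is coherent if it equals $\Delta_\psi$ for some $\psi\in\mathbb{R}^{\mathcal{A}}$. We write $\Delta_{\mathrm{cc}(\psi)}$ for the subdivision induced by $\mathrm{cc}(\psi)_{\mathcal{A}}$ (same polygons, all lattice points marked). For a coherent subdivision $S$, $\mathcal{C}(S)$ is the set of all $\psi\in\mathbb{R}^{\mathcal{A}}$ such that $S$ refines $\Delta_\psi$; it is a closed convex polyhedral cone whose relative interior $\mathcal{C}(S)^\circ$ is the set of $\psi$ with $\Delta_\psi=S$. All these cones contain the line $\mathbb{R}\cdot\mathbf{1}$ of constant functions; the same notation $\mathcal{C}(S)$ is used for the induced cone in $\mathbb{R}^{\mathcal{A}}/\mathbb{R}\cdot\mathbf{1}$. The secondary fan $\Sigma(\Delta)$ is the complete fan in $\mathbb{R}^{\mathcal{A}}/\mathbb{R}\cdot\mathbf{1}$ consisting of all the cones $\mathcal{C}(S)$, $S$ coherent. **Effectiveness and rank.** $\psi\in\mathbb{R}^{\mathcal{A}}$ is effective if $\psi=\mathrm{cc}(\psi)_{\mathcal{A}}$. The rank of $\psi$ is $\mathrm{rank}(\psi)=\dim\mathcal{C}(\Delta_{\mathrm{cc}(\psi)})$, the dimension of the cone in $\Sigma(\Delta)$ (i.e.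 in $\mathbb{R}^{\mathcal{A}}/\mathbb{R}\cdot\mathbf{1}$). Both notions are invariant under adding constants to $\psi$, hence make sense on $\mathbb{R}^{\mathcal{A}}/\mathbb{R}\cdot\mathbf{1}$. **Tropical Severi varieties.** $\mathbb{K}$ is the field of locally convergent Puiseux series over $\mathbb{C}$: elements $c(t)=\sum_{\tau\in R}c_\tau t^\tau$ with $c_\tau\in\mathbb{C}$, $R\subset\mathbb{Q}$ contained in an arithmetic progression bounded from above, and $\sum_{\tau}|c_\tau|t^\tau<\infty$ for all sufficiently large positive $t$; its valuation is $\mathrm{Val}(c(t))=\max\{\tau\in R:c_\tau\neq0\}$. Let $X_\Delta$ be the projective toric surface of $\Delta$ over $\mathbb{K}$ and $\mathbb{P}_\Delta\cong\mathbb{P}^{|\mathcal{A}|-1}$ the projective space of curves on $X_\Delta$ defined by polynomials $f=\sum_{a\in\mathcal{A}}c_ax^a$ (where $x^a=x_1^{a_1}x_2^{a_2}$, $c_a\in\mathbb{K}$), with big open torus $\mathbb{T}_\Delta$ (all $c_a\ne0$). The Severi variety $\mathrm{Sev}(\Delta,\delta)$ is the Zariski closure in $\mathbb{P}_\Delta$ of the set of curves with exactly $\delta$ nodes (ordinary double points) as their only singularities. For $\delta$ as in the claim, its dimension is $|\mathcal{A}|-1-\delta$. $\mathrm{Trop}(\mathcal{X})$ is the closure of the image of $\mathcal{X}\cap\mathbb{T}_\Delta\to\mathbb{R}^{\mathcal{A}}/\mathbb{R}\cdot\mathbf{1}$, $[c_a(t)]_{a\in\mathcal{A}}\mapsto[a\mapsto\mathrm{Val}(c_a(t))]$.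 *)

theory Defs
  imports
    "HOL-Complex_Analysis.Complex_Analysis"
    "HOL-Library.Poly_Mapping"
    "HOL-Library.Extended_Nat"
begin

no_notation fps_nth (infixl \<open>$\<close> 75)

section \<open>Locally convergent Puiseux series\<close>

definition locally_convergent_puiseux :: "(rat \<Rightarrow> complex) \<Rightarrow> bool" where
  "locally_convergent_puiseux c \<longleftrightarrow>
     (\<exists>a d. 0 < d \<and> {\<tau>. c \<tau> \<noteq> 0} \<subseteq> range (\<lambda>k::nat. a - of_nat k * d)) \<and>
     (\<forall>\<^sub>F t in at_top. (\<lambda>\<tau>. norm (c \<tau>) * t powr (of_rat \<tau> :: real)) summable_on UNIV)"

typedef puiseux = "{c. locally_convergent_puiseux c}"
  morphisms puiseux_coeff Abs_puiseux
  by (rule exI[of _ "\<lambda>_. 0"]) (auto simp: locally_convergent_puiseux_def intro!: exI[of _ 1])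

setup_lifting type_definition_puiseux

definition puiseux_conv :: "(rat \<Rightarrow> complex) \<Rightarrow> (rat \<Rightarrow> complex) \<Rightarrow> rat \<Rightarrow> complex" where
  "puiseux_conv c d \<tau> = (\<Sum>\<sigma> | c \<sigma> \<noteq> 0 \<and> d (\<tau> - \<sigma>) \<noteq> 0. c \<sigma> * d (\<tau> - \<sigma>))"

text \<open>The ring axioms are transported from Laurent series: the Laurent series \<open>F\<close> in the
  variable \<open>t powr (-1/N)\<close> is read as a Puiseux series in \<open>t\<close>.\<close>

definition series_of_fls :: "nat \<Rightarrow> complex fls \<Rightarrow> rat \<Rightarrow> complex" where
  "series_of_fls N F \<tau> = (if of_nat N * \<tau> \<in> \<int> then fls_nth F (- \<lfloor>of_nat N * \<tau>\<rfloor>) else 0)"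

lemma series_of_fls_at [simp]:
  assumes "N > 0"
  shows "series_of_fls N F (- (of_int k / of_nat N)) = fls_nth F k"
  using assms by (simp add: series_of_fls_def)

lemma series_of_fls_nonzeroE:
  assumes "N > 0" "series_of_fls N F \<tau> \<noteq> 0"
  obtains k where "\<tau> = - (of_int k / of_nat N)" "fls_nth F k \<noteq> 0"
proof -
  from assms have "of_nat N * \<tau> \<in> \<int>" by (auto simp: series_of_fls_def split: if_splits)
  then obtain m where m: "of_nat N * \<tau> = of_int m" by (auto elim: Ints_cases)
  have "\<tau> = - (of_int (-m) / of_nat N)" using m assms by (simp add: field_simps)
  with that[of "-m"] assms show ?thesis by (metis series_of_fls_at)
qed

lemma series_of_fls_inj:
  assumes "N > 0" "series_of_fls N F = series_of_fls N G"
  shows "F = G"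
  using assms by (intro fls_eqI) (metis series_of_fls_at)

lemma series_of_fls_summable_iff:
  assumes N: "N > 0" and t: "t > 0"
  shows "(\<lambda>\<tau>. norm (series_of_fls N F \<tau>) * t powr (of_rat \<tau> :: real)) summable_on UNIV \<longleftrightarrow>
         summable (\<lambda>k. norm (fls_nth F (fls_subdegree F + int k)) * (t powr (-1 / real N)) ^ k)"
proof -
  define n where "n = fls_subdegree F"
  define h :: "nat \<Rightarrow> rat" where "h = (\<lambda>k. - (of_int (n + int k) / of_nat N))"
  have inj: "inj h" using N by (auto simp: h_def inj_def field_simps)
  have zero: "series_of_fls N F \<tau> = 0" if "\<tau> \<notin> range h" for \<tau>
  proof (rule ccontr)
    assume "series_of_fls N F \<tau> \<noteq> 0"
    then obtain k where k: "\<tau> = - (of_int k / of_nat N)" "fls_nth F k \<noteq> 0"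
      using N by (elim series_of_fls_nonzeroE)
    from k(2) have "n \<le> k" unfolding n_def by (rule fls_subdegree_leI)
    hence "\<tau> = h (nat (k - n))" using k(1) by (simp add: h_def)
    with that show False by blast
  qed
  have pw: "t powr (of_rat (h k) :: real) = t powr (- of_int n / real N) * (t powr (-1 / real N)) ^ k" for k
  proof -
    have hk: "(of_rat (h k) :: real) = - of_int n / real N + real k * (-1 / real N)"
      using N by (simp add: h_def of_rat_divide of_rat_minus of_rat_diff of_rat_add add_divide_distrib diff_divide_distrib)
    show ?thesis unfolding hk powr_add using t by (simp add: powr_realpow [symmetric] powr_powr mult.commute)
  qed
  have "(\<lambda>\<tau>. norm (series_of_fls N F \<tau>) * t powr (of_rat \<tau> :: real)) summable_on UNIV \<longleftrightarrow>
        (\<lambda>\<tau>. norm (series_of_fls N F \<tau>) * t powr (of_rat \<tau> :: real)) summable_on range h"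
    by (rule summable_on_cong_neutral) (auto simp: zero)
  also have "\<dots> \<longleftrightarrow> (\<lambda>k. norm (series_of_fls N F (h k)) * t powr (of_rat (h k) :: real)) summable_on UNIV"
    using inj by (subst summable_on_reindex) (auto simp: o_def)
  also have "\<dots> \<longleftrightarrow> summable (\<lambda>k. norm (series_of_fls N F (h k)) * t powr (of_rat (h k) :: real))"
    by (rule summable_on_UNIV_nonneg_real_iff) simp
  also have "(\<lambda>k. norm (series_of_fls N F (h k)) * t powr (of_rat (h k) :: real)) =
     (\<lambda>k. t powr (- of_int n / real N) * (norm (fls_nth F (n + int k)) * (t powr (-1 / real N)) ^ k))"
    unfolding pw unfolding h_def using N by (simp only: series_of_fls_at) (simp add: mult_ac)
  also have "summable \<dots> \<longleftrightarrow> summable (\<lambda>k. norm (fls_nth F (n + int k)) * (t powr (-1 / real N)) ^ k)"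
    using t by (subst summable_cmult_iff) auto
  finally show ?thesis by (simp add: n_def)
qed

lemma fls_conv_radius_subdegree:
  "fls_conv_radius F = conv_radius (\<lambda>k. norm (fls_nth F (fls_subdegree F + int k)))"
  by (simp add: fls_conv_radius_altdef fps_conv_radius_def add_ac)

lemma eventually_summable_series_of_fls_iff:
  assumes N: "N > 0"
  shows "(\<forall>\<^sub>F t in at_top. (\<lambda>\<tau>. norm (series_of_fls N F \<tau>) * t powr (of_rat \<tau> :: real)) summable_on UNIV)
         \<longleftrightarrow> fls_conv_radius F > 0"
    (is "?L \<longleftrightarrow> ?R")
proof -
  define f where "f = (\<lambda>k. norm (fls_nth F (fls_subdegree F + int k)))"
  have rad: "fls_conv_radius F = conv_radius f"
    by (simp add: fls_conv_radius_subdegree f_def)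
  have iff: "?L \<longleftrightarrow> (\<forall>\<^sub>F t in at_top. summable (\<lambda>k. f k * (t powr (-1 / real N)) ^ k))"
    unfolding f_def
    by (rule eventually_cong[OF eventually_gt_at_top[of 0]], rule series_of_fls_summable_iff[OF N])
  show ?thesis
  proof
    assume ?L
    with iff have "\<forall>\<^sub>F t in at_top. summable (\<lambda>k. f k * (t powr (-1 / real N)) ^ k)" by simp
    with eventually_gt_at_top[of 0] have
      "\<forall>\<^sub>F t::real in at_top. t > 0 \<and> summable (\<lambda>k. f k * (t powr (-1 / real N)) ^ k)"
      by eventually_elim simp
    then obtain t :: real where t: "t > 0" "summable (\<lambda>k. f k * (t powr (-1 / real N)) ^ k)"
      using eventually_happens'[OF trivial_limit_at_top_linorder] by blast
    have "conv_radius f \<ge> norm (t powr (-1 / real N))" using t(2) by (rule conv_radius_geI)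
    moreover have "norm (t powr (-1 / real N)) > 0" using t(1) by simp
    ultimately show ?R unfolding rad by (metis ereal_less(2) less_le_trans)
  next
    assume ?R
    hence "0 < conv_radius f" by (simp add: rad)
    then obtain r :: real where r: "0 < r" "ereal r < conv_radius f"
      using ereal_dense2[of 0 "conv_radius f"] by auto
    have "((\<lambda>t::real. t powr (-1 / real N)) \<longlongrightarrow> 0) at_top"
      using N by (intro tendsto_neg_powr filterlim_ident) auto
    hence "\<forall>\<^sub>F t in at_top. t powr (-1 / real N) < r"
      using r(1) by (rule order_tendstoD)
    hence "\<forall>\<^sub>F t in at_top. summable (\<lambda>k. f k * (t powr (-1 / real N)) ^ k)"
    proof eventually_elim
      case (elim t)
      hence "ereal (norm (t powr (-1 / real N))) < conv_radius f"
        using r(2) by (metis abs_of_nonneg ereal_less(3) ereal_less_eq(3) less_imp_le less_le_trans order_le_less_trans powr_ge_zero real_norm_def)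
      thus ?case by (rule summable_in_conv_radius)
    qed
    with iff show ?L by simp
  qed
qed

definition denominator_bound :: "nat \<Rightarrow> (rat \<Rightarrow> complex) \<Rightarrow> bool" where
  "denominator_bound N c \<longleftrightarrow> N > 0 \<and> (\<forall>\<tau>. c \<tau> \<noteq> 0 \<longrightarrow> of_nat N * \<tau> \<in> \<int>)"

lemma denominator_bound_mult:
  assumes "denominator_bound N c" "M > 0"
  shows "denominator_bound (M * N) c"
  using assms unfolding denominator_bound_def
  by (auto simp: mult.assoc intro!: Ints_mult)

lemma locally_convergent_series_of_fls:
  assumes N: "N > 0" and F: "fls_conv_radius F > 0"
  shows "locally_convergent_puiseux (series_of_fls N F)"
proof -
  have "\<tau> \<in> range (\<lambda>k::nat. - (of_int (fls_subdegree F) / of_nat N) - of_nat k * (1 / of_nat N))"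
    if \<tau>: "series_of_fls N F \<tau> \<noteq> 0" for \<tau>
  proof -
    from \<tau> N obtain k where k: "\<tau> = - (of_int k / of_nat N)" "fls_nth F k \<noteq> 0"
      by (elim series_of_fls_nonzeroE)
    from k(2) have "fls_subdegree F \<le> k" by (rule fls_subdegree_leI)
    then obtain j where "k = fls_subdegree F + int j" by (metis zle_iff_zadd)
    with k(1) have "\<tau> = - (of_int (fls_subdegree F) / of_nat N) - of_nat j * (1 / of_nat N)"
      by (simp add: add_divide_distrib)
    thus ?thesis by blast
  qed
  hence "\<exists>a d. 0 < d \<and> {\<tau>. series_of_fls N F \<tau> \<noteq> 0} \<subseteq> range (\<lambda>k::nat. a - of_nat k * d)"
    using N by (intro exI[of _ "- (of_int (fls_subdegree F) / of_nat N)"] exI[of _ "1 / of_nat N"]) auto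
  thus ?thesis
    unfolding locally_convergent_puiseux_def using eventually_summable_series_of_fls_iff[OF N] F by blast
qed

lemma locally_convergent_denominator_bound:
  assumes "locally_convergent_puiseux c"
  shows "\<exists>N. denominator_bound N c"
proof -
  from assms obtain a d where ad: "{\<tau>. c \<tau> \<noteq> 0} \<subseteq> range (\<lambda>k::nat. a - of_nat k * d)"
    unfolding locally_convergent_puiseux_def by blast
  obtain p q where pq: "a = of_int p / of_int q" "q > 0" by (metis quotient_of_div quotient_of_denom_pos surj_pair)
  obtain r s where rs: "d = of_int r / of_int s" "s > 0" by (metis quotient_of_div quotient_of_denom_pos surj_pair)
  have "of_nat (nat (q * s)) * \<tau> \<in> \<int>" if "c \<tau> \<noteq> 0" for \<tau>
  proof -
    from that ad obtain k :: nat where k: "\<tau> = a - of_nat k * d" by blast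
    have "of_nat (nat (q * s)) * \<tau> = of_int (p * s - int k * r * q)"
    proof -
      have "a * of_int q = of_int p" "d * of_int s = of_int r" using pq rs by auto
      moreover have "of_nat (nat (q * s)) = (of_int q * of_int s :: rat)" using pq rs by simp
      moreover have "of_int q * of_int s * \<tau> = of_int s * (a * of_int q) - of_nat k * of_int q * (d * of_int s)"
        by (simp add: k algebra_simps)
      ultimately show ?thesis by simp
    qed
    thus ?thesis by (metis Ints_of_int)
  qed
  thus ?thesis using pq rs by (intro exI[of _ "nat (q * s)"]) (auto simp: denominator_bound_def)
qed

lemma denominator_bound_obtains_fls:
  assumes c: "locally_convergent_puiseux c" and N: "denominator_bound N c"
  obtains F where "fls_conv_radius F > 0" "c = series_of_fls N F"
proof -
  from N have N0: "N > 0" by (simp add: denominator_bound_def)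
  from c obtain a d where ad: "0 < d" "{\<tau>. c \<tau> \<noteq> 0} \<subseteq> range (\<lambda>k::nat. a - of_nat k * d)"
    unfolding locally_convergent_puiseux_def by blast
  have le: "\<tau> \<le> a" if "c \<tau> \<noteq> 0" for \<tau>
  proof -
    from that ad(2) obtain k :: nat where "\<tau> = a - of_nat k * d" by blast
    with ad(1) show ?thesis by simp
  qed
  define f where "f = (\<lambda>k::int. c (- (of_int k / of_nat N)))"
  define F where "F = Abs_fls f"
  have "\<forall>k < - \<lceil>of_nat N * a\<rceil>. f k = 0"
  proof (intro allI impI)
    fix k assume k: "k < - \<lceil>of_nat N * a\<rceil>"
    show "f k = 0"
    proof (rule ccontr)
      assume "f k \<noteq> 0"
      hence "- (of_int k / of_nat N) \<le> a" unfolding f_def by (rule le)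
      hence "of_int (-k) \<le> of_nat N * a" using N0 by (simp add: field_simps)
      hence "- k \<le> \<lceil>of_nat N * a\<rceil>" by (metis ceiling_mono ceiling_of_int)
      with k show False by simp
    qed
  qed
  hence Fn: "fls_nth F k = f k" for k
    unfolding F_def by (intro nth_Abs_fls_ex_lower_bound) blast
  have eq: "c = series_of_fls N F"
  proof
    fix \<tau> :: rat
    show "c \<tau> = series_of_fls N F \<tau>"
    proof (cases "of_nat N * \<tau> \<in> \<int>")
      case True
      then obtain m where m: "of_nat N * \<tau> = of_int m" by (auto elim: Ints_cases)
      have "\<tau> = - (of_int (-m) / of_nat N)" using m N0 by (simp add: field_simps)
      thus ?thesis using N0 Fn by (metis f_def series_of_fls_at)
    next
      case False
      thus ?thesis using N by (auto simp: series_of_fls_def denominator_bound_def)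
    qed
  qed
  moreover have "fls_conv_radius F > 0"
    using c eventually_summable_series_of_fls_iff[OF N0, of F]
    unfolding eq locally_convergent_puiseux_def by blast
  ultimately show ?thesis using that by blast
qed

lemma series_of_fls_add:
  "series_of_fls N (F + G) = (\<lambda>\<tau>. series_of_fls N F \<tau> + series_of_fls N G \<tau>)"
  by (auto simp: series_of_fls_def)

lemma series_of_fls_uminus: "series_of_fls N (- F) = (\<lambda>\<tau>. - series_of_fls N F \<tau>)"
  by (auto simp: series_of_fls_def)

lemma series_of_fls_0: "series_of_fls N 0 = (\<lambda>_. 0)"
  by (auto simp: series_of_fls_def)

lemma series_of_fls_1: 
  assumes "N > 0"
  shows "series_of_fls N 1 = (\<lambda>\<tau>. if \<tau> = 0 then 1 else 0)"
proof
  fix \<tau> :: rat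
  show "series_of_fls N 1 \<tau> = (if \<tau> = 0 then 1 else 0)"
  proof (cases "series_of_fls N 1 \<tau> = 0")
    case True
    thus ?thesis using series_of_fls_at[OF assms, of 1 0] by auto
  next
    case False
    then obtain k where "\<tau> = - (of_int k / of_nat N)" "fls_nth 1 k \<noteq> (0::complex)"
      using assms by (elim series_of_fls_nonzeroE)
    thus ?thesis using series_of_fls_at[OF assms, of 1 0] by (auto split: if_splits)
  qed
qed

lemma series_of_fls_mult:
  assumes N: "N > 0"
  shows "series_of_fls N (F * G) = puiseux_conv (series_of_fls N F) (series_of_fls N G)"
proof
  fix \<tau> :: rat
  define h :: "int \<Rightarrow> rat" where "h = (\<lambda>k. - (of_int k / of_nat N))"
  have inj: "inj h" using N by (auto simp: h_def inj_def field_simps)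
  let ?S = "{\<sigma>. series_of_fls N F \<sigma> \<noteq> 0 \<and> series_of_fls N G (\<tau> - \<sigma>) \<noteq> 0}"
  show "series_of_fls N (F * G) \<tau> = puiseux_conv (series_of_fls N F) (series_of_fls N G) \<tau>"
  proof (cases "of_nat N * \<tau> \<in> \<int>")
    case True
    then obtain m where m: "of_nat N * \<tau> = of_int m" by (auto elim: Ints_cases)
    define n where "n = - m"
    have \<tau>: "\<tau> = h n" using m N by (simp add: h_def n_def field_simps)
    have diff: "h n - h k = h (n - k)" for k by (simp add: h_def diff_divide_distrib)
    have at: "series_of_fls N F' (h k) = fls_nth F' k" for F' k
      unfolding h_def using N by (rule series_of_fls_at)
    have S: "?S = h ` {k. fls_nth F k \<noteq> 0 \<and> fls_nth G (n - k) \<noteq> 0}" (is "_ = h ` ?K")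
    proof (intro equalityI subsetI)
      fix \<sigma> assume s: "\<sigma> \<in> ?S"
      then obtain k where k: "\<sigma> = h k" "fls_nth F k \<noteq> 0"
        using N unfolding h_def by (auto elim: series_of_fls_nonzeroE)
      with s show "\<sigma> \<in> h ` ?K" by (auto simp: \<tau> diff at)
    next
      fix \<sigma> assume "\<sigma> \<in> h ` ?K"
      thus "\<sigma> \<in> ?S" by (auto simp: \<tau> diff at)
    qed
    have "puiseux_conv (series_of_fls N F) (series_of_fls N G) \<tau> =
          (\<Sum>k\<in>?K. series_of_fls N F (h k) * series_of_fls N G (\<tau> - h k))"
      unfolding puiseux_conv_def S using inj by (subst sum.reindex) (auto intro: inj_on_subset)
    also have "\<dots> = (\<Sum>k\<in>?K. fls_nth F k * fls_nth G (n - k))"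
      by (simp add: \<tau> diff at)
    also have "\<dots> = (\<Sum>k=fls_subdegree F..n - fls_subdegree G. fls_nth F k * fls_nth G (n - k))"
    proof (rule sum.mono_neutral_left)
      show "?K \<subseteq> {fls_subdegree F..n - fls_subdegree G}"
        by (auto dest!: fls_subdegree_leI)
    qed auto
    also have "\<dots> = fls_nth (F * G) n" by (simp add: fls_times_nth(2))
    also have "\<dots> = series_of_fls N (F * G) \<tau>" by (simp add: \<tau> at)
    finally show ?thesis by simp
  next
    case False
    have "?S = {}"
    proof (rule ccontr)
      assume "?S \<noteq> {}"
      then obtain \<sigma> where "of_nat N * \<sigma> \<in> \<int>" "of_nat N * (\<tau> - \<sigma>) \<in> \<int>"
        by (auto simp: series_of_fls_def split: if_splits)
      hence "of_nat N * \<sigma> + of_nat N * (\<tau> - \<sigma>) \<in> \<int>" by (rule Ints_add)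
      with False show False by (simp add: algebra_simps)
    qed
    hence "puiseux_conv (series_of_fls N F) (series_of_fls N G) \<tau> = 0"
      by (simp only: puiseux_conv_def sum.empty)
    thus ?thesis using False by (simp add: series_of_fls_def)
  qed
qed

lemma fls_conv_radius_inverse_pos:
  assumes "F \<noteq> 0" "fls_conv_radius F > 0"
  shows "fls_conv_radius (inverse F) > 0"
proof -
  have "fps_conv_radius (inverse (fls_base_factor_to_fps F)) > 0"
    using assms by (intro fps_conv_radius_inverse_pos) (auto simp: fls_conv_radius_altdef)
  thus ?thesis by (simp add: fls_inverse_def)
qed

lemma two_puiseux_cases:
  assumes "locally_convergent_puiseux c" "locally_convergent_puiseux d"
  obtains N F G where "N > 0" "fls_conv_radius F > 0" "fls_conv_radius G > 0"
    "c = series_of_fls N F" "d = series_of_fls N G"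
proof -
  obtain N where N: "denominator_bound N c" using assms locally_convergent_denominator_bound by blast
  obtain M where M: "denominator_bound M d" using assms locally_convergent_denominator_bound by blast
  have pos: "N > 0" "M > 0" using N M by (auto simp: denominator_bound_def)
  have "denominator_bound (N * M) c" using denominator_bound_mult[OF N pos(2)] by (simp add: mult.commute)
  moreover have "denominator_bound (N * M) d" using denominator_bound_mult[OF M pos(1)] .
  ultimately show ?thesis
    using that[of "N * M"] pos assms denominator_bound_obtains_fls by (metis nat_0_less_mult_iff)
qed

lemma three_puiseux_cases:
  assumes "locally_convergent_puiseux c" "locally_convergent_puiseux d" "locally_convergent_puiseux e"
  obtains N F G H where "N > 0" "fls_conv_radius F > 0" "fls_conv_radius G > 0" "fls_conv_radius H > 0"
    "c = series_of_fls N F" "d = series_of_fls N G" "e = series_of_fls N H"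
proof -
  obtain N where N: "denominator_bound N c" using assms locally_convergent_denominator_bound by blast
  obtain M where M: "denominator_bound M d" using assms locally_convergent_denominator_bound by blast
  obtain L where L: "denominator_bound L e" using assms locally_convergent_denominator_bound by blast
  have pos: "N > 0" "M > 0" "L > 0" using N M L by (auto simp: denominator_bound_def)
  have 1: "denominator_bound (N * M * L) c"
    using denominator_bound_mult[OF N, of "M * L"] pos by (simp add: mult_ac)
  have 2: "denominator_bound (N * M * L) d"
    using denominator_bound_mult[OF M, of "N * L"] pos by (simp add: mult_ac)
  have 3: "denominator_bound (N * M * L) e"
    using denominator_bound_mult[OF L, of "N * M"] pos by (simp add: mult_ac)
  obtain F where F: "fls_conv_radius F > 0" "c = series_of_fls (N * M * L) F"
    using denominator_bound_obtains_fls[OF assms(1) 1] .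
  obtain G where G: "fls_conv_radius G > 0" "d = series_of_fls (N * M * L) G"
    using denominator_bound_obtains_fls[OF assms(2) 2] .
  obtain H where H: "fls_conv_radius H > 0" "e = series_of_fls (N * M * L) H"
    using denominator_bound_obtains_fls[OF assms(3) 3] .
  show ?thesis using that[of "N * M * L" F G H] pos F G H by simp
qed

lemma fls_conv_radius_pos_closed:
  assumes "fls_conv_radius F > 0" "fls_conv_radius G > 0"
  shows "fls_conv_radius (F + G) > 0" "fls_conv_radius (F * G) > 0"
  using assms fls_conv_radius_add[of F G] fls_conv_radius_mult[of F G]
  by (meson less_le_trans min_less_iff_conj)+

instantiation puiseux :: comm_ring_1
begin

lift_definition zero_puiseux :: puiseux is "\<lambda>_. 0"
  using locally_convergent_series_of_fls[of 1 0] by (simp add: series_of_fls_0)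

lift_definition one_puiseux :: puiseux is "\<lambda>\<tau>. if \<tau> = 0 then 1 else 0"
  using locally_convergent_series_of_fls[of 1 1] by (simp add: series_of_fls_1)

lift_definition plus_puiseux :: "puiseux \<Rightarrow> puiseux \<Rightarrow> puiseux" is "\<lambda>c d \<tau>. c \<tau> + d \<tau>"
  by (erule (1) two_puiseux_cases)
     (simp add: series_of_fls_add[symmetric] locally_convergent_series_of_fls fls_conv_radius_pos_closed)

lift_definition uminus_puiseux :: "puiseux \<Rightarrow> puiseux" is "\<lambda>c \<tau>. - c \<tau>"
  by (simp add: locally_convergent_puiseux_def)

definition minus_puiseux :: "puiseux \<Rightarrow> puiseux \<Rightarrow> puiseux" where
  "minus_puiseux x y = x + - y"

lift_definition times_puiseux :: "puiseux \<Rightarrow> puiseux \<Rightarrow> puiseux" is puiseux_conv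
  by (erule (1) two_puiseux_cases)
     (simp add: series_of_fls_mult[symmetric] locally_convergent_series_of_fls fls_conv_radius_pos_closed)

instance
proof
  fix x y z :: puiseux
  show "x * y * z = x * (y * z)"
    by transfer (erule (2) three_puiseux_cases, simp add: series_of_fls_mult[symmetric] mult.assoc)
  show "x * y = y * x"
    by transfer (erule (1) two_puiseux_cases, simp add: series_of_fls_mult[symmetric] mult.commute)
  show "1 * x = x"
  proof transfer
    fix c assume "locally_convergent_puiseux c"
    then obtain N F where NF: "N > 0" "c = series_of_fls N F"
      using two_puiseux_cases by metis
    show "puiseux_conv (\<lambda>\<tau>. if \<tau> = 0 then 1 else 0) c = c"
      using NF by (simp add: series_of_fls_1[symmetric] series_of_fls_mult[symmetric])
  qed
  show "(x + y) * z = x * z + y * z"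
    by transfer (erule (2) three_puiseux_cases,
      simp add: series_of_fls_mult[symmetric] series_of_fls_add[symmetric] distrib_right)
  show "0 \<noteq> (1::puiseux)"
    by transfer (metis zero_neq_one)
qed (unfold minus_puiseux_def, (transfer, simp add: fun_eq_iff)+)

end

lemma puiseux_inverse_exists:
  fixes x :: puiseux
  assumes "x \<noteq> 0"
  shows "\<exists>y. x * y = 1"
  using assms
proof transfer
  fix c :: "rat \<Rightarrow> complex"
  assume c: "locally_convergent_puiseux c" "c \<noteq> (\<lambda>_. 0)"
  from c(1) obtain N F where NF: "N > 0" "fls_conv_radius F > 0" "c = series_of_fls N F"
    using two_puiseux_cases by metis
  have "F \<noteq> 0" using c(2) NF(3) by (auto simp: series_of_fls_0)
  moreover from this have "puiseux_conv c (series_of_fls N (inverse F)) = (\<lambda>\<tau>. if \<tau> = 0 then 1 else 0)"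
    using NF by (simp add: series_of_fls_mult[symmetric] series_of_fls_1[symmetric])
  moreover have "locally_convergent_puiseux (series_of_fls N (inverse F))"
    using NF \<open>F \<noteq> 0\<close> by (intro locally_convergent_series_of_fls fls_conv_radius_inverse_pos)
  ultimately show "\<exists>y\<in>Collect locally_convergent_puiseux. puiseux_conv c y = (\<lambda>\<tau>. if \<tau> = 0 then 1 else 0)"
    by blast
qed

instantiation puiseux :: field
begin

definition inverse_puiseux :: "puiseux \<Rightarrow> puiseux" where
  "inverse_puiseux x = (if x = 0 then 0 else THE y. x * y = 1)"

definition divide_puiseux :: "puiseux \<Rightarrow> puiseux \<Rightarrow> puiseux" where
  "divide_puiseux x y = x * inverse y"

instance
proof
  fix x y :: puiseux
  show "x div y = x * inverse y" by (rule divide_puiseux_def)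
  show "inverse (0::puiseux) = 0" by (simp add: inverse_puiseux_def)
  assume x: "x \<noteq> 0"
  then obtain z where z: "x * z = 1" using puiseux_inverse_exists by blast
  have "(THE y. x * y = 1) = z"
  proof (rule the_equality, rule z)
    fix y assume y: "x * y = 1"
    have "y = y * (x * z)" using z by simp
    also have "\<dots> = z" using y by (metis mult.assoc mult.commute mult_1)
    finally show "y = z" .
  qed
  with x z show "inverse x * x = 1" by (simp add: inverse_puiseux_def mult.commute)
qed

end

definition puiseux_val :: "puiseux \<Rightarrow> rat" where
  "puiseux_val c = (GREATEST \<tau>. puiseux_coeff c \<tau> \<noteq> 0)"


section \<open>Lattice polygons and marked subdivisions\<close>

definition of_lattice :: "int \<times> int \<Rightarrow> real \<times> real" where
  "of_lattice a = (of_int (fst a), of_int (snd a))"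

definition lattice_points :: "(real \<times> real) set \<Rightarrow> (int \<times> int) set" where
  "lattice_points P = {a. of_lattice a \<in> P}"

definition lattice_polygon :: "(real \<times> real) set \<Rightarrow> bool" where
  "lattice_polygon P \<longleftrightarrow> (\<exists>V. finite V \<and> V \<noteq> {} \<and> P = convex hull (of_lattice ` V))"

type_synonym marked = "(real \<times> real) set \<times> (int \<times> int) set"

definition marked_polygon :: "marked \<Rightarrow> bool" where
  "marked_polygon = (\<lambda>(P, M). lattice_polygon P \<and> finite M \<and> M \<subseteq> lattice_points P \<and>
     {x. x extreme_point_of P} \<subseteq> of_lattice ` M)"

definition is_subdivision :: "marked set \<Rightarrow> marked \<Rightarrow> bool" where
  "is_subdivision S = (\<lambda>(P, M).
     finite S \<and>
     (\<forall>(Q, N)\<in>S. marked_polygon (Q, N) \<and> N \<subseteq> M \<and> aff_dim Q = 2) \<and>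
     (\<forall>(Q, N)\<in>S. \<forall>(Q', N')\<in>S.
        Q \<inter> Q' face_of Q \<and> Q \<inter> Q' face_of Q' \<and>
        N \<inter> lattice_points (Q \<inter> Q') = N' \<inter> lattice_points (Q \<inter> Q')) \<and>
     \<Union>(fst ` S) = P)"

definition refines :: "marked set \<Rightarrow> marked set \<Rightarrow> bool" where
  "refines S S' \<longleftrightarrow> (\<forall>(P, M)\<in>S'. is_subdivision {(Q, N)\<in>S. Q \<subseteq> P} (P, M))"

section \<open>Coherent subdivisions and the secondary fan\<close>

text \<open>Throughout, \<open>e :: 'n \<Rightarrow> int \<times> int\<close> enumerates the lattice points of the polygon without
  repetition, so that vectors indexed by these points have type \<open>real ^ 'n\<close>
  (or \<open>puiseux ^ 'n\<close>).\<close>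

definition subgraph_hull :: "('n::finite \<Rightarrow> int \<times> int) \<Rightarrow> real ^ 'n \<Rightarrow> ((real \<times> real) \<times> real) set" where
  "subgraph_hull e \<psi> = convex hull {(of_lattice (e i), y) | i y. y \<le> \<psi> $ i}"

definition concave_hull :: "('n::finite \<Rightarrow> int \<times> int) \<Rightarrow> real ^ 'n \<Rightarrow> real \<times> real \<Rightarrow> real" where
  "concave_hull e \<psi> x = (GREATEST y. (x, y) \<in> subgraph_hull e \<psi>)"

definition concave_hull_restr :: "('n::finite \<Rightarrow> int \<times> int) \<Rightarrow> real ^ 'n \<Rightarrow> real ^ 'n" where
  "concave_hull_restr e \<psi> = (\<chi> i. concave_hull e \<psi> (of_lattice (e i)))"

definition affine_on :: "(real \<times> real) set \<Rightarrow> (real \<times> real \<Rightarrow> real) \<Rightarrow> bool" where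
  "affine_on P f \<longleftrightarrow> (\<exists>u c. \<forall>x\<in>P. f x = u \<bullet> x + c)"

definition linearity_domain :: "(real \<times> real) set \<Rightarrow> (real \<times> real \<Rightarrow> real) \<Rightarrow> (real \<times> real) set \<Rightarrow> bool" where
  "linearity_domain \<Delta> f P \<longleftrightarrow>
     P \<subseteq> \<Delta> \<and> convex P \<and> aff_dim P = 2 \<and> affine_on P f \<and>
     (\<forall>Q. P \<subseteq> Q \<and> Q \<subseteq> \<Delta> \<and> convex Q \<and> affine_on Q f \<longrightarrow> Q = P)"

definition induced_subdivision ::
  "(real \<times> real) set \<Rightarrow> ('n::finite \<Rightarrow> int \<times> int) \<Rightarrow> real ^ 'n \<Rightarrow> marked set" where
  "induced_subdivision \<Delta> e \<psi> =
     {(P, {e i | i. of_lattice (e i) \<in> P \<and> concave_hull e \<psi> (of_lattice (e i)) = \<psi> $ i}) | P.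
       linearity_domain \<Delta> (concave_hull e \<psi>) P}"

definition coherent :: "(real \<times> real) set \<Rightarrow> ('n::finite \<Rightarrow> int \<times> int) \<Rightarrow> marked set \<Rightarrow> bool" where
  "coherent \<Delta> e S \<longleftrightarrow> (\<exists>\<psi>. S = induced_subdivision \<Delta> e \<psi>)"

definition secondary_cone ::
  "(real \<times> real) set \<Rightarrow> ('n::finite \<Rightarrow> int \<times> int) \<Rightarrow> marked set \<Rightarrow> (real ^ 'n) set" where
  "secondary_cone \<Delta> e S = {\<psi>. refines S (induced_subdivision \<Delta> e \<psi>)}"

text \<open>The real vector space \<open>real ^ 'n\<close> modulo the line of constant vectors, with the quotient
  topology. The class of \<open>\<psi>\<close> is \<open>abs_trop_torus \<psi>\<close>.\<close>

quotient_type (overloaded) 'n trop_torus = "real ^ ('n::finite)" /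
  "\<lambda>\<phi> \<psi>. \<exists>c. \<forall>i. \<phi> $ i - \<psi> $ i = c"
proof (rule equivpI)
  show "reflp (\<lambda>(\<phi>::real^'n) \<psi>. \<exists>c. \<forall>i. \<phi> $ i - \<psi> $ i = c)"
    by (rule reflpI) simp
  show "symp (\<lambda>(\<phi>::real^'n) \<psi>. \<exists>c. \<forall>i. \<phi> $ i - \<psi> $ i = c)"
    by (rule sympI) (metis minus_diff_eq)
  show "transp (\<lambda>(\<phi>::real^'n) \<psi>. \<exists>c. \<forall>i. \<phi> $ i - \<psi> $ i = c)"
  proof (rule transpI)
    fix x y z :: "real^'n"
    assume "\<exists>c. \<forall>i. x $ i - y $ i = c" "\<exists>c. \<forall>i. y $ i - z $ i = c"
    then obtain c d where "\<And>i. x $ i - y $ i = c" "\<And>i. y $ i - z $ i = d" by blast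
    hence "\<forall>i. x $ i - z $ i = c + d" by (metis add_diff_cancel_left' diff_add_cancel diff_add_eq)
    thus "\<exists>c. \<forall>i. x $ i - z $ i = c" by blast
  qed
qed

instantiation trop_torus :: (finite) real_vector
begin

lift_definition zero_trop_torus :: "'a trop_torus" is 0 .

lift_definition plus_trop_torus :: "'a trop_torus \<Rightarrow> 'a trop_torus \<Rightarrow> 'a trop_torus" is "(+)"
proof -
  fix a b c d :: "real^'a"
  assume "\<exists>k. \<forall>i. a $ i - b $ i = k" "\<exists>k. \<forall>i. c $ i - d $ i = k"
  then obtain k l where "\<And>i. a $ i - b $ i = k" "\<And>i. c $ i - d $ i = l" by blast
  thus "\<exists>k. \<forall>i. (a + c) $ i - (b + d) $ i = k"
    by (intro exI[of _ "k + l"]) (simp add: add_diff_add)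
qed

lift_definition uminus_trop_torus :: "'a trop_torus \<Rightarrow> 'a trop_torus" is uminus
  by (metis minus_diff_eq minus_diff_minus vector_uminus_component)

lift_definition minus_trop_torus :: "'a trop_torus \<Rightarrow> 'a trop_torus \<Rightarrow> 'a trop_torus" is "(-)"
proof -
  fix a b c d :: "real^'a"
  assume "\<exists>k. \<forall>i. a $ i - b $ i = k" "\<exists>k. \<forall>i. c $ i - d $ i = k"
  then obtain k l where "\<And>i. a $ i - b $ i = k" "\<And>i. c $ i - d $ i = l" by blast
  moreover have "(a - c) $ i - (b - d) $ i = (a $ i - b $ i) - (c $ i - d $ i)" for i
    by simp
  ultimately show "\<exists>k. \<forall>i. (a - c) $ i - (b - d) $ i = k" by metis
qed

lift_definition scaleR_trop_torus :: "real \<Rightarrow> 'a trop_torus \<Rightarrow> 'a trop_torus" is "(*\<^sub>R)"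
  by (metis real_scaleR_def right_diff_distrib vector_scaleR_component)

instance
  by standard (transfer, simp add: algebra_simps)+

end

instantiation trop_torus :: (finite) topological_space
begin

definition open_trop_torus :: "'a trop_torus set \<Rightarrow> bool" where
  "open_trop_torus U \<longleftrightarrow> open (abs_trop_torus -` U)"

instance
  by standard (auto simp: open_trop_torus_def vimage_Union vimage_Int intro: open_Int)

end

definition polyhedral_cone :: "'v::real_vector set \<Rightarrow> bool" where
  "polyhedral_cone C \<longleftrightarrow> (\<exists>G. finite G \<and> C = convex_cone hull G)"

text \<open>The cones of a fan are not required to be strongly convex: all secondary cones contain
  the classes of affine functions.\<close>

definition is_fan :: "'v::real_vector set set \<Rightarrow> bool" where
  "is_fan F \<longleftrightarrow>
     finite F \<and>
     (\<forall>C\<in>F. polyhedral_cone C) \<and>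
     (\<forall>C\<in>F. \<forall>D. D face_of C \<and> D \<noteq> {} \<longrightarrow> D \<in> F) \<and>
     (\<forall>C\<in>F. \<forall>D\<in>F. C \<inter> D face_of C \<and> C \<inter> D face_of D)"

definition secondary_fan ::
  "(real \<times> real) set \<Rightarrow> ('n::finite \<Rightarrow> int \<times> int) \<Rightarrow> 'n trop_torus set set" where
  "secondary_fan \<Delta> e = {abs_trop_torus ` secondary_cone \<Delta> e S | S. coherent \<Delta> e S}"

definition effective :: "('n::finite \<Rightarrow> int \<times> int) \<Rightarrow> real ^ 'n \<Rightarrow> bool" where
  "effective e \<psi> \<longleftrightarrow> \<psi> = concave_hull_restr e \<psi>"

definition trop_rank :: "(real \<times> real) set \<Rightarrow> ('n::finite \<Rightarrow> int \<times> int) \<Rightarrow> real ^ 'n \<Rightarrow> nat" where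
  "trop_rank \<Delta> e \<psi> =
     dim (abs_trop_torus ` secondary_cone \<Delta> e (induced_subdivision \<Delta> e (concave_hull_restr e \<psi>)))"

section \<open>Projective space and its Zariski topology\<close>

text \<open>Points are punctured lines, i.e. sets of homogeneous coordinate vectors.\<close>

type_synonym ('k, 'n) proj_point = "('k ^ 'n) set"

definition proj_point :: "'k::field ^ 'n \<Rightarrow> ('k, 'n) proj_point" where
  "proj_point x = {l *s x | l. l \<noteq> 0}"

type_synonym ('k, 'n) mpolynomial = "('n \<Rightarrow>\<^sub>0 nat) \<Rightarrow>\<^sub>0 'k"

definition mpoly_eval :: "('k::field, 'n::finite) mpolynomial \<Rightarrow> 'k ^ 'n \<Rightarrow> 'k" where
  "mpoly_eval f x = (\<Sum>m\<in>Poly_Mapping.keys f.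
     Poly_Mapping.lookup f m * (\<Prod>i\<in>UNIV. x $ i ^ Poly_Mapping.lookup m i))"

definition homogeneous :: "('k::field, 'n::finite) mpolynomial \<Rightarrow> bool" where
  "homogeneous f \<longleftrightarrow> (\<exists>d. \<forall>m\<in>Poly_Mapping.keys f. (\<Sum>i\<in>UNIV. Poly_Mapping.lookup m i) = d)"

definition zariski_closed :: "('k::field, 'n::finite) proj_point set \<Rightarrow> bool" where
  "zariski_closed Z \<longleftrightarrow> (\<exists>E. (\<forall>f\<in>E. homogeneous f) \<and>
     Z = {proj_point x | x. x \<noteq> 0 \<and> (\<forall>f\<in>E. mpoly_eval f x = 0)})"

definition zariski_closure :: "('k::field, 'n::finite) proj_point set \<Rightarrow> ('k, 'n) proj_point set" where
  "zariski_closure Y = \<Inter>{Z. zariski_closed Z \<and> Y \<subseteq> Z}"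

definition irreducible_closed :: "('k::field, 'n::finite) proj_point set \<Rightarrow> bool" where
  "irreducible_closed Z \<longleftrightarrow> zariski_closed Z \<and> Z \<noteq> {} \<and>
     (\<forall>Z1 Z2. zariski_closed Z1 \<and> zariski_closed Z2 \<and> Z = Z1 \<union> Z2 \<longrightarrow> Z = Z1 \<or> Z = Z2)"

text \<open>Krull dimension of a closed subset; the empty set gets \<open>0\<close>.\<close>

definition variety_dim :: "('k::field, 'n::finite) proj_point set \<Rightarrow> enat" where
  "variety_dim X = Sup {enat d | d. \<exists>Z. (\<forall>i\<le>d. irreducible_closed (Z i) \<and> Z i \<subseteq> X) \<and>
     (\<forall>i<d. Z i \<subset> Z (Suc i))}"

section \<open>Curves on the toric surface of a lattice polygon\<close>

text \<open>The toric surface of \<open>\<Delta>\<close> is covered by the affine charts \<open>Spec K[S]\<close>, one for each vertex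
  \<open>v\<close> of \<open>\<Delta>\<close>, where \<open>S\<close> is the monoid of lattice points of the cone spanned by \<open>\<Delta> - v\<close>. The \<open>K\<close>-points
  of a chart are the monoid homomorphisms \<open>\<gamma>\<close> from \<open>S\<close> to the multiplicative monoid of \<open>K\<close>; only
  the values of \<open>\<gamma>\<close> on \<open>S\<close> matter. Points of different charts are identified via the projective
  embedding by the monomials \<open>x\<^sup>a\<close>, \<open>a \<in> \<Delta> \<inter> \<int>\<^sup>2\<close>.\<close>

type_synonym 'k laurent_poly = "(int \<times> int) \<Rightarrow>\<^sub>0 'k"

definition chart_monoid :: "(real \<times> real) set \<Rightarrow> int \<times> int \<Rightarrow> (int \<times> int) set" where
  "chart_monoid \<Delta> v = lattice_points (cone hull ((\<lambda>x. x - of_lattice v) ` \<Delta>))"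

definition chart_ring :: "(real \<times> real) set \<Rightarrow> int \<times> int \<Rightarrow> 'k::field laurent_poly set" where
  "chart_ring \<Delta> v = {g. Poly_Mapping.keys g \<subseteq> chart_monoid \<Delta> v}"

definition chart_point ::
  "(real \<times> real) set \<Rightarrow> int \<times> int \<Rightarrow> (int \<times> int \<Rightarrow> 'k::field) \<Rightarrow> bool" where
  "chart_point \<Delta> v \<gamma> \<longleftrightarrow> of_lattice v extreme_point_of \<Delta> \<and> \<gamma> 0 = 1 \<and>
     (\<forall>m\<in>chart_monoid \<Delta> v. \<forall>m'\<in>chart_monoid \<Delta> v. \<gamma> (m + m') = \<gamma> m * \<gamma> m')"

definition eval_at :: "(int \<times> int \<Rightarrow> 'k::field) \<Rightarrow> 'k laurent_poly \<Rightarrow> 'k" where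
  "eval_at \<gamma> g = (\<Sum>m\<in>Poly_Mapping.keys g. Poly_Mapping.lookup g m * \<gamma> m)"

definition surface_point ::
  "('n::finite \<Rightarrow> int \<times> int) \<Rightarrow> int \<times> int \<Rightarrow> (int \<times> int \<Rightarrow> 'k::field) \<Rightarrow> ('k, 'n) proj_point" where
  "surface_point e v \<gamma> = proj_point (\<chi> i. \<gamma> (e i - v))"

text \<open>The local equation \<open>x\<^sup>-\<^sup>v f\<close> of the curve defined by \<open>f = (\<Sum>i. c\<^sub>i x\<^bsup>e i\<^esup>)\<close>.\<close>

definition local_equation ::
  "('n::finite \<Rightarrow> int \<times> int) \<Rightarrow> 'k::field ^ 'n \<Rightarrow> int \<times> int \<Rightarrow> 'k laurent_poly" where
  "local_equation e c v = (\<Sum>i\<in>UNIV. Poly_Mapping.single (e i - v) (c $ i))"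

definition ideal_generated :: "'r::comm_ring_1 set \<Rightarrow> 'r set \<Rightarrow> 'r set" where
  "ideal_generated R G = {\<Sum>x\<in>H. r x * x | H r. finite H \<and> H \<subseteq> G \<and> r ` H \<subseteq> R}"

definition max_ideal ::
  "(real \<times> real) set \<Rightarrow> int \<times> int \<Rightarrow> (int \<times> int \<Rightarrow> 'k::field) \<Rightarrow> 'k laurent_poly set" where
  "max_ideal \<Delta> v \<gamma> = {g \<in> chart_ring \<Delta> v. eval_at \<gamma> g = 0}"

text \<open>The ideal \<open>(f) + M^k\<close> of the chart ring \<open>R\<close>, where \<open>f\<close> is the local equation of the curve
  and \<open>M\<close> the maximal ideal of the point. If \<open>\<O>\<close> is the local ring of the curve at the point and
  \<open>\<mm>\<close> its maximal ideal, then \<open>R / ((f) + M^k) = \<O> / \<mm>^k\<close>.\<close>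

definition nbhd_ideal ::
  "(real \<times> real) set \<Rightarrow> ('n::finite \<Rightarrow> int \<times> int) \<Rightarrow> 'k::field ^ 'n \<Rightarrow> int \<times> int \<Rightarrow>
     (int \<times> int \<Rightarrow> 'k) \<Rightarrow> nat \<Rightarrow> 'k laurent_poly set" where
  "nbhd_ideal \<Delta> e c v \<gamma> k = ideal_generated (chart_ring \<Delta> v)
     (insert (local_equation e c v) {prod_list gs | gs. length gs = k \<and> set gs \<subseteq> max_ideal \<Delta> v \<gamma>})"

text \<open>The one-dimensional local ring of the curve is regular iff \<open>\<mm> / \<mm>\<^sup>2\<close> has dimension one.\<close>

definition regular_at ::
  "(real \<times> real) set \<Rightarrow> ('n::finite \<Rightarrow> int \<times> int) \<Rightarrow> 'k::field ^ 'n \<Rightarrow> int \<times> int \<Rightarrow>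
     (int \<times> int \<Rightarrow> 'k) \<Rightarrow> bool" where
  "regular_at \<Delta> e c v \<gamma> \<longleftrightarrow>
     (\<exists>u \<in> max_ideal \<Delta> v \<gamma> - nbhd_ideal \<Delta> e c v \<gamma> 2.
        \<forall>g \<in> max_ideal \<Delta> v \<gamma>. \<exists>a. g - Poly_Mapping.single 0 a * u \<in> nbhd_ideal \<Delta> e c v \<gamma> 2)"

text \<open>The power series ring \<open>K[[x,y]]\<close> is the type \<open>'k fps fps\<close>. The completed local ring of a
  curve at a node (ordinary double point) is isomorphic to \<open>K[[x,y]]/(xy)\<close>.\<close>

definition fps_xy :: "'k::field fps fps" where
  "fps_xy = fps_X * fps_const fps_X"

definition fps_node_ideal :: "nat \<Rightarrow> 'k::field fps fps set" where
  "fps_node_ideal k = {F. \<exists>G. (\<forall>i j. i + j < k \<longrightarrow> fps_nth (fps_nth G i) j = 0) \<and> fps_xy dvd (F - G)}"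

text \<open>An isomorphism of \<open>K\<close>-algebras from the completion \<open>lim\<^sub>k R / ((f) + M^k)\<close> to
  \<open>K[[x,y]]/(xy) = lim\<^sub>k K[[x,y]] / ((xy) + (x,y)^k)\<close> is given by a homomorphism from \<open>R\<close> to
  \<open>K[[x,y]]/(xy)\<close> (with values lifted to \<open>K[[x,y]]\<close> below) which induces isomorphisms between
  the quotients for all \<open>k\<close>.\<close>

definition node_at ::
  "(real \<times> real) set \<Rightarrow> ('n::finite \<Rightarrow> int \<times> int) \<Rightarrow> 'k::field ^ 'n \<Rightarrow> int \<times> int \<Rightarrow>
     (int \<times> int \<Rightarrow> 'k) \<Rightarrow> bool" where
  "node_at \<Delta> e c v \<gamma> \<longleftrightarrow> (\<exists>\<Phi> :: 'k laurent_poly \<Rightarrow> 'k fps fps.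
     (\<forall>a. fps_xy dvd (\<Phi> (Poly_Mapping.single 0 a) - fps_const (fps_const a))) \<and>
     (\<forall>g\<in>chart_ring \<Delta> v. \<forall>h\<in>chart_ring \<Delta> v.
        fps_xy dvd (\<Phi> (g + h) - (\<Phi> g + \<Phi> h)) \<and> fps_xy dvd (\<Phi> (g * h) - \<Phi> g * \<Phi> h)) \<and>
     (\<forall>k. (\<forall>F. \<exists>g\<in>chart_ring \<Delta> v. F - \<Phi> g \<in> fps_node_ideal k) \<and>
          {g \<in> chart_ring \<Delta> v. \<Phi> g \<in> fps_node_ideal k} = nbhd_ideal \<Delta> e c v \<gamma> k))"

definition curve_singular_points ::
  "(real \<times> real) set \<Rightarrow> ('n::finite \<Rightarrow> int \<times> int) \<Rightarrow> 'k::field ^ 'n \<Rightarrow> ('k, 'n) proj_point set" where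
  "curve_singular_points \<Delta> e c = {surface_point e v \<gamma> | v \<gamma>.
     chart_point \<Delta> v \<gamma> \<and> eval_at \<gamma> (local_equation e c v) = 0 \<and> \<not> regular_at \<Delta> e c v \<gamma>}"

definition curve_nodes ::
  "(real \<times> real) set \<Rightarrow> ('n::finite \<Rightarrow> int \<times> int) \<Rightarrow> 'k::field ^ 'n \<Rightarrow> ('k, 'n) proj_point set" where
  "curve_nodes \<Delta> e c = {surface_point e v \<gamma> | v \<gamma>.
     chart_point \<Delta> v \<gamma> \<and> eval_at \<gamma> (local_equation e c v) = 0 \<and> node_at \<Delta> e c v \<gamma>}"

section \<open>Severi varieties and their tropicalizations\<close>

definition severi_variety ::
  "(real \<times> real) set \<Rightarrow> ('n::finite \<Rightarrow> int \<times> int) \<Rightarrow> nat \<Rightarrow> (puiseux, 'n) proj_point set" where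
  "severi_variety \<Delta> e \<delta> = zariski_closure {proj_point c | c. c \<noteq> 0 \<and>
     finite (curve_nodes \<Delta> e c) \<and> card (curve_nodes \<Delta> e c) = \<delta> \<and>
     curve_singular_points \<Delta> e c = curve_nodes \<Delta> e c}"

definition tropicalization :: "(puiseux, 'n::finite) proj_point set \<Rightarrow> 'n trop_torus set" where
  "tropicalization X = closure
     {abs_trop_torus (\<chi> i. of_rat (puiseux_val (c $ i))) | c. (\<forall>i. c $ i \<noteq> 0) \<and> proj_point c \<in> X}"

end

theory Submission
  imports
    Defs
    "HOL-Computational_Algebra.Fundamental_Theorem_Algebra"
    "HOL-Library.Function_Algebras"
begin

text \<open>Let \<open>\<psi>\<close> be as in the hypothesis. If the tropical Severi variety were a union of cones of the
  secondary fan, it would contain a secondary cone through \<open>\<psi>\<close>. A secondary cone through \<open>\<psi>\<close>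
  contains, together with \<open>\<psi>\<close>, the whole cone of the subdivision induced by the concave hull of
  \<open>\<psi>\<close>. All functions in the latter cone are affine on the lattice points of each cell, while
  \<open>\<psi>\<close> is not, because it is not effective. Hence the tropical Severi variety contains a cone of
  dimension greater than the rank of \<open>\<psi>\<close>, that is, greater than the dimension of the variety.

  This contradicts the inequality \<open>dim Trop X \<le> dim X\<close>: if \<open>X\<close> has dimension less than \<open>r\<close>, then any
  \<open>r + 1\<close> homogeneous coordinates satisfy a polynomial relation on \<open>X\<close>, and on points of the torus
  two monomials of that relation have the same valuation, so that \<open>Trop X\<close> lies in a finite union of
  hyperplanes. The lower bound for the Krull dimension needs that the field is algebraically closed:
  a root of a polynomial is a holomorphic function on a half plane, obtained by lifting along the
  covering formed by the roots, and it is periodic because its translates are again roots.\<close>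

section \<open>Puiseux series as germs of holomorphic functions\<close>

text \<open>\<open>variety_dim\<close> is a supremum over chains of irreducible closed sets, so a
  large tropicalization has to produce an actual long chain. It comes from slicing: coordinates
  without a polynomial relation on an affine part of \<open>X\<close> take generically prescribed
  values there, and fixing them one by one, each time at a constant for which no component lies in
  the slice, gains one strict inclusion per coordinate. Prescribing the values is where roots are
  needed: each remaining coordinate is a root of a polynomial over the previous ones. On the
  tropical side the cone through \<psi> enters through a curve, the sum of s^(k+1) v_k for s > 0,
  with independent vectors v_k in the cone. The constant vector, which spans the kernel of the
  projection to the tropical torus, contributes one more dimension; it is balanced by the coordinate
  that is set to 1 in the affine part. In the construction of roots, t = exp s turns a loop around t
  = infinity into the translation by 2 pi i, so a finite orbit of roots yields a common denominator
  of the exponents.\<close>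

definition right_end :: "complex filter" where
  "right_end = filtercomap Re at_top"

lemma eventually_right_end: "eventually P right_end \<longleftrightarrow> (\<exists>T. \<forall>s. T < Re s \<longrightarrow> P s)"
  unfolding right_end_def by (rule eventually_filtercomap_at_top_dense)

lemma eventually_right_end_gt: "\<forall>\<^sub>F s in right_end. T < Re s"
  unfolding eventually_right_end by blast

lemma right_end_nontrivial: "right_end \<noteq> bot"
  unfolding trivial_limit_def eventually_right_end by (metis Re_complex_of_real less_add_one)

text \<open>With t = exp s, \<open>exp (- s / of_nat N)\<close> is the local parameter t^(-1/N) at
  infinity, in which \<open>series_of_fls N F\<close> is the Laurent series \<open>F\<close>.
  Statements near 0 pull back along this limit to statements on a half plane.\<close>

lemma filterlim_exp_right_end:
  assumes "N > 0"
  shows "filterlim (\<lambda>s. exp (- s / of_nat N)) (at 0) right_end"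
proof -
  have "filterlim (\<lambda>s. exp (- Re s / real N)) (nhds 0) right_end"
  proof -
    have "filterlim (\<lambda>x::real. exp (- x / real N)) (nhds 0) at_top"
      using assms by real_asymp
    thus ?thesis unfolding right_end_def by (rule filterlim_compose[OF _ filterlim_filtercomap])
  qed
  hence "filterlim (\<lambda>s. norm (exp (- s / complex_of_nat N))) (nhds 0) right_end"
    by (simp add: norm_exp_eq_Re Re_divide_of_nat)
  hence "filterlim (\<lambda>s. exp (- s / complex_of_nat N)) (nhds 0) right_end"
    by (rule tendsto_norm_zero_cancel)
  thus ?thesis unfolding filterlim_at by simp
qed

lemma eventually_exp_small:
  assumes "N > 0" "r > 0"
  shows "\<forall>\<^sub>F s in right_end. ereal (norm (exp (- s / of_nat N))) < r"
proof -
  obtain r' where r': "0 < ereal r'" "ereal r' < r" using ereal_dense2[OF assms(2)] by auto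
  have "\<forall>\<^sub>F z::complex in at 0. norm z < r'"
    using r' by (intro eventually_at_ball[of r' 0 UNIV, THEN eventually_mono]) (auto simp: dist_norm)
  hence "\<forall>\<^sub>F s in right_end. norm (exp (- s / of_nat N)) < r'"
    using filterlim_exp_right_end[OF assms(1)] unfolding filterlim_iff by blast
  thus ?thesis
    by (rule eventually_mono) (use r'(2) in \<open>auto intro: less_trans[OF _ r'(2)]\<close>)
qed

text \<open>The variable of the Puiseux series is substituted by \<open>exp s\<close>, so that the series converges to a
  single-valued function on a right half plane.\<close>

definition germ :: "puiseux \<Rightarrow> complex \<Rightarrow> complex" where
  "germ c s = (\<Sum>\<^sub>\<infinity>\<tau>. puiseux_coeff c \<tau> * exp (of_rat \<tau> * s))"

lemma germ_eq_eval_fls: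
  assumes N: "N > 0" and c: "puiseux_coeff c = series_of_fls N F"
    and r: "ereal (norm (exp (- s / of_nat N))) < fls_conv_radius F"
  shows "germ c s = eval_fls F (exp (- s / of_nat N))"
proof -
  define \<zeta> where "\<zeta> = exp (- s / of_nat N)"
  define n where "n = fls_subdegree F"
  \<comment> \<open>The support of the series lies in the image of \<open>h\<close>; starting at the
    subdegree \<open>n\<close> makes the index a natural number.\<close>
  define h :: "nat \<Rightarrow> rat" where "h = (\<lambda>k. - (of_int (n + int k) / of_nat N))"
  have inj: "inj h" using N by (auto simp: h_def inj_def field_simps)
  have zero: "series_of_fls N F \<tau> = 0" if "\<tau> \<notin> range h" for \<tau>
  proof (rule ccontr)
    assume "series_of_fls N F \<tau> \<noteq> 0"
    then obtain k where k: "\<tau> = - (of_int k / of_nat N)" "fls_nth F k \<noteq> 0"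
      using N by (elim series_of_fls_nonzeroE)
    from k(2) have "n \<le> k" unfolding n_def by (rule fls_subdegree_leI)
    hence "\<tau> = h (nat (k - n))" using k(1) by (simp add: h_def)
    with that show False by blast
  qed
  have pw: "exp (of_rat (h k) * s) = \<zeta> ^ k * \<zeta> powi n" for k
  proof -
    have "exp (of_rat (h k) * s) = exp (of_int (n + int k) * (- s / of_nat N))"
      using N by (simp add: h_def of_rat_divide of_rat_minus of_rat_add field_simps)
    also have "\<dots> = \<zeta> powi (n + int k)" unfolding \<zeta>_def by (rule exp_power_int[symmetric])
    finally show ?thesis by (simp add: power_int_add \<zeta>_def mult.commute)
  qed
  have "germ c s = infsum (\<lambda>\<tau>. series_of_fls N F \<tau> * exp (of_rat \<tau> * s)) (range h)"
    unfolding germ_def c by (rule infsum_cong_neutral) (auto simp: zero)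
  also have "\<dots> = infsum (\<lambda>k. series_of_fls N F (h k) * exp (of_rat (h k) * s)) UNIV"
    using inj by (subst infsum_reindex) (auto simp: o_def)
  also have "(\<lambda>k. series_of_fls N F (h k) * exp (of_rat (h k) * s)) =
     (\<lambda>k. fps_nth (fls_base_factor_to_fps F) k * \<zeta> ^ k * \<zeta> powi n)"
    unfolding pw unfolding h_def using N by (simp only: series_of_fls_at) (simp add: n_def add_ac mult.assoc)
  also have "infsum \<dots> UNIV = infsum (\<lambda>k. fps_nth (fls_base_factor_to_fps F) k * \<zeta> ^ k) UNIV * \<zeta> powi n"
    by (rule infsum_cmult_left')
  also have "infsum (\<lambda>k. fps_nth (fls_base_factor_to_fps F) k * \<zeta> ^ k) UNIV = eval_fps (fls_base_factor_to_fps F) \<zeta>"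
  proof -
    have "ereal (norm \<zeta>) < fps_conv_radius (fls_base_factor_to_fps F)"
      using r by (simp add: \<zeta>_def fls_conv_radius_altdef)
    hence "summable (\<lambda>k. norm (fps_nth (fls_base_factor_to_fps F) k * \<zeta> ^ k))"
      unfolding fps_conv_radius_def by (rule abs_summable_in_conv_radius)
    hence "((\<lambda>k. fps_nth (fls_base_factor_to_fps F) k * \<zeta> ^ k) has_sum
              suminf (\<lambda>k. fps_nth (fls_base_factor_to_fps F) k * \<zeta> ^ k)) UNIV"
      by (intro norm_summable_imp_has_sum) (auto intro: summable_sums summable_norm_cancel)
    thus ?thesis unfolding eval_fps_def by (rule infsumI)
  qed
  finally show ?thesis by (simp add: eval_fls_def n_def \<zeta>_def)
qed

lemma puiseux_coeff_locally_convergent: "locally_convergent_puiseux (puiseux_coeff c)"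
  using puiseux_coeff by auto

lemma puiseux_coeff_series_of_fls:
  assumes "N > 0" "fls_conv_radius F > 0"
  shows "puiseux_coeff (Abs_puiseux (series_of_fls N F)) = series_of_fls N F"
  using assms by (simp add: Abs_puiseux_inverse locally_convergent_series_of_fls)

lemma puiseux_eq_series:
  obtains N F where "N > 0" "fls_conv_radius F > 0" "puiseux_coeff c = series_of_fls N F"
  using two_puiseux_cases[OF puiseux_coeff_locally_convergent puiseux_coeff_locally_convergent] by metis

lemma germ_0: "germ 0 s = 0"
  unfolding germ_def by (simp add: zero_puiseux.rep_eq)

lemma germ_1: "germ 1 s = 1"
proof -
  have "germ 1 s = infsum (\<lambda>\<tau>. puiseux_coeff 1 \<tau> * exp (of_rat \<tau> * s)) {0}"
    unfolding germ_def by (rule infsum_cong_neutral) (auto simp: one_puiseux.rep_eq)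
  thus ?thesis by (simp add: one_puiseux.rep_eq)
qed

lemma germ_add: "\<forall>\<^sub>F s in right_end. germ (c + d) s = germ c s + germ d s"
  and germ_mult: "\<forall>\<^sub>F s in right_end. germ (c * d) s = germ c s * germ d s"
proof -
  obtain N F G where N: "N > 0" and F: "fls_conv_radius F > 0" and G: "fls_conv_radius G > 0"
    and c: "puiseux_coeff c = series_of_fls N F" and d: "puiseux_coeff d = series_of_fls N G"
    using two_puiseux_cases[OF puiseux_coeff_locally_convergent puiseux_coeff_locally_convergent] by metis
  have sum: "puiseux_coeff (c + d) = series_of_fls N (F + G)"
    by (simp add: plus_puiseux.rep_eq c d series_of_fls_add)
  have prod: "puiseux_coeff (c * d) = series_of_fls N (F * G)"
    using N by (simp add: times_puiseux.rep_eq c d series_of_fls_mult)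
  note ev = eventually_exp_small[OF N F] eventually_exp_small[OF N G]
  note evs = ev eventually_exp_small[OF N fls_conv_radius_pos_closed(1)[OF F G]]
  note evp = ev eventually_exp_small[OF N fls_conv_radius_pos_closed(2)[OF F G]]
  from evs show "\<forall>\<^sub>F s in right_end. germ (c + d) s = germ c s + germ d s"
    by eventually_elim
       (simp add: germ_eq_eval_fls[OF N c] germ_eq_eval_fls[OF N d] germ_eq_eval_fls[OF N sum] eval_fls_add)
  from evp show "\<forall>\<^sub>F s in right_end. germ (c * d) s = germ c s * germ d s"
    by eventually_elim
       (simp add: germ_eq_eval_fls[OF N c] germ_eq_eval_fls[OF N d] germ_eq_eval_fls[OF N prod] eval_fls_mult)
qed

text \<open>A nonzero Laurent series has no zero in some punctured neighbourhood of 0, so its germ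
  cannot vanish on a half plane.\<close>

lemma germ_eq_0:
  assumes "\<forall>\<^sub>F s in right_end. germ c s = 0"
  shows "c = 0"
proof -
  obtain N F where N: "N > 0" and F: "fls_conv_radius F > 0" and c: "puiseux_coeff c = series_of_fls N F"
    by (rule puiseux_eq_series)
  have "\<forall>\<^sub>F s in right_end. eval_fls F (exp (- s / of_nat N)) = 0"
    using assms eventually_exp_small[OF N F] by eventually_elim (simp add: germ_eq_eval_fls[OF N c])
  hence fr: "\<exists>\<^sub>F s in right_end. eval_fls F (exp (- s / of_nat N)) = 0"
    using eventually_frequently right_end_nontrivial by blast
  have "F = 0"
  proof (rule ccontr)
    assume "F \<noteq> 0"
    hence "\<forall>\<^sub>F z in at 0. eval_fls F z \<noteq> 0"
      using F has_laurent_expansion_eventually_nonzero_iff' eval_fls_has_laurent_expansion by blast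
    hence "\<forall>\<^sub>F s in right_end. eval_fls F (exp (- s / of_nat N)) \<noteq> 0"
      using filterlim_exp_right_end[OF N] unfolding filterlim_iff by blast
    with fr show False unfolding frequently_def by simp
  qed
  hence "puiseux_coeff c = puiseux_coeff 0" by (simp add: c series_of_fls_0 zero_puiseux.rep_eq)
  thus ?thesis by (simp add: puiseux_coeff_inject)
qed

text \<open>The period comes from the common denominator \<open>N\<close> of the exponents, the
  exponential bound from the leading exponent. By \<open>germ_surj\<close> these properties
  characterize germs.\<close>

lemma germ_regular:
  obtains N T M where "N > 0" "germ c holomorphic_on {s. T < Re s}"
    "\<And>s. T < Re s \<Longrightarrow> germ c (s + of_nat N * (2 * of_real pi * \<i>)) = germ c s"
    "\<And>s. T < Re s \<Longrightarrow> norm (germ c s) \<le> exp (M * Re s)"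
proof -
  obtain N F where N: "N > 0" and F: "fls_conv_radius F > 0" and c: "puiseux_coeff c = series_of_fls N F"
    by (rule puiseux_eq_series)
  define n where "n = fls_subdegree F"
  define G where "G = fls_base_factor_to_fps F"
  have G: "fps_conv_radius G > 0" using F by (simp add: G_def fls_conv_radius_altdef)
  have "isCont (eval_fps G) 0"
    by (rule continuous_eval_fps) (use G in \<open>auto simp: zero_ereal_def\<close>)
  hence "(eval_fps G \<longlongrightarrow> eval_fps G 0) (at 0)" unfolding isCont_def .
  hence "((\<lambda>z. norm (eval_fps G z)) \<longlongrightarrow> norm (eval_fps G 0)) (at 0)" by (rule tendsto_norm)
  hence "\<forall>\<^sub>F z in at 0. norm (eval_fps G z) < norm (eval_fps G 0) + 1"
    by (rule order_tendstoD) simp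
  hence "\<forall>\<^sub>F s in right_end. norm (eval_fps G (exp (- s / of_nat N))) < norm (eval_fps G 0) + 1"
    using filterlim_exp_right_end[OF N] unfolding filterlim_iff by blast
  hence "\<forall>\<^sub>F s in right_end. 1 < Re s \<and> ereal (norm (exp (- s / of_nat N))) < fls_conv_radius F \<and>
      norm (eval_fps G (exp (- s / of_nat N))) < norm (eval_fps G 0) + 1"
    using eventually_right_end_gt[of 1] eventually_exp_small[OF N F] by eventually_elim auto
  then obtain T where T: "\<And>s. T < Re s \<Longrightarrow> 1 < Re s"
     "\<And>s. T < Re s \<Longrightarrow> ereal (norm (exp (- s / of_nat N))) < fls_conv_radius F"
     "\<And>s. T < Re s \<Longrightarrow> norm (eval_fps G (exp (- s / of_nat N))) < norm (eval_fps G 0) + 1"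
    unfolding eventually_right_end by blast
  \<comment> \<open>As \<open>Re s > 1\<close>, the constant factor can be moved into the
    exponent.\<close>
  define M where "M = ln (norm (eval_fps G 0) + 1) + \<bar>of_int n / real N\<bar>"
  have eq: "germ c s = eval_fls F (exp (- s / of_nat N))" if "T < Re s" for s
    using germ_eq_eval_fls[OF N c T(2)[OF that]] .
  have "(\<lambda>s. eval_fls F (exp (- s / of_nat N))) holomorphic_on {s. T < Re s}"
    using N T(2) by (intro holomorphic_intros) (auto simp: in_eball_iff)
  hence "germ c holomorphic_on {s. T < Re s}"
    by (rule holomorphic_transform) (simp add: eq)
  moreover have "germ c (s + of_nat N * (2 * of_real pi * \<i>)) = germ c s" if s: "T < Re s" for s
  proof -
    have "exp (- (s + of_nat N * (2 * of_real pi * \<i>)) / of_nat N) = exp (- s / of_nat N - 2 * of_real pi * \<i>)"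
      using N by (simp add: field_simps)
    also have "\<dots> = exp (- s / of_nat N)" by (simp add: exp_diff)
    finally show ?thesis using s by (subst (1 2) eq) auto
  qed
  moreover have "norm (germ c s) \<le> exp (M * Re s)" if s: "T < Re s" for s
  proof -
    have "norm (germ c s) = norm (eval_fps G (exp (- s / of_nat N))) * norm (exp (- s / of_nat N) powi n)"
      by (simp add: eq[OF s] eval_fls_def norm_mult G_def n_def)
    also have "\<dots> \<le> (norm (eval_fps G 0) + 1) * norm (exp (- s / of_nat N) powi n)"
      using T(3)[OF s] by (intro mult_right_mono) auto
    also have "norm (exp (- s / of_nat N) powi n) = exp (- (of_int n / real N) * Re s)"
      using N by (simp add: exp_power_int norm_exp_eq_Re Re_divide_of_nat)
    also have "(norm (eval_fps G 0) + 1) = exp (ln (norm (eval_fps G 0) + 1))"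
      by (subst exp_ln) (auto intro: add_nonneg_pos)
    also have "\<dots> * exp (- (of_int n / real N) * Re s) = exp (ln (norm (eval_fps G 0) + 1) - (of_int n / real N) * Re s)"
      by (simp add: exp_diff exp_minus field_simps)
    also have "\<dots> \<le> exp (M * Re s)"
    proof -
      have "0 \<le> ln (norm (eval_fps G 0) + 1)" by simp
      hence "ln (norm (eval_fps G 0) + 1) \<le> ln (norm (eval_fps G 0) + 1) * Re s"
        using T(1)[OF s] by (metis less_eq_real_def mult_left_mono mult.right_neutral)
      moreover have "- (of_int n / real N) * Re s \<le> \<bar>of_int n / real N\<bar> * Re s"
        using T(1)[OF s] by (intro mult_right_mono abs_ge_minus_self) simp
      ultimately show ?thesis by (simp add: M_def distrib_right)
    qed
    finally show ?thesis .
  qed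
  ultimately show ?thesis using that N by blast
qed

section \<open>Recognizing germs among periodic holomorphic functions\<close>

lemma periodic_int:
  fixes w :: "complex \<Rightarrow> 'a" and p :: complex
  assumes "\<And>s. T < Re s \<Longrightarrow> w (s + p) = w s" and "Re p = 0" and "T < Re s"
  shows "w (s + of_int k * p) = w s"
proof -
  have *: "w (s + of_nat m * p) = w s" if "T < Re s" for m s
  proof (induction m)
    case (Suc m)
    have "w (s + of_nat (Suc m) * p) = w ((s + of_nat m * p) + p)" by (simp add: algebra_simps)
    also have "\<dots> = w (s + of_nat m * p)" using assms(2) that by (intro assms(1)) simp
    finally show ?case using Suc by simp
  qed simp
  show ?thesis
  proof (cases k)
    case (nonneg n)
    thus ?thesis using *[OF assms(3), of n] by simp
  next
    case (neg n)
    have "w ((s + of_int k * p) + of_nat (Suc n) * p) = w (s + of_int k * p)"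
      using assms by (intro *) simp
    moreover have "(s + of_int k * p) + of_nat (Suc n) * p = s"
      unfolding neg by (simp add: algebra_simps)
    ultimately show ?thesis by (metis)
  qed
qed

text \<open>Periodicity lets \<open>w\<close> descend to a function \<open>g\<close> of the
  parameter \<zeta> = exp (-s/N) on a punctured disc. The growth bound leaves at worst a pole at 0,
  and the Laurent expansion of \<open>g\<close> there is the required series.\<close>

lemma germ_surj:
  assumes N: "N > 0" and hol: "w holomorphic_on {s. T < Re s}"
    and per: "\<And>s. T < Re s \<Longrightarrow> w (s + of_nat N * (2 * of_real pi * \<i>)) = w s"
    and bd: "\<And>s. T < Re s \<Longrightarrow> norm (w s) \<le> C * exp (M * Re s)"
  obtains y where "\<forall>\<^sub>F s in right_end. germ y s = w s"
proof -
  define \<rho> where "\<rho> = exp (- T / real N)"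
  have \<rho>: "\<rho> > 0" by (simp add: \<rho>_def)
  define g where "g = (\<lambda>\<zeta>. w (- of_nat N * Ln \<zeta>))"
  have T: "T < Re (- of_nat N * L)" if "norm (exp L) < \<rho>" for L
  proof -
    have "Re L < - T / real N" using that by (simp add: \<rho>_def)
    thus ?thesis using N by (simp add: field_simps)
  qed
  \<comment> \<open>Independence of the branch: two logarithms differ by a multiple of 2 pi i, so
    the arguments of \<open>w\<close> differ by a multiple of its period.\<close>
  have g: "g (exp L) = w (- of_nat N * L)" if L: "norm (exp L) < \<rho>" for L
  proof -
    have "exp (Ln (exp L)) = exp L" by simp
    then obtain n :: int where n: "Ln (exp L) = L + of_int (2 * n) * of_real pi * \<i>"
      unfolding exp_eq by auto
    have "g (exp L) = w (- of_nat N * L + of_int (- n) * (of_nat N * (2 * of_real pi * \<i>)))"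
      unfolding g_def n by (simp add: algebra_simps)
    also have "\<dots> = w (- of_nat N * L)"
      using per T[OF L] by (intro periodic_int[of T]) auto
    finally show ?thesis .
  qed
  let ?D = "ball 0 \<rho> - {0::complex}"
  have hol_g: "g holomorphic_on ?D"
  proof -
    \<comment> \<open>Two slit discs cover the punctured disc: \<open>Ln\<close> is holomorphic on
      the first, and \<open>Ln (- z) + \<i> * of_real pi\<close> is a branch of the logarithm on the
      second.\<close>
    let ?A = "ball (0::complex) \<rho> - \<real>\<^sub>\<le>\<^sub>0" and ?B = "ball (0::complex) \<rho> - \<real>\<^sub>\<ge>\<^sub>0"
    have "open ?A" by (intro open_Diff) auto
    have "open ?B" by (intro open_Diff) auto
    have "g holomorphic_on ?A"
    proof -
      have "(w \<circ> (\<lambda>z. - of_nat N * Ln z)) holomorphic_on ?A"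
      proof (rule holomorphic_on_compose_gen[OF _ hol])
        show "(\<lambda>z. - of_nat N * Ln z) holomorphic_on ?A" by (intro holomorphic_intros) auto
        show "(\<lambda>z. - of_nat N * Ln z) ` ?A \<subseteq> {s. T < Re s}"
        proof safe
          fix z :: complex assume "z \<in> ball 0 \<rho>" "z \<notin> \<real>\<^sub>\<le>\<^sub>0"
          hence "z \<noteq> 0" "z \<in> ball 0 \<rho>" by auto
          hence "norm (exp (Ln z)) < \<rho>" by (subst exp_Ln) auto
          thus "T < Re (- of_nat N * Ln z)" by (intro T)
        qed
      qed
      thus ?thesis by (simp add: g_def o_def)
    qed
    moreover have "g holomorphic_on ?B"
    proof -
      have e: "exp (Ln (- z) + \<i> * of_real pi) = z" if "z \<noteq> 0" for z
        using that by (simp add: exp_add mult.commute)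
      have "(w \<circ> (\<lambda>z. - of_nat N * (Ln (- z) + \<i> * of_real pi))) holomorphic_on ?B"
      proof (rule holomorphic_on_compose_gen[OF _ hol])
        show "(\<lambda>z. - of_nat N * (Ln (- z) + \<i> * of_real pi)) holomorphic_on ?B"
          by (intro holomorphic_intros) auto
        show "(\<lambda>z. - of_nat N * (Ln (- z) + \<i> * of_real pi)) ` ?B \<subseteq> {s. T < Re s}"
        proof safe
          fix z :: complex assume "z \<in> ball 0 \<rho>" "z \<notin> \<real>\<^sub>\<ge>\<^sub>0"
          hence "z \<noteq> 0" "z \<in> ball 0 \<rho>" by auto
          hence "norm (exp (Ln (- z) + \<i> * of_real pi)) < \<rho>" by (subst e) auto
          thus "T < Re (- of_nat N * (Ln (- z) + \<i> * of_real pi))" by (intro T)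
        qed
      qed
      moreover have "(w \<circ> (\<lambda>z. - of_nat N * (Ln (- z) + \<i> * of_real pi))) z = g z" if "z \<in> ?B" for z
      proof -
        from that have z: "z \<noteq> 0" "z \<in> ball 0 \<rho>" by auto
        hence "norm (exp (Ln (- z) + \<i> * of_real pi)) < \<rho>" by (subst e) auto
        thus ?thesis using g[of "Ln (- z) + \<i> * of_real pi"] e[OF z(1)] by simp
      qed
      ultimately show ?thesis by (rule holomorphic_transform)
    qed
    ultimately have "g holomorphic_on ?A \<union> ?B"
      using \<open>open ?A\<close> \<open>open ?B\<close> by (rule holomorphic_on_Un)
    moreover have "?A \<union> ?B = ?D" by (auto simp: complex_nonpos_Reals_iff complex_nonneg_Reals_iff complex_eq_iff)
    ultimately show ?thesis by simp
  qed
  have iso: "isolated_singularity_at g 0"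
    by (rule isolated_singularity_at_holomorphic[of _ "ball 0 \<rho>"]) (use hol_g \<rho> in auto)
  \<comment> \<open>\<open>K\<close> exceeds the order of growth \<open>M * real N\<close> by at
    least 1, so that \<open>z ^ K * g z\<close> tends to 0 at 0.\<close>
  define K where "K = nat \<lceil>\<bar>M * real N\<bar>\<rceil> + 1"
  have K: "M * real N + 1 \<le> real K" unfolding K_def by linarith
  have bg: "norm (z ^ K * g z) \<le> \<bar>C\<bar> * norm z" if z: "z \<noteq> 0" "norm z < \<rho>" "norm z < 1" for z
  proof -
    have "norm (g z) \<le> C * exp (M * Re (- of_nat N * Ln z))"
      unfolding g_def using z by (intro bd T) simp
    also have "\<dots> \<le> \<bar>C\<bar> * exp (M * Re (- of_nat N * Ln z))" by (intro mult_right_mono) auto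
    also have "M * Re (- of_nat N * Ln z) = - (M * real N) * ln (norm z)" using z by simp
    also have "exp \<dots> = norm z powr (- (M * real N))" using z by (simp add: powr_def)
    finally have "norm (g z) \<le> \<bar>C\<bar> * norm z powr (- (M * real N))" .
    hence "norm (z ^ K * g z) \<le> norm z powr real K * (\<bar>C\<bar> * norm z powr (- (M * real N)))"
      using z by (simp add: norm_mult norm_power powr_realpow mult_left_mono)
    also have "\<dots> = \<bar>C\<bar> * norm z powr (real K - M * real N)"
      by (simp add: powr_diff powr_minus field_simps)
    also have "norm z powr (real K - M * real N) \<le> norm z powr 1"
      using z K by (intro powr_mono') auto
    finally show ?thesis using z by (simp add: mult_left_mono)
  qed
  have "((\<lambda>z. z ^ K * g z) \<longlongrightarrow> 0) (at 0)"
  proof (rule Lim_null_comparison)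
    have "\<forall>\<^sub>F z::complex in at 0. z \<in> ball 0 (min \<rho> 1) - {0}"
      using \<rho> by (intro eventually_at_in_open) auto
    thus "\<forall>\<^sub>F z in at 0. norm (z ^ K * g z) \<le> \<bar>C\<bar> * norm z"
      by eventually_elim (use bg in auto)
    show "((\<lambda>z::complex. \<bar>C\<bar> * norm z) \<longlongrightarrow> 0) (at 0)"
      by (auto intro!: tendsto_eq_intros)
  qed
  hence ne1: "not_essential (\<lambda>z. z ^ K * g z) 0" unfolding not_essential_def by blast
  have iso1: "isolated_singularity_at (\<lambda>z. z ^ K * g z) 0"
    by (rule isolated_singularity_at_holomorphic[of _ "ball 0 \<rho>"])
       (use hol_g \<rho> in \<open>auto intro!: holomorphic_intros\<close>)
  have "(\<lambda>z. z ^ K * g z) has_laurent_expansion laurent_expansion (\<lambda>z. z ^ K * g z) 0"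
    using iso1 ne1 by (rule not_essential_has_laurent_expansion_0)
  hence "(\<lambda>z. (z ^ K * g z) / z ^ K) has_laurent_expansion laurent_expansion (\<lambda>z. z ^ K * g z) 0 / fls_X ^ K"
    by (intro laurent_expansion_intros)
  then obtain F where "(\<lambda>z. (z ^ K * g z) / z ^ K) has_laurent_expansion F" by blast
  hence F: "fls_conv_radius F > 0" "\<forall>\<^sub>F z in at 0. eval_fls F z = (z ^ K * g z) / z ^ K"
    unfolding has_laurent_expansion_def by auto
  define y where "y = Abs_puiseux (series_of_fls N F)"
  have y: "puiseux_coeff y = series_of_fls N F"
    unfolding y_def using N F(1) by (rule puiseux_coeff_series_of_fls)
  have "\<forall>\<^sub>F s in right_end. eval_fls F (exp (- s / of_nat N)) =
     (exp (- s / of_nat N) ^ K * g (exp (- s / of_nat N))) / exp (- s / of_nat N) ^ K"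
    using F(2) filterlim_exp_right_end[OF N] unfolding filterlim_iff by blast
  hence "\<forall>\<^sub>F s in right_end. germ y s = w s"
    using eventually_exp_small[OF N F(1)] eventually_exp_small[OF N, of "ereal \<rho>", simplified, OF \<rho>]
  proof eventually_elim
    case (elim s)
    have "germ y s = eval_fls F (exp (- s / of_nat N))"
      using elim by (intro germ_eq_eval_fls[OF N y])
    also have "\<dots> = g (exp (- s / of_nat N))" using elim by simp
    also have "\<dots> = w (- of_nat N * (- s / of_nat N))" using elim by (intro g) simp
    finally show ?case using N by simp
  qed
  thus ?thesis by (rule that)
qed

section \<open>Specializing polynomials with Puiseux coefficients\<close>

definition germ_poly :: "complex \<Rightarrow> puiseux poly \<Rightarrow> complex poly" where
  "germ_poly s p = map_poly (\<lambda>c. germ c s) p"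

lemma coeff_germ_poly: "coeff (germ_poly s p) i = germ (coeff p i) s"
  unfolding germ_poly_def by (simp add: coeff_map_poly germ_0)

lemma germ_poly_pCons: "germ_poly s (pCons a p) = pCons (germ a s) (germ_poly s p)"
  by (rule poly_eqI) (simp add: coeff_germ_poly coeff_pCons split: nat.split)

lemma germ_poly_0 [simp]: "germ_poly s 0 = 0"
  by (rule poly_eqI) (simp add: coeff_germ_poly germ_0)

lemma germ_poly_1 [simp]: "germ_poly s 1 = 1"
  by (rule poly_eqI) (simp add: coeff_germ_poly germ_0 germ_1)

lemma germ_poly_add: "\<forall>\<^sub>F s in right_end. germ_poly s (p + q) = germ_poly s p + germ_poly s q"
proof (induction p q rule: poly_induct2)
  case (pCons a p b q)
  from pCons germ_add[of a b] show ?case by eventually_elim (simp add: germ_poly_pCons)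
qed simp

lemma germ_poly_smult: "\<forall>\<^sub>F s in right_end. germ_poly s (smult a p) = smult (germ a s) (germ_poly s p)"
proof (induction p)
  case (pCons b p)
  from pCons(2) germ_mult[of a b] show ?case by eventually_elim (simp add: germ_poly_pCons)
qed simp

lemma germ_poly_mult: "\<forall>\<^sub>F s in right_end. germ_poly s (p * q) = germ_poly s p * germ_poly s q"
proof (induction p)
  case (pCons a p)
  from pCons(2) germ_poly_add[of "smult a q" "pCons 0 (p * q)"] germ_poly_smult[of a q] show ?case
    by eventually_elim (simp add: germ_poly_pCons germ_0)
qed simp

lemma germ_poly_pderiv: "\<forall>\<^sub>F s in right_end. germ_poly s (pderiv p) = pderiv (germ_poly s p)"
proof (induction p)
  case (pCons a p)
  from pCons(2) germ_poly_add[of p "pCons 0 (pderiv p)"] show ?case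
    by eventually_elim (simp add: pderiv_pCons germ_poly_pCons germ_0)
qed simp

lemma germ_poly_poly: "\<forall>\<^sub>F s in right_end. germ (poly p y) s = poly (germ_poly s p) (germ y s)"
proof (induction p)
  case (pCons a p)
  from pCons(2) germ_add[of a "y * poly p y"] germ_mult[of y "poly p y"] show ?case
    by eventually_elim (simp add: germ_poly_pCons)
qed (simp add: germ_0)

section \<open>Holomorphic roots of families of polynomials\<close>

lemma rsquarefree_monic_prod_roots:
  fixes p :: "complex poly"
  assumes "rsquarefree p" "lead_coeff p = 1"
  shows "poly p x = (\<Prod>z|poly p z = 0. x - z)" "card {z. poly p z = 0} = degree p"
    "finite {z. poly p z = 0}"
proof -
  have eq: "(\<Prod>z|poly p z = 0. [:-z, 1:]) = p"
    using complex_poly_decompose_rsquarefree[OF assms(1)] assms(2) by simp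
  show "poly p x = (\<Prod>z|poly p z = 0. x - z)"
    by (subst eq[symmetric], subst poly_prod) simp
  show "card {z. poly p z = 0} = degree p"
    by (subst (2) eq[symmetric], subst degree_prod_sum_eq) auto
  show "finite {z. poly p z = 0}"
    using assms by (intro poly_roots_finite) (auto simp: rsquarefree_def)
qed

lemma separating_radius:
  fixes A :: "'a::metric_space set"
  assumes "finite A"
  obtains \<epsilon> where "\<epsilon> > 0" "\<And>a b. a \<in> A \<Longrightarrow> b \<in> A \<Longrightarrow> a \<noteq> b \<Longrightarrow> ball a \<epsilon> \<inter> ball b \<epsilon> = {}"
proof -
  define D where "D = insert 1 ((\<lambda>(a, b). dist a b / 2) ` {(a, b) \<in> A \<times> A. a \<noteq> b})"
  have fin: "finite D" unfolding D_def
    by (intro finite.insertI finite_imageI finite_subset[OF _ finite_cartesian_product[OF assms assms]]) auto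
  have "Min D > 0" using fin by (subst Min_gr_iff) (auto simp: D_def)
  moreover have "ball a (Min D) \<inter> ball b (Min D) = {}" if "a \<in> A" "b \<in> A" "a \<noteq> b" for a b
  proof -
    have "dist a b / 2 \<in> D" using that by (auto simp: D_def)
    hence "2 * Min D \<le> dist a b" using Min_le[OF fin] by fastforce
    thus ?thesis by (intro disjoint_ballI) simp
  qed
  ultimately show ?thesis by (rule that)
qed

text \<open>Squarefree fibres have exactly \<open>n\<close> roots, so the roots form an
  \<open>n\<close>-sheeted covering of \<open>S\<close>; as \<open>S\<close> is convex, the covering
  has global sections.\<close>

locale root_family =
  fixes p :: "complex \<Rightarrow> complex poly" and n :: nat and S :: "complex set"
  assumes open_S: "open S" and convex_S: "convex S"
    and n_pos: "n > 0"
    and degree_p: "s \<in> S \<Longrightarrow> degree (p s) = n"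
    and monic_p: "s \<in> S \<Longrightarrow> lead_coeff (p s) = 1"
    and rsquarefree_p: "s \<in> S \<Longrightarrow> rsquarefree (p s)"
    and holomorphic_p: "(\<lambda>s. coeff (p s) i) holomorphic_on S"
begin

abbreviation Z :: "complex \<Rightarrow> complex set" where "Z s \<equiv> {w. poly (p s) w = 0}"

definition E :: "(complex \<times> complex) set" where "E = {(s, w). s \<in> S \<and> poly (p s) w = 0}"

lemma poly_p: "s \<in> S \<Longrightarrow> poly (p s) x = (\<Sum>i\<le>n. coeff (p s) i * x ^ i)"
  by (simp add: poly_altdef degree_p)

lemma isCont_coeff: "s \<in> S \<Longrightarrow> isCont (\<lambda>s. coeff (p s) i) s"
  using holomorphic_on_imp_continuous_on[OF holomorphic_p] open_S
  by (simp add: continuous_on_eq_continuous_at)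

lemma continuous_on_poly_p: "continuous_on S (\<lambda>s. poly (p s) x)"
proof -
  have "continuous_on S (\<lambda>s. \<Sum>i\<le>n. coeff (p s) i * x ^ i)"
    by (intro continuous_intros holomorphic_on_imp_continuous_on holomorphic_p)
  thus ?thesis by (rule continuous_on_cong[THEN iffD1, rotated -1]) (simp_all add: poly_p)
qed

text \<open>If every root of \<open>p s\<close> had distance at least \<epsilon> from
  \<open>w\<close>, then \<open>poly (p s) w\<close>, the product of the differences, would have
  norm at least \<open>\<epsilon> ^ n\<close>. But it tends to
  \<open>poly (p z) w = 0\<close>.\<close>

lemma eventually_root_near:
  assumes z: "z \<in> S" and w: "poly (p z) w = 0" and \<epsilon>: "\<epsilon> > 0"
  shows "\<forall>\<^sub>F s in nhds z. \<exists>w'\<in>Z s. w' \<in> ball w \<epsilon>"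
proof -
  have "isCont (\<lambda>s. poly (p s) w) z"
    using continuous_on_poly_p open_S z by (simp add: continuous_on_eq_continuous_at)
  hence "\<forall>\<^sub>F s in nhds z. dist (poly (p s) w) (poly (p z) w) < \<epsilon> ^ n"
    unfolding isCont_def by (intro tendstoD eventually_nhds_conv_at[THEN iffD2] conjI) (use \<epsilon> in auto)
  with eventually_nhds_in_open[OF open_S z] show ?thesis
  proof eventually_elim
    case (elim s)
    note R = rsquarefree_monic_prod_roots[OF rsquarefree_p monic_p, OF elim(1) elim(1)]
    show ?case
    proof (rule ccontr)
      assume "\<not> ?thesis"
      hence "\<forall>w'\<in>Z s. \<epsilon> \<le> norm (w - w')" by (auto simp: dist_norm not_less)
      hence "(\<Prod>w'\<in>Z s. \<epsilon>) \<le> (\<Prod>w'\<in>Z s. norm (w - w'))"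
        using \<epsilon> by (intro prod_mono) auto
      also have "\<dots> = norm (poly (p s) w)" by (subst R(1)) (rule prod_norm)
      finally have "\<epsilon> ^ n \<le> norm (poly (p s) w)"
        using R(2) degree_p[OF elim(1)] by simp
      thus False using elim w by simp
    qed
  qed
qed

text \<open>Pigeonhole: for \<open>s\<close> near \<open>z\<close> each of the \<open>n\<close>
  disjoint balls contains a root of \<open>p s\<close>, which has only \<open>n\<close> roots, so
  each ball contains exactly one and no root is left over.\<close>

lemma local_sheets:
  assumes z: "z \<in> S"
  obtains \<epsilon> \<delta> where "\<epsilon> > 0" "\<delta> > 0" "ball z \<delta> \<subseteq> S"
    "\<And>a b. a \<in> Z z \<Longrightarrow> b \<in> Z z \<Longrightarrow> a \<noteq> b \<Longrightarrow> ball a \<epsilon> \<inter> ball b \<epsilon> = {}"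
    "\<And>s a. s \<in> ball z \<delta> \<Longrightarrow> a \<in> Z z \<Longrightarrow> \<exists>!w. w \<in> Z s \<and> w \<in> ball a \<epsilon>"
    "\<And>s. s \<in> ball z \<delta> \<Longrightarrow> Z s \<subseteq> (\<Union>a\<in>Z z. ball a \<epsilon>)"
proof -
  note Rz = rsquarefree_monic_prod_roots[OF rsquarefree_p monic_p, OF z z]
  obtain \<epsilon> where \<epsilon>: "\<epsilon> > 0" "\<And>a b. a \<in> Z z \<Longrightarrow> b \<in> Z z \<Longrightarrow> a \<noteq> b \<Longrightarrow> ball a \<epsilon> \<inter> ball b \<epsilon> = {}"
    using separating_radius[OF Rz(3)] by blast
  have "\<forall>\<^sub>F s in nhds z. \<forall>a\<in>Z z. \<exists>w\<in>Z s. w \<in> ball a \<epsilon>"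
    using Rz(3) \<epsilon>(1) by (intro eventually_ball_finite ballI eventually_root_near[OF z]) auto
  with eventually_nhds_in_open[OF open_S z]
  have "\<forall>\<^sub>F s in nhds z. s \<in> S \<and> (\<forall>a\<in>Z z. \<exists>w\<in>Z s. w \<in> ball a \<epsilon>)"
    by eventually_elim blast
  then obtain \<delta> where \<delta>: "\<delta> > 0"
    and \<delta>': "\<forall>s. dist s z < \<delta> \<longrightarrow> s \<in> S \<and> (\<forall>a\<in>Z z. \<exists>w\<in>Z s. w \<in> ball a \<epsilon>)"
    unfolding eventually_nhds_metric by blast
  have near: "s \<in> S \<and> (\<forall>a\<in>Z z. \<exists>w. w \<in> Z s \<and> w \<in> ball a \<epsilon>)" if "s \<in> ball z \<delta>" for s
    using \<delta>'[rule_format, of s] that unfolding mem_ball Bex_def by (subst (asm) dist_commute) blast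
  have sheets: "\<exists>!w. w \<in> Z s \<and> w \<in> ball a \<epsilon>" "Z s \<subseteq> (\<Union>a\<in>Z z. ball a \<epsilon>)" if s: "s \<in> ball z \<delta>" and a: "a \<in> Z z" for s a
  proof -
    from near[OF s] have sS: "s \<in> S" by blast
    note Rs = rsquarefree_monic_prod_roots[OF rsquarefree_p monic_p, OF sS sS]
    from near[OF s] have "\<forall>a\<in>Z z. \<exists>w. w \<in> Z s \<and> w \<in> ball a \<epsilon>" by blast
    from bchoice[OF this] obtain f where f: "\<forall>a\<in>Z z. f a \<in> Z s \<and> f a \<in> ball a \<epsilon>" ..
    have "inj_on f (Z z)"
    proof (rule inj_onI)
      fix a b assume ab: "a \<in> Z z" "b \<in> Z z" "f a = f b"
      hence "f a \<in> ball a \<epsilon> \<inter> ball b \<epsilon>" using bspec[OF f, of a] bspec[OF f, of b] by simp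
      thus "a = b" using \<epsilon>(2)[OF ab(1,2)] by blast
    qed
    moreover have "f ` Z z \<subseteq> Z s" using f by (intro image_subsetI) simp
    moreover have "card (Z z) = card (Z s)" using Rs(2) Rz(2) degree_p z sS by simp
    ultimately have im: "f ` Z z = Z s" using Rs(3) by (intro card_subset_eq) (simp_all add: card_image)
    have "w = f a" if "w \<in> Z s" "w \<in> ball a \<epsilon>" for w
    proof -
      from that(1) obtain b where b: "b \<in> Z z" "w = f b" unfolding im[symmetric] by (rule imageE)
      hence "w \<in> ball b \<epsilon>" using bspec[OF f b(1)] by simp
      hence "b = a" using \<epsilon>(2)[OF b(1) a] that(2) by blast
      thus ?thesis using b by simp
    qed
    thus "\<exists>!w. w \<in> Z s \<and> w \<in> ball a \<epsilon>" using bspec[OF f a] by (intro ex1I[of _ "f a"]) auto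
    show "Z s \<subseteq> (\<Union>a\<in>Z z. ball a \<epsilon>)"
      unfolding im[symmetric] using f by (intro image_subsetI UN_I) auto
  qed
  have "card (Z z) \<noteq> 0" using Rz(2) n_pos degree_p[OF z] by simp
  hence ne: "Z z \<noteq> {}" by (metis card.empty)
  show ?thesis
  proof (rule that[OF \<epsilon>(1) \<delta> _ \<epsilon>(2)])
    show "ball z \<delta> \<subseteq> S" using near by blast
    show "\<exists>!w. w \<in> Z s \<and> w \<in> ball a \<epsilon>" if "s \<in> ball z \<delta>" "a \<in> Z z" for s a
      by (rule sheets(1)[OF that])
    show "Z s \<subseteq> (\<Union>a\<in>Z z. ball a \<epsilon>)" if "s \<in> ball z \<delta>" for s
      using ne sheets(2)[OF that] by (meson ex_in_conv)
  qed assumption+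
qed

lemma covering_space_roots: "covering_space E fst S"
proof
  show "continuous_on E fst" by (intro continuous_intros)
  show "fst ` E = S"
  proof (intro equalityI subsetI)
    fix s assume s: "s \<in> S"
    note Rs = rsquarefree_monic_prod_roots[OF rsquarefree_p monic_p, OF s s]
    have "card (Z s) \<noteq> 0" using Rs(2) n_pos degree_p[OF s] by simp
    hence "Z s \<noteq> {}" by (metis card.empty)
    then obtain w where "poly (p s) w = 0" by blast
    hence "(s, w) \<in> E" using s by (simp add: E_def)
    thus "s \<in> fst ` E" by force
  qed (auto simp: E_def)
  fix z assume z: "z \<in> S"
  obtain \<epsilon> \<delta> where ed: "\<epsilon> > 0" "\<delta> > 0" "ball z \<delta> \<subseteq> S"
    and disj: "\<And>a b. a \<in> Z z \<Longrightarrow> b \<in> Z z \<Longrightarrow> a \<noteq> b \<Longrightarrow> ball a \<epsilon> \<inter> ball b \<epsilon> = {}"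
    and ex1: "\<And>s a. s \<in> ball z \<delta> \<Longrightarrow> a \<in> Z z \<Longrightarrow> \<exists>!w. w \<in> Z s \<and> w \<in> ball a \<epsilon>"
    and cov: "\<And>s. s \<in> ball z \<delta> \<Longrightarrow> Z s \<subseteq> (\<Union>a\<in>Z z. ball a \<epsilon>)"
    by (rule local_sheets[OF z]) (rule that; assumption)
  let ?T = "ball z \<delta>"
  define U where "U = (\<lambda>a. E \<inter> (?T \<times> ball a \<epsilon>))"
  \<comment> \<open>\<open>q a\<close> is the sheet through \<open>a\<close>: it selects the root
    near \<open>a\<close> and inverts the projection of \<open>U a\<close> to the base.\<close>
  define q where "q = (\<lambda>a s. THE w. w \<in> Z s \<and> w \<in> ball a \<epsilon>)"
  have q: "q a s \<in> Z s \<and> q a s \<in> ball a \<epsilon>" if "s \<in> ?T" "a \<in> Z z" for s a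
    unfolding q_def by (rule theI'[OF ex1[OF that]])
  have q_unique: "w = q a s" if "s \<in> ?T" "a \<in> Z z" "w \<in> Z s" "w \<in> ball a \<epsilon>" for s a w
    unfolding q_def by (rule the1_equality[symmetric, OF ex1[OF that(1,2)]]) (use that(3,4) in simp)
  have q_cont: "continuous_on ?T (q a)" if a: "a \<in> Z z" for a
    unfolding continuous_on_eq_continuous_at[OF open_ball]
  proof
    fix s assume s: "s \<in> ?T"
    show "isCont (q a) s"
      unfolding isCont_def
    proof (rule tendstoI)
      fix e :: real assume e: "e > 0"
      \<comment> \<open>A root within \<open>e'\<close> of \<open>q a s\<close> still lies in
        \<open>ball a \<epsilon>\<close>, hence is the value of \<open>q a\<close> at the nearby
        point.\<close>
      define e' where "e' = min e (\<epsilon> - dist a (q a s))"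
      have e': "e' > 0" using q[OF s a] e by (simp add: e'_def)
      have "\<forall>\<^sub>F s' in nhds s. \<exists>w'\<in>Z s'. w' \<in> ball (q a s) e'"
        using ed(3) s q[OF s a] e' by (intro eventually_root_near) auto
      moreover have "\<forall>\<^sub>F s' in nhds s. s' \<in> ?T" using s by (intro eventually_nhds_in_open) auto
      ultimately have "\<forall>\<^sub>F s' in nhds s. dist (q a s') (q a s) < e"
      proof eventually_elim
        case (elim s')
        then obtain w' where w': "w' \<in> Z s'" "dist (q a s) w' < e'" by auto
        have "dist a w' < \<epsilon>" using w'(2) dist_triangle[of a w' "q a s"] by (simp add: e'_def)
        hence "w' = q a s'" using q_unique[OF elim(2) a w'(1)] by simp
        thus ?case using w'(2) by (simp add: e'_def dist_commute)
      qed
      thus "\<forall>\<^sub>F s' in at s. dist (q a s') (q a s) < e" unfolding eventually_nhds_conv_at ..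
    qed
  qed
  have "\<Union>(U ` Z z) = E \<inter> fst -` ?T"
    using cov unfolding U_def E_def by fastforce
  moreover have "\<forall>u\<in>U ` Z z. openin (top_of_set E) u"
    unfolding U_def by (auto intro!: openin_open_Int open_Times)
  moreover have "pairwise disjnt (U ` Z z)"
  proof (rule pairwiseI)
    fix u v assume "u \<in> U ` Z z" "v \<in> U ` Z z" "u \<noteq> v"
    then obtain a b where "a \<in> Z z" "b \<in> Z z" "a \<noteq> b" "u = U a" "v = U b" by blast
    thus "disjnt u v" using disj[of a b] unfolding disjnt_def U_def by blast
  qed
  moreover have "\<exists>r. homeomorphism u ?T fst r" if "u \<in> U ` Z z" for u
  proof -
    from that obtain a where a: "a \<in> Z z" "u = U a" by blast
    have "homeomorphism u ?T fst (\<lambda>s. (s, q a s))"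
    proof (rule homeomorphismI)
      show "continuous_on u fst" by (intro continuous_intros)
      show "continuous_on ?T (\<lambda>s. (s, q a s))" by (intro continuous_intros q_cont a)
      show "fst ` u \<subseteq> ?T" unfolding a U_def by auto
      show "(\<lambda>s. (s, q a s)) ` ?T \<subseteq> u"
        using q a ed(3) unfolding U_def E_def by auto
      show "(fst x, q a (fst x)) = x" if "x \<in> u" for x
        using that q_unique[of "fst x" a "snd x"] a unfolding U_def E_def by (cases x) auto
      show "fst (y, q a y) = y" for y by simp
    qed
    thus ?thesis by blast
  qed
  ultimately show "\<exists>T. z \<in> T \<and> openin (top_of_set S) T \<and>
          (\<exists>v. \<Union>v = E \<inter> fst -` T \<and> (\<forall>u\<in>v. openin (top_of_set E) u) \<and> pairwise disjnt v \<and>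
               (\<forall>u\<in>v. \<exists>q. homeomorphism u T fst q))"
    using ed by (intro exI[of _ ?T] conjI exI[of _ "U ` Z z"]) (auto intro: open_subset)
qed

text \<open>The identity of the simply connected set \<open>S\<close> lifts through the
  covering.\<close>

lemma continuous_root_exists:
  obtains w where "continuous_on S w" "\<And>s. s \<in> S \<Longrightarrow> poly (p s) (w s) = 0"
proof -
  obtain g where g: "continuous_on S g" "g \<in> S \<rightarrow> E" "\<And>y. y \<in> S \<Longrightarrow> fst (g y) = y"
    by (rule covering_space_lift[OF covering_space_roots, of S id])
       (use open_S convex_S in \<open>auto intro: convex_imp_simply_connected open_imp_locally_path_connected\<close>)
  show ?thesis
  proof (rule that[of "snd \<circ> g"])
    show "continuous_on S (snd \<circ> g)" using g(1) by (auto intro!: continuous_intros simp: o_def)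
    show "poly (p s) ((snd \<circ> g) s) = 0" if "s \<in> S" for s
    proof -
      have "g s \<in> E" using g(2) that by auto
      thus ?thesis using g(3)[OF that] by (auto simp: E_def)
    qed
  qed
qed

lemma continuous_root_unique:
  assumes "continuous_on S w" "\<And>s. s \<in> S \<Longrightarrow> poly (p s) (w s) = 0"
    and "continuous_on S w'" "\<And>s. s \<in> S \<Longrightarrow> poly (p s) (w' s) = 0"
    and "s0 \<in> S" "w s0 = w' s0" "s \<in> S"
  shows "w s = w' s"
proof -
  have "(s, w s) = (s, w' s)"
    by (rule covering_space_lift_unique[OF covering_space_roots, of "\<lambda>s. (s, w s)" s0 "\<lambda>s. (s, w' s)" S id])
       (use assms convex_S in \<open>auto intro!: continuous_intros simp: E_def convex_connected\<close>)
  thus ?thesis by simp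
qed

text \<open>Implicit differentiation with difference quotients: the values of \<open>p s\<close> at
  \<open>w s\<close> and \<open>w z\<close> differ by \<open>(w s - w z) * Q s\<close>, where
  \<open>Q z\<close> is the derivative of \<open>p z\<close> at its root \<open>w z\<close> and is
  nonzero by squarefreeness. \<open>R\<close> collects the difference quotients of the
  coefficients.\<close>

lemma continuous_root_holomorphic:
  assumes w: "continuous_on S w" and root: "\<And>s. s \<in> S \<Longrightarrow> poly (p s) (w s) = 0"
  shows "w holomorphic_on S"
  unfolding holomorphic_on_open[OF open_S]
proof
  fix z assume z: "z \<in> S"
  define Q where "Q = (\<lambda>s. \<Sum>k\<le>n. coeff (p s) k * (\<Sum>j<k. w s ^ j * w z ^ (k - Suc j)))"
  define R where "R = (\<lambda>s. \<Sum>k\<le>n. (coeff (p s) k - coeff (p z) k) / (s - z) * w z ^ k)"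
  have key: "(w s - w z) * Q s = - (\<Sum>k\<le>n. (coeff (p s) k - coeff (p z) k) * w z ^ k)" if s: "s \<in> S" for s
  proof -
    have "(w s - w z) * Q s = (\<Sum>k\<le>n. coeff (p s) k * (w s ^ k - w z ^ k))"
    proof -
      have "(w s - w z) * (c * (\<Sum>j<k. w s ^ j * w z ^ (k - Suc j))) = c * (w s ^ k - w z ^ k)" for c k
        unfolding power_diff_sumr2[of "w s" k "w z"] by (simp add: mult_ac)
      thus ?thesis by (simp add: Q_def sum_distrib_left)
    qed
    also have "\<dots> = poly (p s) (w s) - poly (p s) (w z)"
      by (simp add: poly_p[OF s] right_diff_distrib sum_subtractf)
    also have "\<dots> = poly (p z) (w z) - poly (p s) (w z)" using root s z by simp
    also have "\<dots> = - (\<Sum>k\<le>n. (coeff (p s) k - coeff (p z) k) * w z ^ k)"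
      by (simp add: poly_p[OF s] poly_p[OF z] left_diff_distrib sum_subtractf)
    finally show ?thesis .
  qed
  have cw: "isCont w z" using w open_S z by (simp add: continuous_on_eq_continuous_at)
  have "isCont Q z" unfolding Q_def by (intro continuous_intros isCont_coeff z cw)
  hence Q: "(Q \<longlongrightarrow> Q z) (at z)" by (simp add: isCont_def)
  have Qz: "Q z \<noteq> 0"
  proof -
    have "((\<lambda>x. poly (p z) x) has_field_derivative Q z) (at (w z))"
    proof -
      have "(\<Sum>j<k. w z ^ j * w z ^ (k - Suc j)) = of_nat k * w z ^ (k - 1)" for k
        by (simp flip: power_add)
      thus ?thesis unfolding poly_p[OF z] Q_def
        by (auto intro!: derivative_eq_intros sum.cong)
    qed
    hence "Q z = poly (pderiv (p z)) (w z)" using poly_DERIV DERIV_unique by blast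
    thus ?thesis using rsquarefree_p[OF z] root[OF z] unfolding rsquarefree_roots by auto
  qed
  have "\<exists>R'. (R \<longlongrightarrow> R') (at z)"
  proof -
    have "(\<lambda>s. coeff (p s) k) field_differentiable at z" for k
      by (rule holomorphic_on_imp_differentiable_at[OF holomorphic_p open_S z])
    then obtain d where "((\<lambda>s. coeff (p s) k) has_field_derivative d k) (at z)" for k
      unfolding field_differentiable_def by metis
    hence "((\<lambda>s. (coeff (p s) k - coeff (p z) k) / (s - z)) \<longlongrightarrow> d k) (at z)" for k
      unfolding has_field_derivative_iff by blast
    hence "(R \<longlongrightarrow> (\<Sum>k\<le>n. d k * w z ^ k)) (at z)" unfolding R_def by (intro tendsto_intros)
    thus ?thesis ..
  qed
  then obtain R' where R': "(R \<longlongrightarrow> R') (at z)" by blast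
  have "((\<lambda>s. (w s - w z) / (s - z)) \<longlongrightarrow> - R' / Q z) (at z)"
  proof (rule Lim_transform_eventually)
    show "((\<lambda>s. - R s / Q s) \<longlongrightarrow> - R' / Q z) (at z)" by (intro tendsto_intros R' Q Qz)
    have "\<forall>\<^sub>F s in at z. Q s \<noteq> 0" using tendsto_imp_eventually_ne[OF Q Qz] .
    moreover have "\<forall>\<^sub>F s in at z. s \<in> S - {z}" using eventually_at_in_open[OF open_S z] .
    ultimately show "\<forall>\<^sub>F s in at z. - R s / Q s = (w s - w z) / (s - z)"
    proof eventually_elim
      case (elim s)
      have "R s * (s - z) = (\<Sum>k\<le>n. (coeff (p s) k - coeff (p z) k) * w z ^ k)"
        using elim by (simp add: R_def sum_distrib_right)
      with key[of s] have "(w s - w z) * Q s = - R s * (s - z)" using elim by simp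
      thus ?case using elim by (simp add: field_simps)
    qed
  qed
  thus "\<exists>f'. (w has_field_derivative f') (at z)" unfolding has_field_derivative_iff by blast
qed

text \<open>Translates of a continuous root by multiples of \<open>P\<close> are again continuous
  roots. Among \<open>n + 1\<close> of them two agree at a given point, where there are only
  \<open>n\<close> roots, hence everywhere; the difference of their shifts is a period of the
  root.\<close>

lemma periodic_holomorphic_root:
  assumes per: "\<And>s. s \<in> S \<Longrightarrow> p (s + P) = p s" and inv: "\<And>s. s \<in> S \<Longrightarrow> s + P \<in> S"
    "\<And>s. s \<in> S \<Longrightarrow> s - P \<in> S" and ne: "S \<noteq> {}"
  obtains w m where "m > 0" "w holomorphic_on S" "\<And>s. s \<in> S \<Longrightarrow> poly (p s) (w s) = 0"
    "\<And>s. s \<in> S \<Longrightarrow> w (s + of_nat m * P) = w s"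
proof -
  obtain w where w: "continuous_on S w" and root: "\<And>s. s \<in> S \<Longrightarrow> poly (p s) (w s) = 0"
    by (rule continuous_root_exists) blast
  have shift: "s + of_nat k * P \<in> S \<and> p (s + of_nat k * P) = p s" if "s \<in> S" for s k
  proof (induction k)
    case (Suc k)
    have "s + of_nat (Suc k) * P = (s + of_nat k * P) + P" by (simp add: algebra_simps)
    thus ?case using Suc per inv(1) by metis
  qed (use that in simp)
  have shift': "s - of_nat k * P \<in> S" if "s \<in> S" for s k
  proof (induction k)
    case (Suc k)
    have "s - of_nat (Suc k) * P = (s - of_nat k * P) - P" by (simp add: algebra_simps)
    thus ?case using Suc inv(2) by metis
  qed (use that in simp)
  define v where "v = (\<lambda>k s. w (s + of_nat k * P))"
  have v_cont: "continuous_on S (v k)" for k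
    unfolding v_def using shift by (intro continuous_on_compose2[OF w] continuous_intros) auto
  have v_root: "poly (p s) (v k s) = 0" if "s \<in> S" for k s
    using root[of "s + of_nat k * P"] shift[OF that] by (simp add: v_def)
  obtain s0 where s0: "s0 \<in> S" using ne by blast
  note R = rsquarefree_monic_prod_roots[OF rsquarefree_p monic_p, OF s0 s0]
  have "\<not> inj_on (\<lambda>k. v k s0) {..n}"
  proof
    assume "inj_on (\<lambda>k. v k s0) {..n}"
    moreover have "(\<lambda>k. v k s0) ` {..n} \<subseteq> Z s0" using v_root[OF s0] by blast
    ultimately have "card {..n} \<le> card (Z s0)" using R(3) by (metis card_inj_on_le)
    thus False using R(2) degree_p[OF s0] by simp
  qed
  then obtain a b where ab: "a < b" "v a s0 = v b s0"
    unfolding inj_on_def by (metis linorder_neqE_nat)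
  have *: "v a s = v b s" if "s \<in> S" for s
    using continuous_root_unique[OF v_cont v_root v_cont v_root s0 ab(2) that] .
  have "w (s + of_nat (b - a) * P) = w s" if "s \<in> S" for s
  proof -
    have "v a (s - of_nat a * P) = v b (s - of_nat a * P)"
      if "s - of_nat a * P \<in> S" using that * by blast
    moreover have "(s - of_nat a * P) + of_nat b * P = s + of_nat (b - a) * P"
      using ab(1) by (simp add: of_nat_diff algebra_simps)
    ultimately show ?thesis using shift'[OF that, of a] by (simp add: v_def)
  qed
  thus ?thesis using that[of "b - a" w] ab(1) continuous_root_holomorphic[OF w root] root by simp
qed

end

section \<open>Puiseux series form an algebraically closed field\<close>

lemma germ_of_nat: "\<forall>\<^sub>F s in right_end. germ (of_nat n) s = of_nat n"
proof (induction n)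
  case (Suc n)
  with germ_add[of 1 "of_nat n"] show ?case by eventually_elim (simp add: germ_1)
qed (simp add: germ_0)

instance puiseux :: field_char_0
proof
  show "inj (of_nat :: nat \<Rightarrow> puiseux)"
  proof (rule injI)
    fix m n :: nat assume eq: "(of_nat m :: puiseux) = of_nat n"
    have "\<forall>\<^sub>F s in right_end. (of_nat m :: complex) = of_nat n"
      using germ_of_nat[of m] germ_of_nat[of n] by eventually_elim (metis eq)
    thus "m = n" using right_end_nontrivial by simp
  qed
qed

text \<open>An element \<open>g\<close> of least degree generates the ideal of \<open>P\<close> and
  its derivative. A root of \<open>g\<close> would be a root of \<open>P\<close>, so minimality of
  \<open>degree P\<close> forces \<open>g\<close> to be constant. The Bezout identity is what
  carries coprimality over to germs.\<close>

lemma min_degree_rootless_coprime_pderiv: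
  fixes P :: "'a :: field_char_0 poly"
  assumes "degree P > 0" and rootless: "\<And>x. poly P x \<noteq> 0"
    and min: "\<And>Q :: 'a poly. 0 < degree Q \<Longrightarrow> degree Q < degree P \<Longrightarrow> \<exists>x. poly Q x = 0"
  obtains U V where "U * P + V * pderiv P = 1"
proof -
  define I where "I = {U * P + V * pderiv P | U V. True}"
  have diff: "h - k * g \<in> I" if "h \<in> I" "g \<in> I" for h g k
  proof -
    from that obtain U V U' V' where "h = U * P + V * pderiv P" "g = U' * P + V' * pderiv P"
      unfolding I_def by blast
    hence "h - k * g = (U - k * U') * P + (V - k * V') * pderiv P" by (simp add: algebra_simps)
    thus ?thesis unfolding I_def by blast
  qed
  have mem: "P \<in> I" "pderiv P \<in> I"
    unfolding I_def by (rule CollectI, rule exI[of _ 1], rule exI[of _ 0], simp)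
      (rule CollectI, rule exI[of _ 0], rule exI[of _ 1], simp)
  have P0: "P \<noteq> 0" "pderiv P \<noteq> 0" using assms(1) by (auto simp: pderiv_eq_0_iff)
  obtain g where g: "g \<in> I" "g \<noteq> 0" and least: "\<And>h. h \<in> I \<Longrightarrow> h \<noteq> 0 \<Longrightarrow> degree g \<le> degree h"
    using ex_has_least_nat[of "\<lambda>h. h \<in> I \<and> h \<noteq> 0" P degree] mem P0 by blast
  have dvd: "g dvd h" if "h \<in> I" for h
  proof -
    have "h mod g = h - (h div g) * g" by (simp add: minus_div_mult_eq_mod)
    hence "h mod g \<in> I" using diff[OF that g(1)] by simp
    hence "h mod g = 0" using degree_mod_less[OF g(2), of h] least[of "h mod g"] by fastforce
    thus ?thesis by (simp add: dvd_eq_mod_eq_0)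
  qed
  have "degree g \<le> degree (pderiv P)" using least mem P0 by blast
  also have "\<dots> < degree P" using assms(1) by (simp add: degree_pderiv)
  finally have "degree g < degree P" .
  moreover have "poly g x \<noteq> 0" for x using dvd[OF mem(1)] rootless by (metis dvd_trans poly_eq_0_iff_dvd)
  ultimately have "degree g = 0" using min by blast
  then obtain c where c: "g = [:c:]" by (rule degree_eq_zeroE)
  from g(1) obtain U V where UV: "g = U * P + V * pderiv P" unfolding I_def by blast
  have "smult (inverse c) U * P + smult (inverse c) V * pderiv P = smult (inverse c) g"
    by (simp add: UV smult_add_right)
  also have "\<dots> = 1" using g(2) c by (simp add: one_pCons)
  finally show ?thesis by (rule that)
qed

text \<open>For \<open>norm w > 1\<close> the equation can be divided by
  \<open>norm w ^ (d - 1)\<close>. The bound is linear in the coefficients, so it turns exponential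
  bounds for them into one for the root.\<close>

lemma monic_root_bound:
  fixes p :: "complex poly"
  assumes "lead_coeff p = 1" "poly p w = 0" "degree p \<le> n"
  shows "norm w \<le> 1 + (\<Sum>i\<le>n. norm (coeff p i))"
proof (cases "norm w \<le> 1")
  case True
  thus ?thesis by (smt (verit) sum_nonneg norm_ge_zero)
next
  case False
  define d where "d = degree p"
  have "d > 0"
  proof (rule gr0I)
    assume "d = 0"
    then obtain c where "p = [:c:]" unfolding d_def by (rule degree_eq_zeroE)
    thus False using assms(1,2) by simp
  qed
  have "poly p w = w ^ d + (\<Sum>i<d. coeff p i * w ^ i)"
    using assms(1) by (simp add: poly_altdef d_def lessThan_Suc_atMost[symmetric])
  hence "norm (w ^ d) = norm (\<Sum>i<d. coeff p i * w ^ i)"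
    using assms(2) by (metis add_eq_0_iff2 norm_minus_cancel)
  also have "\<dots> \<le> (\<Sum>i<d. norm (coeff p i) * norm w ^ (d - 1))"
    using False by (intro sum_norm_le) (auto simp: norm_mult norm_power intro!: mult_left_mono power_increasing)
  finally have "norm w * norm w ^ (d - 1) \<le> (\<Sum>i<d. norm (coeff p i)) * norm w ^ (d - 1)"
    using \<open>d > 0\<close> by (simp add: norm_power sum_distrib_right flip: power_Suc)
  moreover have "norm w ^ (d - 1) > 0" using False by (intro zero_less_power) linarith
  ultimately have "norm w \<le> (\<Sum>i<d. norm (coeff p i))" by (rule mult_right_le_imp_le)
  also have "\<dots> \<le> (\<Sum>i\<le>n. norm (coeff p i))"
    using assms(3) by (intro sum_mono2) (auto simp: d_def)
  finally show ?thesis by simp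
qed

text \<open>Far to the right the Bezout identity holds for the germs and makes the specialized
  polynomials squarefree. A periodic holomorphic root inherits the growth of the coefficients, so it
  is the germ of a Puiseux series.\<close>

lemma puiseux_monic_root:
  fixes P :: "puiseux poly"
  assumes deg: "degree P > 0" and monic: "lead_coeff P = 1"
    and UV: "U * P + V * pderiv P = 1"
  shows "\<exists>y. poly P y = 0"
proof -
  define n where "n = degree P"
  have coeff_n: "coeff P n = 1" using monic by (simp add: n_def)
  have "\<forall>c. \<exists>N T M. N > 0 \<and> germ c holomorphic_on {s. T < Re s} \<and>
      (\<forall>s. T < Re s \<longrightarrow> germ c (s + of_nat N * (2 * of_real pi * \<i>)) = germ c s) \<and>
      (\<forall>s. T < Re s \<longrightarrow> norm (germ c s) \<le> exp (M * Re s))"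
    by (metis germ_regular)
  then obtain Nf Tf Mf where
    Nf: "\<And>c. Nf c > 0" and hol: "\<And>c. germ c holomorphic_on {s. Tf c < Re s}" and
    per: "\<And>c s. Tf c < Re s \<Longrightarrow> germ c (s + of_nat (Nf c) * (2 * of_real pi * \<i>)) = germ c s" and
    bd: "\<And>c s. Tf c < Re s \<Longrightarrow> norm (germ c s) \<le> exp (Mf c * Re s)"
    by metis
  define C where "C = coeff P ` {..n}"
  have finC: "finite C" by (simp add: C_def)
  \<comment> \<open>Only finitely many series occur as coefficients, so one half plane and one
    period serve all of them.\<close>
  have coeff_C: "coeff P i \<in> insert 0 C" for i
    using coeff_eq_0[of P i] by (cases "i \<le> n") (auto simp: C_def n_def)
  have "\<forall>\<^sub>F s in right_end. \<forall>c\<in>C. Tf c < Re s"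
    using finC by (intro eventually_ball_finite ballI eventually_right_end_gt)
  moreover have "\<forall>\<^sub>F s in right_end. rsquarefree (germ_poly s P)"
    using germ_poly_add[of "U * P" "V * pderiv P"] germ_poly_mult[of U P] germ_poly_mult[of V "pderiv P"]
      germ_poly_pderiv[of P]
  proof eventually_elim
    case (elim s)
    hence eq: "germ_poly s U * germ_poly s P + germ_poly s V * pderiv (germ_poly s P) = 1"
      by (simp add: UV)
    show ?case unfolding rsquarefree_roots
    proof (intro allI notI)
      fix a assume "poly (germ_poly s P) a = 0 \<and> poly (pderiv (germ_poly s P)) a = 0"
      hence "poly (germ_poly s U * germ_poly s P + germ_poly s V * pderiv (germ_poly s P)) a = 0" by simp
      thus False unfolding eq by simp
    qed
  qed
  ultimately have "\<forall>\<^sub>F s in right_end. 0 < Re s \<and> (\<forall>c\<in>C. Tf c < Re s) \<and> rsquarefree (germ_poly s P)"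
    using eventually_right_end_gt[of 0] by eventually_elim blast
  then obtain T where T: "\<And>s. T < Re s \<Longrightarrow> 0 < Re s \<and> (\<forall>c\<in>C. Tf c < Re s) \<and> rsquarefree (germ_poly s P)"
    unfolding eventually_right_end by blast
  define S where "S = {s. T < Re s}"
  \<comment> \<open>A common multiple of the periods of all coefficients.\<close>
  define N where "N = prod Nf C"
  have N: "N > 0" using Nf by (simp add: N_def prod_pos)
  have degree_germ: "degree (germ_poly s P) = n" "lead_coeff (germ_poly s P) = 1" for s
  proof -
    show "degree (germ_poly s P) = n"
    proof (rule antisym)
      show "degree (germ_poly s P) \<le> n"
        by (rule degree_le) (simp add: coeff_germ_poly coeff_eq_0 n_def germ_0)
      show "n \<le> degree (germ_poly s P)"
        by (rule le_degree) (simp add: coeff_germ_poly coeff_n germ_1)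
    qed
    thus "lead_coeff (germ_poly s P) = 1" by (simp add: coeff_germ_poly coeff_n germ_1)
  qed
  have per': "germ c (s + of_nat N * (2 * of_real pi * \<i>)) = germ c s" if "c \<in> insert 0 C" "s \<in> S" for c s
  proof (cases "c \<in> C")
    case True
    hence "Nf c dvd N" unfolding N_def by (intro dvd_prodI finC)
    then obtain k where k: "N = Nf c * k" ..
    have "germ c (s + of_int (int k) * (of_nat (Nf c) * (2 * of_real pi * \<i>))) = germ c s"
      using that T[of s] True by (intro periodic_int[of "Tf c"] per) (auto simp: S_def)
    thus ?thesis unfolding k by (simp add: mult_ac)
  qed (use that in \<open>auto simp: germ_0\<close>)
  interpret root_family "\<lambda>s. germ_poly s P" n S
  proof
    show "open S" "convex S" unfolding S_def by (rule open_halfspace_Re_gt convex_halfspace_Re_gt)+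
    show "n > 0" using deg by (simp add: n_def)
    fix s assume "s \<in> S"
    thus "rsquarefree (germ_poly s P)" using T by (simp add: S_def)
  next
    fix i
    have "germ (coeff P i) holomorphic_on S"
    proof (cases "coeff P i \<in> C")
      case True
      thus ?thesis by (intro holomorphic_on_subset[OF hol]) (use T in \<open>auto simp: S_def\<close>)
    next
      case False
      hence "coeff P i = 0" using coeff_C by blast
      moreover have "germ 0 = (\<lambda>_. 0)" by (simp add: fun_eq_iff germ_0)
      ultimately show ?thesis by simp
    qed
    thus "(\<lambda>s. coeff (germ_poly s P) i) holomorphic_on S" by (simp add: coeff_germ_poly)
  qed (rule degree_germ)+
  obtain w m where wm: "m > 0" "w holomorphic_on S" "\<And>s. s \<in> S \<Longrightarrow> poly (germ_poly s P) (w s) = 0"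
    "\<And>s. s \<in> S \<Longrightarrow> w (s + of_nat m * (of_nat N * (2 * of_real pi * \<i>))) = w s"
  proof (rule periodic_holomorphic_root[of "of_nat N * (2 * of_real pi * \<i>)"])
    show "germ_poly (s + of_nat N * (2 * of_real pi * \<i>)) P = germ_poly s P" if "s \<in> S" for s
      by (rule poly_eqI) (simp only: coeff_germ_poly per'[OF coeff_C that])
    show "S \<noteq> {}" unfolding S_def by (metis (mono_tags) Re_complex_of_real empty_iff less_add_one mem_Collect_eq)
  qed (auto simp: S_def)
  \<comment> \<open>The sum dominates each exponent and is nonnegative, so
    \<open>exp (M * Re s)\<close> is at least 1 and absorbs the summand 1 of
    \<open>monic_root_bound\<close>; this produces the factor \<open>real n + 2\<close>.\<close>
  define M where "M = (\<Sum>i\<le>n. \<bar>Mf (coeff P i)\<bar>)"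
  have bound: "norm (w s) \<le> (real n + 2) * exp (M * Re s)" if "T < Re s" for s
  proof -
    have s: "s \<in> S" "0 < Re s" using that T by (auto simp: S_def)
    have "norm (w s) \<le> 1 + (\<Sum>i\<le>n. norm (coeff (germ_poly s P) i))"
      using degree_germ wm(3)[OF s(1)] by (intro monic_root_bound) auto
    also have "(\<Sum>i\<le>n. norm (coeff (germ_poly s P) i)) \<le> (\<Sum>i\<le>n. exp (M * Re s))"
    proof (rule sum_mono)
      fix i assume i: "i \<in> {..n}"
      have "norm (germ (coeff P i) s) \<le> exp (Mf (coeff P i) * Re s)"
        using T[OF that] i by (intro bd) (auto simp: C_def)
      also have "Mf (coeff P i) \<le> \<bar>Mf (coeff P i)\<bar>" by simp
      also have "\<bar>Mf (coeff P i)\<bar> \<le> M" unfolding M_def using i by (intro member_le_sum) auto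
      finally show "norm (coeff (germ_poly s P) i) \<le> exp (M * Re s)"
        using s(2) by (simp add: coeff_germ_poly mult_right_mono)
    qed
    also have "\<dots> = (real n + 1) * exp (M * Re s)" by simp
    finally have "norm (w s) \<le> 1 + (real n + 1) * exp (M * Re s)" by simp
    moreover have "1 \<le> exp (M * Re s)"
      using s(2) by (simp add: M_def sum_nonneg)
    ultimately show ?thesis unfolding distrib_right by linarith
  qed
  have "m * N > 0" using wm(1) N by simp
  then obtain y where y: "\<forall>\<^sub>F s in right_end. germ y s = w s"
    by (rule germ_surj[of "m * N" w T "real n + 2" M]) (use wm bound in \<open>auto simp: S_def mult_ac\<close>)
  have "\<forall>\<^sub>F s in right_end. germ (poly P y) s = 0"
    using y germ_poly_poly[of P y] eventually_right_end_gt[of T]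
    by eventually_elim (use wm(3) in \<open>simp add: S_def\<close>)
  thus ?thesis using germ_eq_0 by blast
qed

text \<open>A rootless polynomial of least positive degree satisfies a Bezout identity with its
  derivative, and \<open>puiseux_monic_root\<close> then gives it a root.\<close>

instance puiseux :: alg_closed_field
proof (rule alg_closedI)
  have "\<exists>y. poly P y = 0" if "degree P > 0" for P :: "puiseux poly"
    using that
  proof (induction "degree P" arbitrary: P rule: less_induct)
    case less
    show ?case
    proof (rule ccontr)
      assume contra: "\<nexists>y. poly P y = 0"
      define Q where "Q = smult (inverse (lead_coeff P)) P"
      have P0: "P \<noteq> 0" using less.prems by auto
      have Q: "degree Q = degree P" "lead_coeff Q = 1" "\<And>y. poly Q y = 0 \<longleftrightarrow> poly P y = 0"
        using P0 by (auto simp: Q_def)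
      obtain U V where "U * Q + V * pderiv Q = 1"
        using min_degree_rootless_coprime_pderiv[of Q] less Q contra by auto
      with puiseux_monic_root[of Q U V] less.prems Q contra show False by simp
    qed
  qed
  thus "\<exists>x. poly p x = 0" if "degree p > 0" "lead_coeff p = 1" for p :: "puiseux poly"
    using that by blast
qed

section \<open>The Hilbert basis theorem\<close>

text \<open>Subrings are carrier sets, so that the rings of polynomial functions in varying sets of
  variables live in one type.\<close>

definition subring_of :: "'r::comm_ring_1 set \<Rightarrow> bool" where
  "subring_of A \<longleftrightarrow> 1 \<in> A \<and> (\<forall>a\<in>A. \<forall>b\<in>A. a - b \<in> A \<and> a * b \<in> A)"

lemma subring_ofD:
  assumes "subring_of A"
  shows "1 \<in> A" "0 \<in> A" "a \<in> A \<Longrightarrow> b \<in> A \<Longrightarrow> a + b \<in> A" "a \<in> A \<Longrightarrow> b \<in> A \<Longrightarrow> a - b \<in> A"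
    "a \<in> A \<Longrightarrow> b \<in> A \<Longrightarrow> a * b \<in> A" "a \<in> A \<Longrightarrow> - a \<in> A" "a \<in> A \<Longrightarrow> a ^ n \<in> A"
proof -
  show 1: "1 \<in> A" and diff: "\<And>a b. a \<in> A \<Longrightarrow> b \<in> A \<Longrightarrow> a - b \<in> A"
    and mult: "\<And>a b. a \<in> A \<Longrightarrow> b \<in> A \<Longrightarrow> a * b \<in> A"
    using assms unfolding subring_of_def by blast+
  show 0: "0 \<in> A" using diff[OF 1 1] by simp
  show minus: "\<And>a. a \<in> A \<Longrightarrow> - a \<in> A" using diff[OF 0] by simp
  show "\<And>a b. a \<in> A \<Longrightarrow> b \<in> A \<Longrightarrow> a + b \<in> A" using diff minus by (metis diff_minus_eq_add)
  show "a \<in> A \<Longrightarrow> a ^ n \<in> A" by (induction n) (auto intro: 1 mult)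
qed

text \<open>Elements of the ring, not formal polynomials: \<open>x\<close> may be algebraic over
  \<open>A\<close>, so neither coefficients nor degree need be unique. The bound \<open>d\<close> on
  the exponents is strict; \<open>d = 0\<close> leaves only 0.\<close>

definition bounded_polys :: "'r::comm_ring_1 set \<Rightarrow> 'r \<Rightarrow> nat \<Rightarrow> 'r set" where
  "bounded_polys A x d = {\<Sum>k<d. a k * x ^ k | a. \<forall>k. a k \<in> A}"

definition adjoin :: "'r::comm_ring_1 set \<Rightarrow> 'r \<Rightarrow> 'r set" where
  "adjoin A x = (\<Union>d. bounded_polys A x d)"

lemma bounded_polysI: "(\<And>k. a k \<in> A) \<Longrightarrow> (\<Sum>k<d. a k * x ^ k) \<in> bounded_polys A x d"
  unfolding bounded_polys_def by blast

lemma bounded_polysE: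
  assumes "f \<in> bounded_polys A x d"
  obtains a where "\<And>k. a k \<in> A" "f = (\<Sum>k<d. a k * x ^ k)"
  using assms unfolding bounded_polys_def by blast

lemma bounded_polys_0: "bounded_polys A x 0 \<subseteq> {0}"
  by (auto simp: bounded_polys_def)

context
  fixes A :: "'r::comm_ring_1 set"
  assumes A: "subring_of A"
begin

lemma bounded_polys_add:
  assumes "f \<in> bounded_polys A x d" "g \<in> bounded_polys A x d"
  shows "f + g \<in> bounded_polys A x d"
proof -
  obtain a b where "\<And>k. a k \<in> A" "f = (\<Sum>k<d. a k * x ^ k)" "\<And>k. b k \<in> A" "g = (\<Sum>k<d. b k * x ^ k)"
    using assms by (auto elim!: bounded_polysE)
  thus ?thesis using bounded_polysI[of "\<lambda>k. a k + b k" A x d]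
    by (simp add: subring_ofD[OF A] sum.distrib distrib_right)
qed

lemma bounded_polys_zero: "0 \<in> bounded_polys A x d"
  using bounded_polysI[of "\<lambda>_. 0" A x d] by (simp add: subring_ofD[OF A])

lemma bounded_polys_scale:
  assumes "c \<in> A" "f \<in> bounded_polys A x d"
  shows "c * f \<in> bounded_polys A x d"
proof -
  obtain a where "\<And>k. a k \<in> A" "f = (\<Sum>k<d. a k * x ^ k)" using assms by (auto elim!: bounded_polysE)
  thus ?thesis using bounded_polysI[of "\<lambda>k. c * a k" A x d] assms(1)
    by (simp add: subring_ofD[OF A] sum_distrib_left mult.assoc)
qed

lemma bounded_polys_diff:
  assumes "f \<in> bounded_polys A x d" "g \<in> bounded_polys A x d"
  shows "f - g \<in> bounded_polys A x d"
  using bounded_polys_add[OF assms(1) bounded_polys_scale[OF _ assms(2), of "-1"]]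
  by (simp add: subring_ofD[OF A])

lemma bounded_polys_monom:
  assumes "c \<in> A" "k < d"
  shows "c * x ^ k \<in> bounded_polys A x d"
proof -
  have "(\<Sum>i<d. (if i = k then c else 0) * x ^ i) = (\<Sum>i<d. if i = k then c * x ^ i else 0)"
    by (rule sum.cong) auto
  also have "\<dots> = c * x ^ k" using assms(2) by (simp add: sum.delta)
  finally show ?thesis
    using bounded_polysI[of "\<lambda>i. if i = k then c else 0" A x d] assms(1) by (simp add: subring_ofD[OF A])
qed

lemma bounded_polys_sum:
  "(\<And>k. k \<in> K \<Longrightarrow> f k \<in> bounded_polys A x d) \<Longrightarrow> (\<Sum>k\<in>K. f k) \<in> bounded_polys A x d"
  by (induction K rule: infinite_finite_induct) (auto intro: bounded_polys_zero bounded_polys_add)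

lemma bounded_polys_shift:
  assumes "c \<in> A" "f \<in> bounded_polys A x d" "d + e \<le> d'"
  shows "c * x ^ e * f \<in> bounded_polys A x d'"
proof -
  obtain a where a: "\<And>k. a k \<in> A" "f = (\<Sum>k<d. a k * x ^ k)" using assms by (auto elim!: bounded_polysE)
  have "c * x ^ e * f = (\<Sum>k<d. (c * a k) * x ^ (k + e))"
    by (simp add: a(2) sum_distrib_left power_add mult_ac)
  thus ?thesis using assms a by (auto intro!: bounded_polys_sum bounded_polys_monom subring_ofD(5)[OF A])
qed

lemma bounded_polys_mono: "d \<le> d' \<Longrightarrow> f \<in> bounded_polys A x d \<Longrightarrow> f \<in> bounded_polys A x d'"
  using bounded_polys_shift[of 1 f x d 0 d'] by (simp add: subring_ofD[OF A])

lemma bounded_polys_SucE: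
  assumes "f \<in> bounded_polys A x (Suc d)"
  obtains g a where "g \<in> bounded_polys A x d" "a \<in> A" "f = g + a * x ^ d"
proof -
  obtain a where a: "\<And>k. a k \<in> A" "f = (\<Sum>k<Suc d. a k * x ^ k)" using assms by (rule bounded_polysE) blast
  show ?thesis
    by (rule that[of "\<Sum>k<d. a k * x ^ k" "a d"]) (use a in \<open>auto intro: bounded_polysI\<close>)
qed

lemma adjoinI: "f \<in> bounded_polys A x d \<Longrightarrow> f \<in> adjoin A x"
  unfolding adjoin_def by blast

lemma subset_adjoin: "a \<in> A \<Longrightarrow> a \<in> adjoin A x"
  using bounded_polys_monom[of a 0 1 x] by (auto intro: adjoinI)

lemma gen_in_adjoin: "x \<in> adjoin A x"
  using bounded_polys_monom[of 1 1 2 x] by (auto intro: adjoinI subring_ofD[OF A])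

lemma subring_of_adjoin: "subring_of (adjoin A x)"
  unfolding subring_of_def
proof (intro conjI ballI)
  show "1 \<in> adjoin A x" by (intro subset_adjoin subring_ofD[OF A])
  fix f g assume "f \<in> adjoin A x" "g \<in> adjoin A x"
  then obtain d d' where d: "f \<in> bounded_polys A x d" "g \<in> bounded_polys A x d'" unfolding adjoin_def by blast
  hence "f \<in> bounded_polys A x (max d d')" "g \<in> bounded_polys A x (max d d')"
    by (auto elim: bounded_polys_mono[rotated])
  thus "f - g \<in> adjoin A x" by (blast intro: adjoinI bounded_polys_diff)
  obtain a where a: "\<And>k. a k \<in> A" "f = (\<Sum>k<d. a k * x ^ k)" using d by (auto elim!: bounded_polysE)
  have "f * g = (\<Sum>k<d. a k * x ^ k * g)" by (simp add: a(2) sum_distrib_right)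
  also have "\<dots> \<in> bounded_polys A x (d' + d)"
    using a d by (intro bounded_polys_sum bounded_polys_shift[where d = d']) auto
  finally show "f * g \<in> adjoin A x" by (rule adjoinI)
qed

text \<open>The leading coefficient \<open>a\<close> need not be invertible, so each reduction step
  multiplies by \<open>a\<close> instead of dividing by it. For \<open>d \<le> m\<close> the
  truncated difference \<open>d - m\<close> forces \<open>q = 0\<close>.\<close>

lemma pseudo_division:
  assumes a: "a \<in> A" and f0: "f0 \<in> bounded_polys A x m" and f: "f = f0 + a * x ^ m"
    and g: "g \<in> bounded_polys A x d"
  shows "\<exists>N q r. q \<in> bounded_polys A x (d - m) \<and> r \<in> bounded_polys A x m \<and> a ^ N * g = q * f + r"
  using g
proof (induction d arbitrary: g)
  case 0
  hence "g = 0" using bounded_polys_0 by blast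
  thus ?case by (intro exI[of _ 0] exI[of _ "0::'r"]) (simp add: bounded_polys_zero)
next
  case (Suc d)
  show ?case
  proof (cases "Suc d \<le> m")
    case True
    hence "g \<in> bounded_polys A x m" using Suc.prems bounded_polys_mono by blast
    thus ?thesis by (intro exI[of _ 0] exI[of _ "0::'r"] exI[of _ g]) (simp add: bounded_polys_zero)
  next
    case False
    obtain g0 b where g0: "g0 \<in> bounded_polys A x d" "b \<in> A" "g = g0 + b * x ^ d"
      using Suc.prems by (rule bounded_polys_SucE)
    have "a * x ^ m * x ^ (d - m) = a * x ^ d" using False by (simp flip: power_add add: mult.assoc)
    hence eq: "a * g - b * x ^ (d - m) * f = a * g0 - b * x ^ (d - m) * f0"
      unfolding g0(3) f by (simp add: algebra_simps)
    have "a * g0 - b * x ^ (d - m) * f0 \<in> bounded_polys A x d"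
      using False a g0 f0 by (intro bounded_polys_diff bounded_polys_scale bounded_polys_shift[where d = m]) auto
    from Suc.IH[OF this] obtain N q r where *: "q \<in> bounded_polys A x (d - m)" "r \<in> bounded_polys A x m"
      "a ^ N * (a * g0 - b * x ^ (d - m) * f0) = q * f + r" by blast
    have "a ^ Suc N * g = (q + (a ^ N * b) * x ^ (d - m)) * f + r"
      using *(3) unfolding eq[symmetric] by (simp add: algebra_simps)
    moreover have "q + (a ^ N * b) * x ^ (d - m) \<in> bounded_polys A x (Suc d - m)"
      using False * a g0 by (intro bounded_polys_add bounded_polys_mono[OF _ *(1)] bounded_polys_monom
          subring_ofD[OF A]) auto
    ultimately show ?thesis using *(2) by blast
  qed
qed

end

definition lin_combs :: "'r::comm_ring_1 set \<Rightarrow> (nat \<Rightarrow> 'r) \<Rightarrow> nat \<Rightarrow> 'r set" where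
  "lin_combs A f m = {\<Sum>k<m. c k * f k | c. \<forall>k. c k \<in> A}"

text \<open>The ascending chain condition for ideals, stated for generators: in every sequence some
  term is a combination of its predecessors.\<close>

definition seq_noetherian :: "'r::comm_ring_1 set \<Rightarrow> bool" where
  "seq_noetherian A \<longleftrightarrow> (\<forall>f. (\<forall>n. f n \<in> A) \<longrightarrow> (\<exists>m. f m \<in> lin_combs A f m))"

definition submodule_of :: "'r::comm_ring_1 set \<Rightarrow> 'r set \<Rightarrow> bool" where
  "submodule_of A J \<longleftrightarrow> 0 \<in> J \<and> (\<forall>h\<in>J. \<forall>h'\<in>J. h + h' \<in> J) \<and> (\<forall>a\<in>A. \<forall>h\<in>J. a * h \<in> J)"

lemma lin_combs_subset:
  assumes "submodule_of A J" "\<And>k. k < m \<Longrightarrow> g k \<in> J"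
  shows "lin_combs A g m \<subseteq> J"
proof -
  have "(\<Sum>k<m. c k * g k) \<in> J" if "\<forall>k. c k \<in> A" for c
    using assms that by (induction m) (auto simp: submodule_of_def)
  thus ?thesis unfolding lin_combs_def by blast
qed

lemma submodule_lin_combs:
  assumes "subring_of A"
  shows "submodule_of A (lin_combs A f m)"
  unfolding submodule_of_def
proof (intro conjI ballI)
  show "0 \<in> lin_combs A f m"
    unfolding lin_combs_def by (rule CollectI, rule exI[of _ "\<lambda>_. 0"]) (simp add: subring_ofD[OF assms])
next
  fix h h' assume "h \<in> lin_combs A f m" "h' \<in> lin_combs A f m"
  then obtain c c' where "\<forall>k. c k \<in> A" "\<forall>k. c' k \<in> A" "h = (\<Sum>k<m. c k * f k)" "h' = (\<Sum>k<m. c' k * f k)"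
    unfolding lin_combs_def by blast
  thus "h + h' \<in> lin_combs A f m"
    unfolding lin_combs_def by (intro CollectI exI[of _ "\<lambda>k. c k + c' k"])
       (simp add: subring_ofD[OF assms] sum.distrib distrib_right)
next
  fix a h assume "a \<in> A" "h \<in> lin_combs A f m"
  then obtain c where "\<forall>k. c k \<in> A" "h = (\<Sum>k<m. c k * f k)" unfolding lin_combs_def by blast
  thus "a * h \<in> lin_combs A f m"
    unfolding lin_combs_def using \<open>a \<in> A\<close> by (intro CollectI exI[of _ "\<lambda>k. a * c k"])
       (simp add: subring_ofD[OF assms] sum_distrib_left mult.assoc)
qed

lemma in_lin_combs:
  assumes "subring_of A" "k < m"
  shows "f k \<in> lin_combs A f m"
proof -
  have "(\<Sum>i<m. (if i = k then 1 else 0) * f i) = (\<Sum>i<m. if i = k then f i else 0)"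
    by (rule sum.cong) auto
  also have "\<dots> = f k" using assms(2) by (simp add: sum.delta)
  finally show ?thesis unfolding lin_combs_def
    by (intro CollectI exI[of _ "\<lambda>i. if i = k then 1 else 0"]) (simp add: subring_ofD[OF assms(1)])
qed

lemma lin_combs_mono: "subring_of A \<Longrightarrow> m \<le> m' \<Longrightarrow> lin_combs A f m \<subseteq> lin_combs A f m'"
  by (intro lin_combs_subset submodule_lin_combs in_lin_combs) auto

text \<open>In the ideal generated by a bad sequence, elements are chosen successively of least
  degree outside the span of the earlier ones. Some leading coefficient is a combination of the
  earlier leading coefficients; cancelling it gives an element of smaller degree that is still
  outside the span.\<close>

theorem hilbert_basis:
  fixes A :: "'r::comm_ring_1 set"
  assumes A: "subring_of A" and noeth: "seq_noetherian A"
  shows "seq_noetherian (adjoin A x)"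
proof (rule ccontr)
  let ?B = "adjoin A x"
  note B = subring_of_adjoin[OF A, of x]
  assume "\<not> ?thesis"
  then obtain f where f: "\<And>n. f n \<in> ?B" "\<And>m. f m \<notin> lin_combs ?B f m"
    unfolding seq_noetherian_def by blast
  define J where "J = (\<Union>m. lin_combs ?B f m)"
  \<comment> \<open>Finitely many elements of \<open>J\<close> involve only finitely many terms of
    \<open>f\<close>, so some term of \<open>f\<close> lies outside their span and the choice never
    stops.\<close>
  have common: "\<exists>M. lin_combs ?B g m \<subseteq> lin_combs ?B f M" if "\<And>k. k < m \<Longrightarrow> g k \<in> J" for g m
  proof -
    have "\<exists>M. \<forall>k<m. g k \<in> lin_combs ?B f M"
      using that
    proof (induction m)
      case (Suc m)
      then obtain M where "\<forall>k<m. g k \<in> lin_combs ?B f M" by auto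
      moreover obtain M' where "g m \<in> lin_combs ?B f M'" using Suc.prems[of m] unfolding J_def by auto
      ultimately have "\<forall>k<Suc m. g k \<in> lin_combs ?B f (max M M')"
        using lin_combs_mono[OF B, of M "max M M'" f] lin_combs_mono[OF B, of M' "max M M'" f]
        by (auto simp: less_Suc_eq)
      thus ?case ..
    qed simp
    then obtain M where "\<And>k. k < m \<Longrightarrow> g k \<in> lin_combs ?B f M" by blast
    hence "lin_combs ?B g m \<subseteq> lin_combs ?B f M" by (rule lin_combs_subset[OF submodule_lin_combs[OF B]])
    thus ?thesis ..
  qed
  have J_module: "submodule_of ?B J"
    unfolding submodule_of_def
  proof (intro conjI ballI)
    show "0 \<in> J" using submodule_lin_combs[OF B, of f] unfolding J_def submodule_of_def by blast
    fix h h' assume "h \<in> J" "h' \<in> J"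
    then obtain m m' where "h \<in> lin_combs ?B f m" "h' \<in> lin_combs ?B f m'" unfolding J_def by blast
    hence "h \<in> lin_combs ?B f (max m m')" "h' \<in> lin_combs ?B f (max m m')"
      using lin_combs_mono[OF B, of m "max m m'" f] lin_combs_mono[OF B, of m' "max m m'" f] by auto
    thus "h + h' \<in> J" using submodule_lin_combs[OF B, of f] unfolding J_def submodule_of_def by blast
  next
    fix b h assume "b \<in> ?B" "h \<in> J"
    thus "b * h \<in> J" using submodule_lin_combs[OF B, of f] unfolding J_def submodule_of_def by blast
  qed
  have J_sub: "J \<subseteq> ?B"
  proof -
    have "submodule_of ?B ?B" using B by (auto simp: submodule_of_def subring_ofD)
    hence "lin_combs ?B f m \<subseteq> ?B" for m by (rule lin_combs_subset) (rule f(1))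
    thus ?thesis unfolding J_def by blast
  qed
  define deg where "deg = (\<lambda>h. LEAST d. h \<in> bounded_polys A x d)"
  have deg: "h \<in> bounded_polys A x (deg h)" if "h \<in> J" for h
    unfolding deg_def by (rule LeastI_ex[of "\<lambda>d. h \<in> bounded_polys A x d"]) (use that J_sub in \<open>auto simp: adjoin_def\<close>)
  have deg_le: "deg h \<le> d" if "h \<in> bounded_polys A x d" for h d
    unfolding deg_def using that by (rule Least_le)
  define P where "P = (\<lambda>g m h. h \<in> J \<and> h \<notin> lin_combs ?B g m \<and> (\<forall>h'\<in>J. h' \<notin> lin_combs ?B g m \<longrightarrow> deg h \<le> deg h'))"
  have "\<exists>g. \<forall>m. P g m (g m)"
  proof (rule dependent_wf_choice[OF wf_less])
    fix g g' :: "nat \<Rightarrow> 'r" and m h assume "\<And>z. (z, m) \<in> {(x, y). x < y} \<Longrightarrow> g z = g' z"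
    hence "lin_combs ?B g m = lin_combs ?B g' m" unfolding lin_combs_def by auto
    thus "P g m h = P g' m h" unfolding P_def by simp
  next
    fix m and g :: "nat \<Rightarrow> 'r" assume "\<And>y. (y, m) \<in> {(x, y). x < y} \<Longrightarrow> P g y (g y)"
    hence "\<And>k. k < m \<Longrightarrow> g k \<in> J" by (simp add: P_def)
    then obtain M where "lin_combs ?B g m \<subseteq> lin_combs ?B f M" using common by blast
    hence "f M \<notin> lin_combs ?B g m" using f(2) by blast
    moreover have "f M \<in> J" unfolding J_def using in_lin_combs[OF B, of M "Suc M"] by blast
    ultimately show "\<exists>h. P g m h"
      using ex_has_least_nat[of "\<lambda>h. h \<in> J \<and> h \<notin> lin_combs ?B g m" "f M" deg] unfolding P_def by blast
  qed
  then obtain g where g: "\<And>m. g m \<in> J" "\<And>m. g m \<notin> lin_combs ?B g m"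
    and least: "\<And>m h. h \<in> J \<Longrightarrow> h \<notin> lin_combs ?B g m \<Longrightarrow> deg (g m) \<le> deg h"
    unfolding P_def by blast
  \<comment> \<open>\<open>deg\<close> is a strict bound on the exponents, so the leading exponent
    is one less.\<close>
  define D where "D = (\<lambda>m. deg (g m) - 1)"
  have deg_pos: "deg (g m) = Suc (D m)" for m
  proof -
    have "deg (g m) \<noteq> 0"
    proof
      assume "deg (g m) = 0"
      hence "g m = 0" using deg[OF g(1), of m] bounded_polys_0 by fastforce
      thus False using g(2)[of m] submodule_lin_combs[OF B, of g m] by (simp add: submodule_of_def)
    qed
    thus ?thesis by (simp add: D_def)
  qed
  have "\<exists>g0 a. g0 \<in> bounded_polys A x (D m) \<and> a \<in> A \<and> g m = g0 + a * x ^ D m" for m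
    using deg[OF g(1), of m] unfolding deg_pos by (blast elim: bounded_polys_SucE[OF A])
  then obtain g0 a where ga: "\<And>m. g0 m \<in> bounded_polys A x (D m)" "\<And>m. a m \<in> A"
    "\<And>m. g m = g0 m + a m * x ^ D m" by metis
  have D_mono: "D k \<le> D m" if "k < m" for k m
  proof -
    have "g m \<notin> lin_combs ?B g k" using g(2)[of m] lin_combs_mono[OF B, of k m g] that by auto
    hence "deg (g k) \<le> deg (g m)" using least g(1) by blast
    thus ?thesis by (simp add: deg_pos)
  qed
  obtain m where "a m \<in> lin_combs A a m" using noeth ga(2) unfolding seq_noetherian_def by blast
  then obtain c where c: "\<And>k. c k \<in> A" "a m = (\<Sum>k<m. c k * a k)" unfolding lin_combs_def by blast
  \<comment> \<open>The earlier \<open>g k\<close>, shifted to exponent \<open>D m\<close>, cancel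
    the leading term of \<open>g m\<close>; the shift is possible because \<open>D\<close> is
    nondecreasing.\<close>
  define s where "s = (\<Sum>k<m. (c k * x ^ (D m - D k)) * g k)"
  define h where "h = g m - s"
  have s: "s \<in> lin_combs ?B g m"
    unfolding s_def lin_combs_def
    by (intro CollectI exI[of _ "\<lambda>k. c k * x ^ (D m - D k)"] conjI refl allI subring_ofD[OF B]
        subset_adjoin[OF A] c gen_in_adjoin[OF A])
  have "h \<notin> lin_combs ?B g m"
  proof
    assume "h \<in> lin_combs ?B g m"
    hence "h + s \<in> lin_combs ?B g m" using s submodule_lin_combs[OF B, of g m] by (simp add: submodule_of_def)
    thus False using g(2)[of m] by (simp add: h_def)
  qed
  moreover have "h \<in> J"
  proof -
    have "s \<in> J" using s lin_combs_subset[OF J_module, of m g] g(1) by blast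
    hence "- 1 * s \<in> J" using J_module subring_ofD(6)[OF B subring_ofD(1)[OF B]] unfolding submodule_of_def by blast
    hence "g m + - 1 * s \<in> J" using g(1)[of m] J_module unfolding submodule_of_def by blast
    thus ?thesis by (simp add: h_def)
  qed
  moreover have "h \<in> bounded_polys A x (D m)"
  proof -
    have "(c k * x ^ (D m - D k)) * g k = c k * x ^ (D m - D k) * g0 k + c k * a k * x ^ D m" if "k < m" for k
    proof -
      have "x ^ (D m - D k) * x ^ D k = x ^ D m" using D_mono[OF that] by (simp flip: power_add)
      hence "c k * x ^ (D m - D k) * (a k * x ^ D k) = c k * a k * x ^ D m" by (simp add: mult_ac)
      thus ?thesis unfolding ga(3)[of k] by (simp add: distrib_left)
    qed
    hence "s = (\<Sum>k<m. c k * x ^ (D m - D k) * g0 k) + a m * x ^ D m"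
      unfolding s_def c(2) by (simp add: sum.distrib sum_distrib_right)
    hence "h = g0 m - (\<Sum>k<m. c k * x ^ (D m - D k) * g0 k)" unfolding h_def ga(3)[of m] by simp
    also have "\<dots> \<in> bounded_polys A x (D m)"
      using D_mono by (intro bounded_polys_diff[OF A] ga bounded_polys_sum[OF A] bounded_polys_shift[OF A c(1) ga(1)]) auto
    finally show ?thesis .
  qed
  ultimately show False using least[of h m] deg_le[of h "D m"] deg_pos[of m] by simp
qed

section \<open>Algebraic extensions by one element\<close>

text \<open>Modelled on the ideal of functions vanishing on an irreducible set. No quotient is
  formed: being 0 means membership in \<open>p\<close>, and a nonzero class counts as invertible
  over the fraction field if it has a multiple that agrees modulo \<open>p\<close> with an element
  of \<open>A\<close> outside \<open>p\<close>.\<close>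

locale algebraic_extension =
  fixes A :: "'r::comm_ring_1 set" and x :: 'r and p :: "'r set"
  assumes A: "subring_of A"
    and p_zero: "0 \<in> p"
    and p_diff: "f \<in> p \<Longrightarrow> g \<in> p \<Longrightarrow> f - g \<in> p"
    and p_mult: "f \<in> p \<Longrightarrow> f * g \<in> p"
    and p_prime: "f \<in> adjoin A x \<Longrightarrow> g \<in> adjoin A x \<Longrightarrow> f * g \<in> p \<Longrightarrow> f \<in> p \<or> g \<in> p"
    and p_proper: "1 \<notin> p"
begin

abbreviation "poly_lt \<equiv> bounded_polys A x"

lemmas B = subring_of_adjoin[OF A, of x]
lemmas lt_in_adjoin = adjoinI[OF A]

lemma p_add: "f \<in> p \<Longrightarrow> g \<in> p \<Longrightarrow> f + g \<in> p"
  using p_diff[of f "0 - g"] p_diff[OF p_zero, of g] by simp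

lemma p_diff_iff: "f - g \<in> p \<Longrightarrow> f \<in> p \<longleftrightarrow> g \<in> p"
  using p_diff[of f "f - g"] p_add[of "f - g" g] by auto

lemma p_power: "f \<in> adjoin A x \<Longrightarrow> f ^ n \<in> p \<Longrightarrow> f \<in> p"
  by (induction n) (use p_proper p_prime subring_ofD(7)[OF B] in auto)

text \<open>The least \<open>m\<close> in such a relation is the degree of \<open>x\<close> over the fraction field of \<open>A / p\<close>.\<close>

definition relation :: "nat \<Rightarrow> 'r \<Rightarrow> 'r \<Rightarrow> bool" where
  "relation m a f \<longleftrightarrow> a \<in> A \<and> a \<notin> p \<and> f \<in> p \<and> f - a * x ^ m \<in> poly_lt m"

text \<open>Modulo \<open>p\<close>, all terms above the largest index with coefficient outside
  \<open>p\<close> can be discarded.\<close>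

lemma drop_leading_terms:
  assumes "f \<in> poly_lt d" "f = (\<Sum>k<d. c k * x ^ k)" "\<And>k. c k \<in> A" "j < d" "c j \<notin> p"
  obtains m where "m < d" "c m \<notin> p" "(\<Sum>k<m. c k * x ^ k) \<in> poly_lt m"
    "f - ((\<Sum>k<m. c k * x ^ k) + c m * x ^ m) \<in> p"
proof -
  define m where "m = (GREATEST m. m < d \<and> c m \<notin> p)"
  have m: "m < d \<and> c m \<notin> p" unfolding m_def by (rule GreatestI_nat[of _ j d]) (use assms in auto)
  have gr: "c k \<in> p" if "m < k" "k < d" for k
  proof (rule ccontr)
    assume "c k \<notin> p"
    hence "k \<le> m" unfolding m_def using that by (intro Greatest_le_nat[of _ _ d]) auto
    thus False using that by simp
  qed
  have sum_p: "(\<Sum>k\<in>K. c k * x ^ k) \<in> p" if "\<And>k. k \<in> K \<Longrightarrow> c k \<in> p" for K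
    using that by (induction K rule: infinite_finite_induct) (auto intro: p_zero p_add p_mult)
  have "f = (\<Sum>k<Suc m. c k * x ^ k) + (\<Sum>k\<in>{Suc m..<d}. c k * x ^ k)"
    unfolding assms(2) using m by (subst sum.union_disjoint[symmetric]) (auto intro!: sum.cong)
  hence "f - ((\<Sum>k<m. c k * x ^ k) + c m * x ^ m) = (\<Sum>k\<in>{Suc m..<d}. c k * x ^ k)" by simp
  also have "\<dots> \<in> p" by (rule sum_p) (use gr in auto)
  finally show ?thesis using that m assms(3) by (blast intro: bounded_polysI)
qed

context
  fixes m a f
  assumes rel: "relation m a f" and minimal: "\<forall>m' a' f'. relation m' a' f' \<longrightarrow> m \<le> m'"
begin

text \<open>The powers of \<open>x\<close> below \<open>m\<close> are linearly independent modulo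
  \<open>p\<close>: once leading terms in \<open>p\<close> are dropped, a nontrivial relation would
  have degree below the minimal \<open>m\<close>.\<close>

lemma coeffs_in_p:
  assumes "\<And>k. c k \<in> A" "(\<Sum>k<d. c k * x ^ k) \<in> p" "d \<le> m" "j < d"
  shows "c j \<in> p"
proof (rule ccontr)
  assume "c j \<notin> p"
  then obtain n where n: "n < d" "c n \<notin> p" "(\<Sum>k<n. c k * x ^ k) \<in> poly_lt n"
    "(\<Sum>k<d. c k * x ^ k) - ((\<Sum>k<n. c k * x ^ k) + c n * x ^ n) \<in> p"
    by (rule drop_leading_terms[OF bounded_polysI[of c A x d, OF assms(1)] refl assms(1,4)]) blast
  hence "(\<Sum>k<n. c k * x ^ k) + c n * x ^ n \<in> p" using assms(2) p_diff_iff by blast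
  hence "relation n (c n) ((\<Sum>k<n. c k * x ^ k) + c n * x ^ n)"
    using n assms(1) by (simp add: relation_def)
  thus False using minimal n(1) assms(3) by fastforce
qed

text \<open>This replaces inverting \<open>v\<close> over the fraction field. A multiple of
  \<open>v\<close> of least degree \<open>d\<close> modulo \<open>p\<close> is compared with the
  minimal relation \<open>f\<close>; both \<open>m \<le> d\<close> and \<open>0 < d < m\<close> are
  contradictory, so the multiple lies in \<open>A\<close>.\<close>

lemma multiple_in_base:
  assumes v: "v \<in> adjoin A x" "v \<notin> p"
  obtains u b where "u \<in> adjoin A x" "b \<in> A" "b \<notin> p" "u * v - b \<in> p"
proof -
  \<comment> \<open>A candidate is a multiple \<open>u * v\<close>, represented modulo
    \<open>p\<close> by some \<open>g\<close> with leading term \<open>b * x ^ d\<close> and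
    \<open>b\<close> outside \<open>p\<close>.\<close>
  define cand where "cand = (\<lambda>d b g u. b \<in> A \<and> b \<notin> p \<and> g - b * x ^ d \<in> poly_lt d \<and> g \<notin> p \<and>
     u \<in> adjoin A x \<and> u * v - g \<in> p)"
  have candI: "\<exists>d' b g'. d' < d \<and> cand d' b g' u"
    if g: "g \<in> poly_lt d" "g \<notin> p" "u \<in> adjoin A x" "u * v - g \<in> p" for d g u
  proof -
    obtain c where c: "\<And>k. c k \<in> A" "g = (\<Sum>k<d. c k * x ^ k)" using g(1) by (rule bounded_polysE) blast
    have "\<exists>j<d. c j \<notin> p"
    proof (rule ccontr)
      assume "\<not> ?thesis"
      hence "(\<Sum>k\<in>K. c k * x ^ k) \<in> p" if "K \<subseteq> {..<d}" for K
        using that by (induction K rule: infinite_finite_induct) (auto intro: p_zero p_add p_mult)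
      thus False using g(2) c(2) by blast
    qed
    then obtain j where "j < d" "c j \<notin> p" by blast
    from drop_leading_terms[OF g(1) c(2,1) this] obtain n where n: "n < d" "c n \<notin> p"
      "(\<Sum>k<n. c k * x ^ k) \<in> poly_lt n" "g - ((\<Sum>k<n. c k * x ^ k) + c n * x ^ n) \<in> p" by blast
    define g' where "g' = (\<Sum>k<n. c k * x ^ k) + c n * x ^ n"
    have "g' \<notin> p" using n(4) g(2) p_diff_iff unfolding g'_def by blast
    moreover have "u * v - g' \<in> p"
    proof -
      have "(u * v - g) + (g - g') \<in> p" using p_add[OF g(4)] n(4) unfolding g'_def by blast
      thus ?thesis by simp
    qed
    ultimately have "cand n (c n) g' u"
      using n c(1) g(3) by (simp add: cand_def g'_def)
    thus ?thesis using n(1) by blast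
  qed
  obtain d0 where "v \<in> poly_lt d0" using v(1) unfolding adjoin_def by blast
  hence "\<exists>d b g u. cand d b g u" using candI[of v d0 1] v(2) subring_ofD(1)[OF B] p_zero by auto
  then obtain d b g u where cand: "cand d b g u" and least: "\<And>d' b' g' u'. cand d' b' g' u' \<Longrightarrow> d \<le> d'"
    using exists_least_iff[of "\<lambda>d. \<exists>b g u. cand d b g u"] by (metis not_le)
  from cand have b: "b \<in> A" "b \<notin> p" and g0: "g - b * x ^ d \<in> poly_lt d" and g: "g \<notin> p"
    and u: "u \<in> adjoin A x" "u * v - g \<in> p" by (auto simp: cand_def)
  from rel have a: "a \<in> A" "a \<notin> p" and f: "f \<in> p" and f0: "f - a * x ^ m \<in> poly_lt m"
    by (auto simp: relation_def)
  have aB: "a \<in> adjoin A x" and bB: "b \<in> adjoin A x" using a b subset_adjoin[OF A] by auto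
  have gB: "g \<in> adjoin A x"
  proof -
    have "(g - b * x ^ d) + b * x ^ d \<in> adjoin A x"
      by (intro subring_ofD[OF B] lt_in_adjoin[OF g0] bB gen_in_adjoin[OF A])
    thus ?thesis by simp
  qed
  have "d < m"
  proof (rule ccontr)
    assume "\<not> d < m"
    hence dm: "x ^ (d - m) * x ^ m = x ^ d" by (simp flip: power_add)
    \<comment> \<open>Subtracting a multiple of \<open>f\<close>, which is 0 modulo
      \<open>p\<close>, removes the leading term. The result represents \<open>a * u * v\<close> in
      lower degree and is outside \<open>p\<close> because \<open>a * g\<close> is.\<close>
    define h where "h = a * g - b * x ^ (d - m) * f"
    have "h = a * (g - b * x ^ d) - b * x ^ (d - m) * (f - a * x ^ m)"
      unfolding h_def dm[symmetric] by (simp add: algebra_simps)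
    also have "\<dots> \<in> poly_lt d"
      using \<open>\<not> d < m\<close> by (intro bounded_polys_diff[OF A] bounded_polys_scale[OF A] a g0
         bounded_polys_shift[OF A b(1) f0]) auto
    finally have h: "h \<in> poly_lt d" .
    have fp: "b * x ^ (d - m) * f \<in> p" using p_mult[OF f, of "b * x ^ (d - m)"] by (simp add: mult_ac)
    have "a * g \<notin> p" using p_prime[OF aB gB] a g by blast
    hence hp: "h \<notin> p" using p_add[of h "b * x ^ (d - m) * f"] fp unfolding h_def by auto
    have "(a * u) * v - h = (u * v - g) * a + b * x ^ (d - m) * f" by (simp add: h_def algebra_simps)
    hence "(a * u) * v - h \<in> p" using p_add[OF p_mult[OF u(2), of a] fp] by simp
    moreover have "a * u \<in> adjoin A x" using aB u subring_ofD[OF B] by blast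
    ultimately show False using candI[OF h hp] least by (meson not_le)
  qed
  have "d = 0"
  proof (rule ccontr)
    assume "d \<noteq> 0"
    have dm: "x ^ (m - d) * x ^ d = x ^ m" using \<open>d < m\<close> by (simp flip: power_add)
    \<comment> \<open>The first step of dividing \<open>f\<close> by \<open>g\<close> is made by
      hand, so that the leading coefficient of the full quotient \<open>Q\<close> is known to be
      \<open>b ^ N * a\<close>, which is outside \<open>p\<close>. The remainder lies in
      \<open>p\<close> by the choice of \<open>d\<close>, hence so does \<open>Q\<close>; but
      \<open>Q\<close> has degree \<open>m - d < m\<close>, contrary to
      \<open>coeffs_in_p\<close>.\<close>
    define f1 where "f1 = b * f - a * x ^ (m - d) * g"
    have "f1 = b * (f - a * x ^ m) - a * x ^ (m - d) * (g - b * x ^ d)"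
      unfolding f1_def dm[symmetric] by (simp add: algebra_simps)
    also have "\<dots> \<in> poly_lt m"
      using \<open>d < m\<close> by (intro bounded_polys_diff[OF A] bounded_polys_scale[OF A] b f0
         bounded_polys_shift[OF A a(1) g0]) auto
    finally have f1: "f1 \<in> poly_lt m" .
    have "g = (g - b * x ^ d) + b * x ^ d" by simp
    from pseudo_division[OF A b(1) g0 this f1] obtain N q r where
      q: "q \<in> poly_lt (m - d)" and r: "r \<in> poly_lt d" and eq: "b ^ N * f1 = q * g + r" by blast
    define Q where "Q = q + b ^ N * a * x ^ (m - d)"
    have eq': "b ^ N * b * f = Q * g + r"
      using eq unfolding f1_def Q_def by (simp add: algebra_simps)
    have QB: "Q \<in> adjoin A x"
      unfolding Q_def by (intro subring_ofD[OF B] lt_in_adjoin[OF q] bB aB gen_in_adjoin[OF A])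
    have Qg_r: "Q * g + r \<in> p" using p_mult[OF f, of "b ^ N * b"] eq' by (simp add: mult_ac)
    have "r \<in> p"
    proof (rule ccontr)
      assume rp: "r \<notin> p"
      have "(- Q * u) * v - r = (u * v - g) * (- Q) - (Q * g + r)" by (simp add: algebra_simps)
      hence "(- Q * u) * v - r \<in> p" using p_diff[OF p_mult[OF u(2), of "- Q"] Qg_r] by (simp only:)
      moreover have "- Q * u \<in> adjoin A x" by (intro subring_ofD[OF B] QB u)
      ultimately show False using candI[OF r rp] least by (meson not_le)
    qed
    hence "Q * g \<in> p" using p_diff[OF Qg_r, of r] by simp
    hence Qp: "Q \<in> p" using p_prime[OF QB gB] g by blast
    obtain c where c: "\<And>k. c k \<in> A" "q = (\<Sum>k<m - d. c k * x ^ k)" using q by (rule bounded_polysE) blast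
    define c' where "c' = c(m - d := b ^ N * a)"
    have c'A: "c' k \<in> A" for k using c(1) a b subring_ofD[OF A] by (simp add: c'_def)
    have "Q = (\<Sum>k<Suc (m - d). c' k * x ^ k)"
      unfolding Q_def c(2) by (simp add: c'_def)
    hence "c' (m - d) \<in> p" using coeffs_in_p[of c' "Suc (m - d)" "m - d"] c'A Qp \<open>d \<noteq> 0\<close> \<open>d < m\<close> by auto
    hence "b ^ N * a \<in> p" by (simp add: c'_def)
    thus False using p_prime[OF subring_ofD(7)[OF B bB, of N] aB] p_power[OF bB, of N] a b by blast
  qed
  have "g = b" using g0 bounded_polys_0[of A x] unfolding \<open>d = 0\<close> by auto
  thus ?thesis using that b u by blast
qed

end

end

section \<open>Rings of polynomial functions\<close>

inductive_set polyfun :: "'n set \<Rightarrow> ('k::comm_ring_1 ^ 'n \<Rightarrow> 'k) set" for M where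
  polyfun_const: "(\<lambda>_. c) \<in> polyfun M"
| polyfun_coord: "i \<in> M \<Longrightarrow> (\<lambda>x. x $ i) \<in> polyfun M"
| polyfun_add: "f \<in> polyfun M \<Longrightarrow> g \<in> polyfun M \<Longrightarrow> f + g \<in> polyfun M"
| polyfun_mult: "f \<in> polyfun M \<Longrightarrow> g \<in> polyfun M \<Longrightarrow> f * g \<in> polyfun M"

lemma polyfun_mono: "f \<in> polyfun M \<Longrightarrow> M \<subseteq> M' \<Longrightarrow> f \<in> polyfun M'"
  by (induction rule: polyfun.induct) (auto intro: polyfun.intros)

lemma polyfun_uminus: "f \<in> polyfun M \<Longrightarrow> - f \<in> polyfun M"
  using polyfun_mult[OF polyfun_const[of "-1"], of f M] by (simp add: fun_eq_iff fun_Compl_def func_times)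

lemma polyfun_diff: "f \<in> polyfun M \<Longrightarrow> g \<in> polyfun M \<Longrightarrow> f - g \<in> polyfun M"
  using polyfun_add[OF _ polyfun_uminus, of f M g] by simp

lemma subring_of_polyfun: "subring_of (polyfun M)"
  unfolding subring_of_def using polyfun_const[of 1 M]
  by (auto intro: polyfun_diff polyfun_mult simp: func_one)

lemma polyfun_cong: "f \<in> polyfun M \<Longrightarrow> (\<And>i. i \<in> M \<Longrightarrow> x $ i = y $ i) \<Longrightarrow> f x = f y"
  by (induction rule: polyfun.induct) auto

text \<open>Variables can be added one at a time, so results about \<open>adjoin\<close> apply by
  induction on the set of variables.\<close>

lemma polyfun_insert: "polyfun (insert j M) = adjoin (polyfun M) (\<lambda>x :: 'k::comm_ring_1 ^ 'n. x $ j)"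
proof (intro equalityI subsetI)
  note A = subring_of_polyfun[of M, where 'a = 'k]
  note B = subring_of_adjoin[OF A]
  fix f :: "'k ^ 'n \<Rightarrow> 'k" assume "f \<in> polyfun (insert j M)"
  thus "f \<in> adjoin (polyfun M) (\<lambda>x. x $ j)"
  proof (induction rule: polyfun.induct)
    case (polyfun_coord i)
    thus ?case by (cases "i = j") (auto intro: subset_adjoin[OF A] gen_in_adjoin[OF A] polyfun.polyfun_coord)
  qed (blast intro: subset_adjoin[OF A] polyfun_const subring_ofD(3,5)[OF B])+
next
  fix f :: "'k ^ 'n \<Rightarrow> 'k" assume "f \<in> adjoin (polyfun M) (\<lambda>x. x $ j)"
  then obtain d a where a: "\<And>k. a k \<in> polyfun M" "f = (\<Sum>k<d. a k * (\<lambda>x. x $ j) ^ k)"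
    unfolding adjoin_def by (auto elim!: bounded_polysE)
  have "(\<Sum>k\<in>K. a k * (\<lambda>x. x $ j) ^ k) \<in> polyfun (insert j M)" for K :: "nat set"
  proof (induction K rule: infinite_finite_induct)
    case (insert k K)
    have *: "a k * (\<lambda>x. x $ j) ^ k \<in> polyfun (insert j M)"
      by (intro polyfun_mult subring_ofD(7)[OF subring_of_polyfun] polyfun_coord polyfun_mono[OF a(1)]) auto
    show ?case unfolding sum.insert[OF insert.hyps] by (rule polyfun_add[OF * insert.IH])
  qed (simp_all only: sum.empty sum.infinite subring_ofD(2)[OF subring_of_polyfun] not_False_eq_True)
  thus "f \<in> polyfun (insert j M)" unfolding a(2) .
qed

lemma polyfun_empty: "polyfun {} = range (\<lambda>c _. c)"
proof (intro equalityI subsetI)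
  fix f :: "'a ^ 'b \<Rightarrow> 'a" assume "f \<in> polyfun {}"
  thus "f \<in> range (\<lambda>c _. c)"
    by (induction rule: polyfun.induct) (auto simp: fun_eq_iff intro!: image_eqI)
qed (auto intro: polyfun_const)

lemma seq_noetherian_polyfun: "finite M \<Longrightarrow> seq_noetherian (polyfun M :: ('k::field ^ 'n \<Rightarrow> 'k) set)"
proof (induction M rule: finite_induct)
  case empty
  show ?case unfolding seq_noetherian_def
  proof (intro allI impI)
    fix f :: "nat \<Rightarrow> 'k ^ 'n \<Rightarrow> 'k" assume f: "\<forall>n. f n \<in> polyfun {}"
    hence "\<forall>n. \<exists>c. f n = (\<lambda>_. c)" unfolding polyfun_empty by (simp add: image_iff)
    then obtain c where c: "\<And>n. f n = (\<lambda>_. c n)" using choice[of "\<lambda>n c. f n = (\<lambda>_. c)"] by auto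
    \<comment> \<open>A constant is either 0, which is the empty combination, or divides every other
      constant; so \<open>m = 0\<close> or \<open>m = 1\<close> works.\<close>
    show "\<exists>m. f m \<in> lin_combs (polyfun {}) f m"
    proof (cases "c 0 = 0")
      case True
      thus ?thesis by (intro exI[of _ 0]) (auto simp: lin_combs_def c fun_eq_iff intro: polyfun_const)
    next
      case False
      hence "f 1 = (\<Sum>k<1. (\<lambda>k _. c 1 / c 0) k * f k)" by (auto simp: c fun_eq_iff)
      thus ?thesis unfolding lin_combs_def by (intro exI[of _ 1] CollectI exI[of _ "\<lambda>k _. c 1 / c 0"]) (auto intro: polyfun_const)
    qed
  qed
next
  case (insert j M)
  thus ?case unfolding polyfun_insert by (intro hilbert_basis subring_of_polyfun)
qed

section \<open>Affine varieties\<close>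

lemma sum_fun_apply: "(\<Sum>k\<in>K. f k) x = (\<Sum>k\<in>K. f k x)"
  by (induction K rule: infinite_finite_induct) auto

lemma power_fun_apply: "(f ^ n) x = f x ^ n"
  by (induction n) auto

definition aff_closed :: "('k::field ^ 'n) set \<Rightarrow> bool" where
  "aff_closed Z \<longleftrightarrow> (\<exists>E \<subseteq> polyfun UNIV. Z = {x. \<forall>f\<in>E. f x = 0})"

definition aff_irreducible :: "('k::field ^ 'n) set \<Rightarrow> bool" where
  "aff_irreducible Z \<longleftrightarrow> aff_closed Z \<and> Z \<noteq> {} \<and>
     (\<forall>Z1 Z2. aff_closed Z1 \<longrightarrow> aff_closed Z2 \<longrightarrow> Z \<subseteq> Z1 \<union> Z2 \<longrightarrow> Z \<subseteq> Z1 \<or> Z \<subseteq> Z2)"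

lemma aff_closed_separate:
  assumes "aff_closed Z" "x \<notin> Z"
  obtains f where "f \<in> polyfun UNIV" "\<And>z. z \<in> Z \<Longrightarrow> f z = 0" "f x \<noteq> 0"
  using assms unfolding aff_closed_def by blast

lemma aff_closed_zeros: "f \<in> polyfun UNIV \<Longrightarrow> aff_closed {x. f x = 0}"
  unfolding aff_closed_def by (intro exI[of _ "{f}"]) auto

lemma aff_closed_Int:
  assumes "aff_closed Z" "aff_closed Z'"
  shows "aff_closed (Z \<inter> Z')"
proof -
  obtain E E' where "E \<subseteq> polyfun UNIV" "E' \<subseteq> polyfun UNIV"
    "Z = {x. \<forall>f\<in>E. f x = 0}" "Z' = {x. \<forall>f\<in>E'. f x = 0}"
    using assms unfolding aff_closed_def by blast
  thus ?thesis unfolding aff_closed_def by (intro exI[of _ "E \<union> E'"]) auto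
qed

lemma aff_closed_Un:
  assumes "aff_closed Z" "aff_closed Z'"
  shows "aff_closed (Z \<union> Z')"
proof -
  obtain E E' where E: "E \<subseteq> polyfun UNIV" "E' \<subseteq> polyfun UNIV"
    and Z: "Z = {x. \<forall>f\<in>E. f x = 0}" "Z' = {x. \<forall>f\<in>E'. f x = 0}"
    using assms unfolding aff_closed_def by blast
  have "Z \<union> Z' = {x. \<forall>h\<in>{f * g | f g. f \<in> E \<and> g \<in> E'}. h x = 0}"
    unfolding Z by fastforce
  moreover have "{f * g | f g. f \<in> E \<and> g \<in> E'} \<subseteq> polyfun UNIV"
    using E by (blast intro: polyfun_mult)
  ultimately show ?thesis unfolding aff_closed_def by blast
qed

lemma aff_closed_Union: "finite F \<Longrightarrow> (\<And>Z. Z \<in> F \<Longrightarrow> aff_closed Z) \<Longrightarrow> aff_closed (\<Union>F)"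
proof (induction F rule: finite_induct)
  case empty
  show ?case unfolding aff_closed_def
    by (intro exI[of _ "{\<lambda>_. 1}"]) (auto intro: polyfun_const)
qed (auto intro: aff_closed_Un)

lemma aff_closed_coord: "aff_closed {x. x $ j = c}"
proof -
  have "(\<lambda>x. x $ j) - (\<lambda>_. c) \<in> polyfun UNIV"
    by (intro polyfun_diff polyfun_coord polyfun_const) auto
  from aff_closed_zeros[OF this] show ?thesis by simp
qed

lemma aff_closed_singleton: "aff_closed {x :: 'k::field ^ 'n}"
proof -
  have "range (\<lambda>i. (\<lambda>y. y $ i) - (\<lambda>_. x $ i)) \<subseteq> polyfun UNIV"
    by (auto intro!: polyfun_diff polyfun_coord polyfun_const simp del: minus_apply)
  moreover have "{x} = {y. \<forall>f\<in>range (\<lambda>i. (\<lambda>y. y $ i) - (\<lambda>_. x $ i)). f y = 0}"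
    by (auto simp: vec_eq_iff)
  ultimately show ?thesis unfolding aff_closed_def by blast
qed

lemma aff_irreducible_singleton: "aff_irreducible {x}"
  unfolding aff_irreducible_def by (auto simp: aff_closed_singleton)

lemma aff_irreducible_Union:
  assumes Z: "aff_irreducible Z" and "finite F" "\<And>W. W \<in> F \<Longrightarrow> aff_closed W" "Z \<subseteq> \<Union>F"
  shows "\<exists>W\<in>F. Z \<subseteq> W"
  using assms(2-4)
proof (induction F rule: finite_induct)
  case empty
  thus ?case using Z by (auto simp: aff_irreducible_def)
next
  case (insert W F)
  have "aff_closed W" "aff_closed (\<Union>F)" "Z \<subseteq> W \<union> \<Union>F"
    using insert by (auto intro: aff_closed_Union)
  hence "Z \<subseteq> W \<or> Z \<subseteq> \<Union>F" using Z unfolding aff_irreducible_def by blast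
  thus ?case using insert by blast
qed

text \<open>Along a strictly descending chain choose \<open>f i\<close> vanishing on
  \<open>Z (Suc i)\<close> but not on \<open>Z i\<close>. Some \<open>f m\<close> is a combination
  of earlier ones, all of which vanish on \<open>Z m\<close>; then so does
  \<open>f m\<close>.\<close>

lemma wf_aff_closed:
  "wf {(Z', Z). aff_closed Z' \<and> aff_closed Z \<and> Z' \<subset> (Z :: ('k::field ^ 'n::finite) set)}"
  unfolding wf_iff_no_infinite_down_chain
proof
  assume "\<exists>Z. \<forall>i. (Z (Suc i), Z i) \<in> {(Z', Z). aff_closed Z' \<and> aff_closed Z \<and> Z' \<subset> (Z :: ('k ^ 'n) set)}"
  then obtain Z :: "nat \<Rightarrow> ('k ^ 'n) set" where
    "\<forall>i. (Z (Suc i), Z i) \<in> {(Z', Z). aff_closed Z' \<and> aff_closed Z \<and> Z' \<subset> Z}" ..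
  hence Z: "aff_closed (Z i)" "Z (Suc i) \<subset> Z i" for i by simp_all
  have anti: "Z m \<subseteq> Z k" if "k \<le> m" for k m
    by (rule lift_Suc_antimono_le[OF _ that]) (rule psubset_imp_subset[OF Z(2)])
  have "\<exists>f\<in>polyfun UNIV. (\<forall>z\<in>Z (Suc i). f z = 0) \<and> (\<exists>z\<in>Z i. f z \<noteq> 0)" for i
  proof -
    obtain x where x: "x \<in> Z i" "x \<notin> Z (Suc i)" using Z(2) by blast
    show ?thesis by (rule aff_closed_separate[OF Z(1) x(2)]) (use x(1) in blast)
  qed
  then obtain f where f: "\<And>i. f i \<in> polyfun UNIV" "\<And>i z. z \<in> Z (Suc i) \<Longrightarrow> f i z = 0"
    "\<And>i. \<exists>z\<in>Z i. f i z \<noteq> 0" by metis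
  obtain m where "f m \<in> lin_combs (polyfun UNIV) f m"
    using seq_noetherian_polyfun[OF finite[of UNIV]] f(1) unfolding seq_noetherian_def by blast
  then obtain c where c: "f m = (\<Sum>k<m. c k * f k)" unfolding lin_combs_def by blast
  have "f m z = 0" if "z \<in> Z m" for z
  proof -
    have "f k z = 0" if "k < m" for k using anti[of "Suc k" m] that \<open>z \<in> Z m\<close> f(2) by fastforce
    thus ?thesis unfolding c by (simp add: sum_fun_apply)
  qed
  thus False using f(3) by blast
qed

theorem finite_irreducible_decomposition:
  fixes Z :: "('k::field ^ 'n::finite) set"
  assumes "aff_closed Z"
  obtains F where "finite F" "\<And>W. W \<in> F \<Longrightarrow> aff_irreducible W" "Z = \<Union>F"
proof -
  have "\<exists>F. finite F \<and> (\<forall>W\<in>F. aff_irreducible W) \<and> Z = \<Union>F" using assms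
  proof (induction Z rule: wf_induct_rule[OF wf_aff_closed])
    case (1 Z)
    show ?case
    proof (cases "Z = {} \<or> aff_irreducible Z")
      case True
      thus ?thesis
      proof
        assume "Z = {}"
        thus ?thesis by (intro exI[of _ "{}"]) simp
      next
        assume "aff_irreducible Z"
        thus ?thesis by (intro exI[of _ "{Z}"]) simp
      qed
    next
      case False
      then obtain Z1 Z2 where Z12: "aff_closed Z1" "aff_closed Z2" "Z \<subseteq> Z1 \<union> Z2" "\<not> Z \<subseteq> Z1" "\<not> Z \<subseteq> Z2"
        using 1(2) unfolding aff_irreducible_def by blast
      have "\<exists>F. finite F \<and> (\<forall>W\<in>F. aff_irreducible W) \<and> Z \<inter> Z1 = \<Union>F"
        by (rule 1(1)) (use 1(2) Z12 aff_closed_Int in auto)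
      then obtain F1 where F1: "finite F1 \<and> (\<forall>W\<in>F1. aff_irreducible W) \<and> Z \<inter> Z1 = \<Union>F1" ..
      have "\<exists>F. finite F \<and> (\<forall>W\<in>F. aff_irreducible W) \<and> Z \<inter> Z2 = \<Union>F"
        by (rule 1(1)) (use 1(2) Z12 aff_closed_Int in auto)
      then obtain F2 where F2: "finite F2 \<and> (\<forall>W\<in>F2. aff_irreducible W) \<and> Z \<inter> Z2 = \<Union>F2" ..
      have "Z = \<Union>(F1 \<union> F2)" using F1 F2 Z12(3) by (metis Int_Un_distrib Union_Un_distrib inf.absorb1)
      thus ?thesis using F1 F2 by (intro exI[of _ "F1 \<union> F2"]) (simp add: ball_Un)
    qed
  qed
  thus ?thesis using that by blast
qed

section \<open>Restriction to lines\<close>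

lemma polyfun_on_line:
  assumes "f \<in> polyfun M"
  shows "\<exists>P. \<forall>t. poly P t = f (\<chi> i. p $ i + t * (q $ i - p $ i))"
  using assms
proof (induction rule: polyfun.induct)
  case (polyfun_const c)
  show ?case by (intro exI[of _ "[:c:]"]) simp
next
  case (polyfun_coord i)
  show ?case by (intro exI[of _ "[:p $ i, q $ i - p $ i:]"]) simp
next
  case (polyfun_add f g)
  then obtain P Q where "\<forall>t. poly P t = f (\<chi> i. p $ i + t * (q $ i - p $ i))"
    "\<forall>t. poly Q t = g (\<chi> i. p $ i + t * (q $ i - p $ i))" by blast
  thus ?case by (intro exI[of _ "P + Q"]) simp
next
  case (polyfun_mult f g)
  then obtain P Q where "\<forall>t. poly P t = f (\<chi> i. p $ i + t * (q $ i - p $ i))"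
    "\<forall>t. poly Q t = g (\<chi> i. p $ i + t * (q $ i - p $ i))" by blast
  thus ?case by (intro exI[of _ "P * Q"]) simp
qed

lemma finite_zeros_on_line:
  fixes f :: "'k::field ^ 'n \<Rightarrow> 'k"
  assumes "f \<in> polyfun M" "f (\<chi> i. p $ i + t0 * (q $ i - p $ i)) \<noteq> 0"
  shows "finite {t. f (\<chi> i. p $ i + t * (q $ i - p $ i)) = 0}"
proof -
  obtain P where P: "\<And>t. poly P t = f (\<chi> i. p $ i + t * (q $ i - p $ i))"
    using polyfun_on_line[OF assms(1), of p q] by blast
  have "poly P t0 \<noteq> 0" using assms(2) P by simp
  hence "P \<noteq> 0" by auto
  from poly_roots_finite[OF this] show ?thesis by (simp add: P)
qed

text \<open>On the line joining a point with \<open>f \<noteq> 0\<close> to a point with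
  \<open>g \<noteq> 0\<close> each function has only finitely many zeros, while the field is
  infinite.\<close>

lemma polyfun_mult_nonzero:
  fixes f g :: "'k::field_char_0 ^ 'n \<Rightarrow> 'k"
  assumes f: "f \<in> polyfun UNIV" "f \<noteq> 0" and g: "g \<in> polyfun UNIV" "g \<noteq> 0"
  shows "f * g \<noteq> 0"
proof -
  obtain p q where p: "f p \<noteq> 0" and q: "g q \<noteq> 0" using f(2) g(2) by (auto simp: fun_eq_iff)
  have "finite {t. f (\<chi> i. p $ i + t * (q $ i - p $ i)) = 0}"
    by (rule finite_zeros_on_line[OF f(1), of _ 0]) (use p in simp)
  moreover have "finite {t. g (\<chi> i. p $ i + t * (q $ i - p $ i)) = 0}"
    by (rule finite_zeros_on_line[OF g(1), of _ 1]) (use q in simp)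
  ultimately have "finite ({t. f (\<chi> i. p $ i + t * (q $ i - p $ i)) = 0} \<union> {t. g (\<chi> i. p $ i + t * (q $ i - p $ i)) = 0})"
    by simp
  then obtain t where "f (\<chi> i. p $ i + t * (q $ i - p $ i)) \<noteq> 0" "g (\<chi> i. p $ i + t * (q $ i - p $ i)) \<noteq> 0"
    using ex_new_if_finite[OF infinite_UNIV_char_0] by blast
  hence "(f * g) (\<chi> i. p $ i + t * (q $ i - p $ i)) \<noteq> 0" by simp
  thus ?thesis by (metis zero_fun_apply)
qed

definition set_coord :: "'k ^ 'n \<Rightarrow> 'n \<Rightarrow> 'k \<Rightarrow> 'k ^ 'n" where
  "set_coord z j c = (\<chi> i. if i = j then c else z $ i)"

lemma set_coord_nth [simp]: "set_coord z j c $ i = (if i = j then c else z $ i)"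
  by (simp add: set_coord_def)

lemma set_coord_same [simp]: "set_coord z j (z $ j) = z"
  by (simp add: vec_eq_iff)

lemma polyfun_set_coord:
  "f \<in> polyfun (insert j M) \<Longrightarrow> (\<lambda>z. f (set_coord z j c)) \<in> polyfun M"
proof (induction rule: polyfun.induct)
  case (polyfun_coord i)
  thus ?case by (cases "i = j") (auto intro: polyfun.intros)
next
  case (polyfun_add f g)
  thus ?case using polyfun.polyfun_add[OF polyfun_add.IH] by (simp add: plus_fun_def)
next
  case (polyfun_mult f g)
  thus ?case using polyfun.polyfun_mult[OF polyfun_mult.IH] by (simp add: func_times)
qed (rule polyfun.polyfun_const)

lemma finite_set_coord_zeros:
  fixes h :: "'k::field ^ 'n \<Rightarrow> 'k"
  assumes h: "h \<in> polyfun M" and "h z \<noteq> 0"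
  shows "finite {c. h (set_coord z j c) = 0}"
proof -
  have *: "(\<chi> i. set_coord z j 0 $ i + t * (set_coord z j 1 $ i - set_coord z j 0 $ i)) = set_coord z j t" for t
    by (simp add: vec_eq_iff)
  show ?thesis
    using finite_zeros_on_line[OF h, of "set_coord z j 0" "z $ j" "set_coord z j 1"] assms(2)
    unfolding * by simp
qed

section \<open>Chains of irreducible closed sets\<close>

definition aff_chain :: "nat \<Rightarrow> (nat \<Rightarrow> ('k::field ^ 'n) set) \<Rightarrow> bool" where
  "aff_chain r Z \<longleftrightarrow> (\<forall>i\<le>r. aff_irreducible (Z i)) \<and> (\<forall>i<r. Z i \<subset> Z (Suc i))"

text \<open>Coordinate \<open>j\<close> is fixed at a constant \<open>c\<close> for which the slice
  still lifts generic points and contains no component of \<open>Y\<close>. The chain found in the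
  slice ends in an irreducible set, which lies in some component \<open>W\<close> of
  \<open>Y\<close>; as \<open>W\<close> is not contained in the slice, it extends the chain.\<close>

lemma chain_from_lifting:
  fixes Y :: "('k::field_char_0 ^ 'n::finite) set"
  assumes "finite J" "aff_closed Y" "h \<in> polyfun J" "h z0 \<noteq> 0"
    and "\<And>z. h z \<noteq> 0 \<Longrightarrow> \<exists>x\<in>Y. \<forall>i\<in>J. x $ i = z $ i"
  shows "\<exists>Z. aff_chain (card J) Z \<and> Z (card J) \<subseteq> Y"
  using assms
proof (induction J arbitrary: Y h z0 rule: finite_induct)
  case empty
  then obtain x where "x \<in> Y" by blast
  thus ?case by (intro exI[of _ "\<lambda>_. {x}"]) (simp add: aff_chain_def aff_irreducible_singleton)
next
  case (insert j J)
  obtain F where F: "finite F" "\<And>W. W \<in> F \<Longrightarrow> aff_irreducible W" "Y = \<Union>F"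
    using finite_irreducible_decomposition[OF insert.prems(1)] by blast
  have ne: "W \<noteq> {}" if "W \<in> F" for W using F(2)[OF that] by (simp add: aff_irreducible_def)
  \<comment> \<open>A component inside \<open>x $ j = c\<close> determines \<open>c\<close> as the
    coordinate \<open>j\<close> of any of its points, so only finitely many constants are
    excluded.\<close>
  have "finite {c. \<exists>W\<in>F. W \<subseteq> {x. x $ j = c}}"
  proof (rule finite_subset)
    show "{c. \<exists>W\<in>F. W \<subseteq> {x. x $ j = c}} \<subseteq> (\<lambda>W. (SOME x. x \<in> W) $ j) ` F"
    proof
      fix c assume "c \<in> {c. \<exists>W\<in>F. W \<subseteq> {x. x $ j = c}}"
      then obtain W where W: "W \<in> F" "W \<subseteq> {x. x $ j = c}" by blast
      have "(SOME x. x \<in> W) \<in> W" using ne[OF W(1)] by (simp add: some_in_eq)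
      thus "c \<in> (\<lambda>W. (SOME x. x \<in> W) $ j) ` F" using W by blast
    qed
  qed (use F in simp)
  with finite_set_coord_zeros[OF insert.prems(2,3), of j]
  have "finite ({c. h (set_coord z0 j c) = 0} \<union> {c. \<exists>W\<in>F. W \<subseteq> {x. x $ j = c}})" by simp
  from ex_new_if_finite[OF infinite_UNIV_char_0 this] obtain c where
    "c \<notin> {c. h (set_coord z0 j c) = 0} \<union> {c. \<exists>W\<in>F. W \<subseteq> {x. x $ j = c}}" ..
  hence c: "h (set_coord z0 j c) \<noteq> 0" "W \<in> F \<Longrightarrow> \<not> W \<subseteq> {x. x $ j = c}" for W by auto
  have "\<exists>Z. aff_chain (card J) Z \<and> Z (card J) \<subseteq> Y \<inter> {x. x $ j = c}"
  proof (rule insert.IH)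
    show "aff_closed (Y \<inter> {x. x $ j = c})" by (intro aff_closed_Int insert.prems aff_closed_coord)
    show "(\<lambda>z. h (set_coord z j c)) \<in> polyfun J" by (rule polyfun_set_coord[OF insert.prems(2)])
    show "h (set_coord z0 j c) \<noteq> 0" by fact
    fix z assume "h (set_coord z j c) \<noteq> 0"
    from insert.prems(4)[OF this] show "\<exists>x\<in>Y \<inter> {x. x $ j = c}. \<forall>i\<in>J. x $ i = z $ i"
      using insert.hyps(2) by (auto split: if_splits)
  qed
  then obtain Z where Z: "aff_chain (card J) Z" "Z (card J) \<subseteq> Y \<inter> {x. x $ j = c}" by blast
  have "\<exists>W\<in>F. Z (card J) \<subseteq> W"
    by (rule aff_irreducible_Union) (use Z F in \<open>auto simp: aff_chain_def aff_irreducible_def\<close>)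
  then obtain W where W: "W \<in> F" "Z (card J) \<subseteq> W" by blast
  have "Z (card J) \<noteq> W" using c(2)[OF W(1)] Z(2) by blast
  hence "Z (card J) \<subset> W" using W(2) by blast
  hence "aff_chain (Suc (card J)) (\<lambda>i. if i \<le> card J then Z i else W)"
    using Z(1) F(2)[OF W(1)] unfolding aff_chain_def by (simp add: less_Suc_eq)
  moreover have "W \<subseteq> Y" using W(1) F(3) by blast
  ultimately show ?case
    using insert.hyps by (intro exI[of _ "\<lambda>i. if i \<le> card J then Z i else W"]) simp
qed

section \<open>Lifting generic points\<close>

definition vanishes_on :: "('k::field ^ 'n) set \<Rightarrow> ('k ^ 'n \<Rightarrow> 'k) \<Rightarrow> bool" where
  "vanishes_on Y f \<longleftrightarrow> (\<forall>y\<in>Y. f y = 0)"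

definition coords_independent :: "('k::field ^ 'n) set \<Rightarrow> 'n set \<Rightarrow> bool" where
  "coords_independent Y J \<longleftrightarrow> (\<forall>f\<in>polyfun J. vanishes_on Y f \<longrightarrow> f = 0)"

text \<open>Primality: if \<open>f * g\<close> vanishes on \<open>Y\<close>, the zero sets of
  \<open>f\<close> and \<open>g\<close> cover \<open>Y\<close>, so one of them contains it.\<close>

lemma algebraic_extension_polyfun:
  fixes Y :: "('k::field ^ 'n) set"
  assumes "aff_irreducible Y"
  shows "algebraic_extension (polyfun M) (\<lambda>x. x $ j) {f. vanishes_on Y f}"
proof
  show "subring_of (polyfun M)" by (rule subring_of_polyfun)
  show "1 \<notin> {f. vanishes_on Y f}" using assms by (auto simp: vanishes_on_def aff_irreducible_def)
  fix f g assume "f \<in> adjoin (polyfun M) (\<lambda>x. x $ j)" "g \<in> adjoin (polyfun M) (\<lambda>x. x $ j)"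
    "f * g \<in> {f. vanishes_on Y f}"
  hence fg: "f \<in> polyfun UNIV" "g \<in> polyfun UNIV" "Y \<subseteq> {x. f x = 0} \<union> {x. g x = 0}"
    unfolding polyfun_insert[symmetric] by (auto intro: polyfun_mono simp: vanishes_on_def)
  hence "Y \<subseteq> {x. f x = 0} \<or> Y \<subseteq> {x. g x = 0}"
    using assms aff_closed_zeros unfolding aff_irreducible_def by blast
  thus "f \<in> {f. vanishes_on Y f} \<or> g \<in> {f. vanishes_on Y f}" by (auto simp: vanishes_on_def)
qed (auto simp: vanishes_on_def)

text \<open>A point \<open>z\<close> satisfying the equations of \<open>Y\<close> in the coordinates
  \<open>M\<close> is extended by \<xi>, a root of the minimal relation of coordinate
  \<open>j\<close> with its coefficients evaluated at \<open>z\<close>. Pseudo-division by this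
  relation shows that the equations of \<open>Y\<close> involving coordinate \<open>j\<close> then
  hold as well.\<close>

lemma lifting_step:
  fixes Y :: "('k::alg_closed_field ^ 'n) set"
  assumes Y: "aff_irreducible Y" and j: "j \<notin> M" and J: "J \<subseteq> M"
    and indep: "coords_independent Y J"
    and dep: "f0 \<in> polyfun (insert j J)" "f0 \<noteq> 0" "vanishes_on Y f0"
    and v: "v \<in> polyfun (insert j M)" "\<not> vanishes_on Y v"
  obtains w where "w \<in> polyfun M" "\<not> vanishes_on Y w"
    "\<And>z. w z \<noteq> 0 \<Longrightarrow> (\<forall>g\<in>polyfun M. vanishes_on Y g \<longrightarrow> g z = 0) \<Longrightarrow>
       \<exists>\<xi>. v (set_coord z j \<xi>) \<noteq> 0 \<and>
         (\<forall>g\<in>polyfun (insert j M). vanishes_on Y g \<longrightarrow> g (set_coord z j \<xi>) = 0)"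
proof -
  let ?X = "\<lambda>x :: 'k ^ 'n. x $ j"
  interpret algebraic_extension "polyfun M" ?X "{f. vanishes_on Y f}"
    by (rule algebraic_extension_polyfun[OF Y])
  \<comment> \<open>By independence of \<open>J\<close> a nonzero coefficient of \<open>f0\<close>
    does not vanish on \<open>Y\<close>, so \<open>f0\<close> stays nontrivial modulo the ideal of
    \<open>Y\<close>.\<close>
  have "\<exists>m a f. relation m a f"
  proof -
    obtain d where "f0 \<in> bounded_polys (polyfun J) ?X d"
      using dep(1) unfolding polyfun_insert adjoin_def by blast
    then obtain c where c: "\<And>k. c k \<in> polyfun J" "f0 = (\<Sum>k<d. c k * ?X ^ k)"
      by (rule bounded_polysE) blast
    have cM: "c k \<in> polyfun M" for k by (rule polyfun_mono[OF c(1) J])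
    have "\<exists>k<d. c k \<noteq> 0"
    proof (rule ccontr)
      assume "\<not> ?thesis"
      hence "f0 = 0" unfolding c(2) by (intro sum.neutral) auto
      thus False using dep(2) by contradiction
    qed
    then obtain k where k: "k < d" "c k \<noteq> 0" by blast
    hence "c k \<notin> {f. vanishes_on Y f}" using indep c(1) unfolding coords_independent_def by blast
    from drop_leading_terms[OF _ c(2) cM k(1) this] obtain m where m:
      "c m \<notin> {f. vanishes_on Y f}" "(\<Sum>k<m. c k * ?X ^ k) \<in> poly_lt m"
      "f0 - ((\<Sum>k<m. c k * ?X ^ k) + c m * ?X ^ m) \<in> {f. vanishes_on Y f}"
      using bounded_polysI[of c "polyfun M" ?X d, OF cM] c(2) by blast
    have "(\<Sum>k<m. c k * ?X ^ k) + c m * ?X ^ m \<in> {f. vanishes_on Y f}"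
      using p_diff_iff[OF m(3)] dep(3) by blast
    hence "relation m (c m) ((\<Sum>k<m. c k * ?X ^ k) + c m * ?X ^ m)"
      unfolding relation_def using cM m(1,2) by (simp only: add_diff_cancel_right') simp
    thus ?thesis by blast
  qed
  then obtain m where "\<exists>a f. relation m a f" and min: "\<forall>m' a' f'. relation m' a' f' \<longrightarrow> m \<le> m'"
    using exists_least_iff[of "\<lambda>m. \<exists>a f. relation m a f"] by (metis not_le)
  then obtain a f where rel: "relation m a f" by blast
  hence a: "a \<in> polyfun M" "\<not> vanishes_on Y a" and f: "vanishes_on Y f" and f_lt: "f - a * ?X ^ m \<in> poly_lt m"
    by (auto simp: relation_def)
  obtain c where c: "\<And>k. c k \<in> polyfun M" "f - a * ?X ^ m = (\<Sum>k<m. c k * ?X ^ k)"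
    using f_lt by (rule bounded_polysE) blast
  have feq: "f = (\<Sum>k<m. c k * ?X ^ k) + a * ?X ^ m"
    using c(2) by (simp only: diff_eq_eq)
  have "m > 0"
  proof (rule gr0I)
    assume "m = 0"
    hence "f = a" using feq by simp
    thus False using f a by simp
  qed
  obtain u b where ub: "u \<in> polyfun (insert j M)" "b \<in> polyfun M" "\<not> vanishes_on Y b" "vanishes_on Y (u * v - b)"
    using multiple_in_base[OF rel min, of v] v unfolding polyfun_insert[symmetric] by blast
  have fB: "f \<in> polyfun (insert j M)"
  proof -
    have "f - a * ?X ^ m \<in> polyfun (insert j M)"
      unfolding polyfun_insert by (rule lt_in_adjoin[OF f_lt])
    moreover have "a * ?X ^ m \<in> polyfun (insert j M)"
      by (intro polyfun_mult polyfun_mono[OF a(1)] subring_ofD(7)[OF subring_of_polyfun] polyfun_coord) auto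
    ultimately have "(f - a * ?X ^ m) + a * ?X ^ m \<in> polyfun (insert j M)" by (rule polyfun_add)
    thus ?thesis by (simp only: diff_add_cancel)
  qed
  show ?thesis
  \<comment> \<open>\<open>a z \<noteq> 0\<close> keeps the degree of the minimal relation and lets
    powers of \<open>a\<close> be cancelled; \<open>b z \<noteq> 0\<close> keeps \<open>v\<close>,
    which divides \<open>b\<close> modulo the ideal, from vanishing.\<close>
  proof (rule that[of "a * b"])
    show "a * b \<in> polyfun M" by (intro polyfun_mult a ub)
    show "\<not> vanishes_on Y (a * b)"
      using p_prime[of a b] a ub(2,3) subset_adjoin[OF A] by blast
    fix z assume w: "(a * b) z \<noteq> 0" and z: "\<forall>g\<in>polyfun M. vanishes_on Y g \<longrightarrow> g z = 0"
    have az: "a z \<noteq> 0" and bz: "b z \<noteq> 0" using w by auto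
    have "\<exists>\<xi>. (\<Sum>k\<le>m. (if k = m then a z else c k z) * \<xi> ^ k) = 0"
      using \<open>m > 0\<close> az by (intro alg_closed) auto
    then obtain \<xi> where \<xi>: "(\<Sum>k<m. c k z * \<xi> ^ k) + a z * \<xi> ^ m = 0"
      by (auto simp: lessThan_Suc_atMost[symmetric])
    define x where "x = set_coord z j \<xi>"
    have base: "g x = g z" if "g \<in> polyfun M" for g
      using that by (rule polyfun_cong) (use j in \<open>auto simp: x_def\<close>)
    have fx: "f x = 0"
      using \<xi> unfolding feq by (simp add: sum_fun_apply power_fun_apply base[OF c(1)] base[OF a(1)]) (simp add: x_def)
    have zero: "g x = 0" if g: "g \<in> polyfun (insert j M)" "vanishes_on Y g" for g
    proof -
      obtain d where d: "g \<in> poly_lt d" using g(1) unfolding polyfun_insert adjoin_def by blast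
      have "f = (f - a * ?X ^ m) + a * ?X ^ m" by (simp only: diff_add_cancel)
      from pseudo_division[OF A a(1) f_lt this d] obtain N q r where
        r: "r \<in> poly_lt m" and eq: "a ^ N * g = q * f + r" by blast
      have "r = g * a ^ N - f * q" using eq by (simp add: mult.commute)
      hence rp: "r \<in> {f. vanishes_on Y f}" using p_diff[OF p_mult p_mult, of g f] g(2) f by (simp only: mem_Collect_eq)
      obtain e where e: "\<And>k. e k \<in> polyfun M" "r = (\<Sum>k<m. e k * ?X ^ k)"
        using r by (rule bounded_polysE) blast
      \<comment> \<open>A remainder in the ideal of degree below \<open>m\<close> has all its
        coefficients in the ideal, so they vanish at \<open>z\<close>.\<close>
      have "e k \<in> {f. vanishes_on Y f}" if "k < m" for k
        by (rule coeffs_in_p[OF rel min e(1) _ order_refl that])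
           (use rp in \<open>simp only: e(2)\<close>)
      hence "e k x = 0" if "k < m" for k using that z e(1) base[OF e(1)] by simp
      hence "r x = 0" unfolding e(2) by (simp add: sum_fun_apply)
      hence "(a ^ N * g) x = 0" unfolding eq using fx by simp
      thus "g x = 0" using az by (simp add: power_fun_apply base[OF a(1)])
    qed
    have "u * v - b \<in> polyfun (insert j M)"
      by (intro polyfun_diff polyfun_mult ub v polyfun_mono[OF ub(2)]) auto
    hence "(u * v - b) x = 0" using zero ub(4) by blast
    hence "u x * v x = b z" using base[OF ub(2)] by simp
    hence "v x \<noteq> 0" using bz by auto
    thus "\<exists>\<xi>. v (set_coord z j \<xi>) \<noteq> 0 \<and>
         (\<forall>g\<in>polyfun (insert j M). vanishes_on Y g \<longrightarrow> g (set_coord z j \<xi>) = 0)"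
      using zero unfolding x_def by blast
  qed
qed

text \<open>The coordinates outside \<open>J\<close> are supplied one at a time by
  \<open>lifting_step\<close>. Each step trades the condition \<open>v x \<noteq> 0\<close> on the
  point sought for a condition \<open>w\<close> on one coordinate less, until only a condition
  \<open>h\<close> on the coordinates \<open>J\<close> remains.\<close>

lemma generic_lifting:
  fixes Y :: "('k::alg_closed_field ^ 'n::finite) set"
  assumes Y: "aff_irreducible Y" and indep: "coords_independent Y J"
    and dep: "\<And>j. j \<notin> J \<Longrightarrow> \<not> coords_independent Y (insert j J)"
  shows "\<exists>h\<in>polyfun J. h \<noteq> 0 \<and> (\<forall>z. h z \<noteq> 0 \<longrightarrow> (\<exists>x\<in>Y. \<forall>i\<in>J. x $ i = z $ i))"
proof -
  have "\<exists>h\<in>polyfun J. h \<noteq> 0 \<and> (\<forall>z. h z \<noteq> 0 \<longrightarrow> (\<exists>x. (\<forall>i\<in>J. x $ i = z $ i) \<and> v x \<noteq> 0 \<and>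
      (\<forall>g\<in>polyfun (J \<union> L). vanishes_on Y g \<longrightarrow> g x = 0)))"
    if "finite L" "L \<inter> J = {}" "v \<in> polyfun (J \<union> L)" "\<not> vanishes_on Y v" for L v
    using that
  proof (induction L arbitrary: v rule: finite_induct)
    case empty
    have "v \<noteq> 0" using empty.prems(3) by (auto simp: vanishes_on_def)
    moreover have "\<forall>g\<in>polyfun J. vanishes_on Y g \<longrightarrow> g z = 0" for z
      using indep by (auto simp: coords_independent_def)
    ultimately show ?case using empty.prems by (intro bexI[of _ v] conjI allI impI exI) auto
  next
    case (insert j L)
    have j: "j \<notin> J" "j \<notin> J \<union> L" using insert by auto
    obtain f0 where "f0 \<in> polyfun (insert j J)" "f0 \<noteq> 0" "vanishes_on Y f0"
      using dep[OF j(1)] unfolding coords_independent_def by blast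
    moreover have "v \<in> polyfun (insert j (J \<union> L))" using insert.prems by simp
    ultimately obtain w where w: "w \<in> polyfun (J \<union> L)" "\<not> vanishes_on Y w"
      "\<And>z. w z \<noteq> 0 \<Longrightarrow> (\<forall>g\<in>polyfun (J \<union> L). vanishes_on Y g \<longrightarrow> g z = 0) \<Longrightarrow>
       \<exists>\<xi>. v (set_coord z j \<xi>) \<noteq> 0 \<and>
         (\<forall>g\<in>polyfun (insert j (J \<union> L)). vanishes_on Y g \<longrightarrow> g (set_coord z j \<xi>) = 0)"
      using lifting_step[OF Y j(2) Un_upper1 indep _ _ _ _ insert.prems(3)] by blast
    have "L \<inter> J = {}" using insert.prems by blast
    from insert.IH[OF this w(1,2)] obtain h where h: "h \<in> polyfun J" "h \<noteq> 0"
      "\<And>z. h z \<noteq> 0 \<Longrightarrow> \<exists>x. (\<forall>i\<in>J. x $ i = z $ i) \<and> w x \<noteq> 0 \<and> (\<forall>g\<in>polyfun (J \<union> L). vanishes_on Y g \<longrightarrow> g x = 0)"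
      by blast
    have "\<exists>x. (\<forall>i\<in>J. x $ i = z $ i) \<and> v x \<noteq> 0 \<and> (\<forall>g\<in>polyfun (J \<union> insert j L). vanishes_on Y g \<longrightarrow> g x = 0)"
      if hz: "h z \<noteq> 0" for z
    proof -
      obtain x where x: "\<forall>i\<in>J. x $ i = z $ i" "w x \<noteq> 0" "\<forall>g\<in>polyfun (J \<union> L). vanishes_on Y g \<longrightarrow> g x = 0"
        using h(3)[OF hz] by blast
      obtain \<xi> where "v (set_coord x j \<xi>) \<noteq> 0"
        "\<forall>g\<in>polyfun (insert j (J \<union> L)). vanishes_on Y g \<longrightarrow> g (set_coord x j \<xi>) = 0"
        using w(3)[OF x(2,3)] by blast
      moreover have "\<forall>i\<in>J. set_coord x j \<xi> $ i = z $ i" using x(1) j(1) by auto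
      ultimately show ?thesis unfolding Un_insert_right by (intro exI[of _ "set_coord x j \<xi>"] conjI)
    qed
    thus ?case using h(1,2) by blast
  qed
  \<comment> \<open>With all coordinates present and the trivial condition 1, the point found
    satisfies every equation of \<open>Y\<close>.\<close>
  from this[of "- J" "\<lambda>_. 1"] obtain h where h: "h \<in> polyfun J" "h \<noteq> 0"
    "\<And>z. h z \<noteq> 0 \<Longrightarrow> \<exists>x. (\<forall>i\<in>J. x $ i = z $ i) \<and> (\<forall>g\<in>polyfun UNIV. vanishes_on Y g \<longrightarrow> g x = 0)"
    using Y by (auto simp: polyfun_const vanishes_on_def aff_irreducible_def)
  have "\<exists>x\<in>Y. \<forall>i\<in>J. x $ i = z $ i" if hz: "h z \<noteq> 0" for z
  proof -
    obtain x where x: "\<forall>i\<in>J. x $ i = z $ i" "\<forall>g\<in>polyfun UNIV. vanishes_on Y g \<longrightarrow> g x = 0"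
      using h(3)[OF hz] by blast
    have "x \<in> Y"
    proof (rule ccontr)
      assume "x \<notin> Y"
      moreover have "aff_closed Y" using Y by (simp add: aff_irreducible_def)
      ultimately obtain f where "f \<in> polyfun UNIV" "\<And>y. y \<in> Y \<Longrightarrow> f y = 0" "f x \<noteq> 0"
        using aff_closed_separate by metis
      thus False using x(2) by (auto simp: vanishes_on_def)
    qed
    thus ?thesis using x(1) by blast
  qed
  thus ?thesis using h(1,2) by blast
qed

text \<open>If \<open>I\<close> were dependent on every component, the product of the relations
  would be a nonzero relation on \<open>Y\<close>. On a good component \<open>I\<close> is enlarged
  to an independent set \<open>J\<close> of greatest size, as generic lifting requires, and the
  chain of length \<open>card J\<close> is truncated.\<close>

theorem independent_coords_chain:
  fixes Y :: "('k::{alg_closed_field, field_char_0} ^ 'n::finite) set"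
  assumes Y: "aff_closed Y" and indep: "coords_independent Y I"
  shows "\<exists>Z. aff_chain (card I) Z \<and> Z (card I) \<subseteq> Y"
proof -
  obtain F where F: "finite F" "\<And>W. W \<in> F \<Longrightarrow> aff_irreducible W" "Y = \<Union>F"
    using finite_irreducible_decomposition[OF Y] by blast
  have "\<exists>W\<in>F. coords_independent W I"
  proof (rule ccontr)
    assume "\<not> ?thesis"
    then obtain f where f: "\<And>W. W \<in> F \<Longrightarrow> f W \<in> polyfun I \<and> vanishes_on W (f W) \<and> f W \<noteq> 0"
      unfolding coords_independent_def by metis
    have "\<exists>g\<in>polyfun I. g \<noteq> 0 \<and> vanishes_on (\<Union>G) g" if "G \<subseteq> F" for G
      using finite_subset[OF that F(1)] that
    proof (induction G rule: finite_induct)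
      case empty
      show ?case by (intro bexI[of _ "\<lambda>_. 1"]) (auto simp: vanishes_on_def polyfun_const fun_eq_iff)
    next
      case (insert W G)
      hence "G \<subseteq> F" by simp
      from insert.IH[OF this] obtain g where g: "g \<in> polyfun I" "g \<noteq> 0" "vanishes_on (\<Union>G) g"
        by (elim bexE conjE)
      have W: "f W \<in> polyfun I" "vanishes_on W (f W)" "f W \<noteq> 0" using f insert by auto
      have "f W * g \<noteq> 0"
        by (rule polyfun_mult_nonzero) (use W g in \<open>auto intro: polyfun_mono\<close>)
      moreover have "vanishes_on (\<Union>(insert W G)) (f W * g)"
        using W(2) g(3) by (auto simp: vanishes_on_def)
      ultimately show ?case using polyfun_mult[OF W(1) g(1)] by blast
    qed
    from this[OF order_refl] indep F(3) show False unfolding coords_independent_def by blast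
  qed
  then obtain W where W: "W \<in> F" "coords_independent W I" by blast
  have "\<exists>J. (I \<subseteq> J \<and> coords_independent W J) \<and> (\<forall>J'. I \<subseteq> J' \<and> coords_independent W J' \<longrightarrow> card J' \<le> card J)"
    by (rule ex_has_greatest_nat[of _ I _ "CARD('n) + 1"]) (use W in \<open>auto simp: less_Suc_eq_le intro!: card_mono\<close>)
  then obtain J where J: "I \<subseteq> J" "coords_independent W J"
    and max: "\<And>J'. I \<subseteq> J' \<Longrightarrow> coords_independent W J' \<Longrightarrow> card J' \<le> card J" by blast
  have "\<not> coords_independent W (insert j J)" if "j \<notin> J" for j
    using max[of "insert j J"] J(1) that by auto
  from generic_lifting[OF F(2)[OF W(1)] J(2) this] obtain h where
    h: "h \<in> polyfun J" "h \<noteq> 0" "\<And>z. h z \<noteq> 0 \<Longrightarrow> \<exists>x\<in>W. \<forall>i\<in>J. x $ i = z $ i" by blast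
  obtain z0 where "h z0 \<noteq> 0" using h(2) by (auto simp: fun_eq_iff)
  moreover have "aff_closed W" using F(2)[OF W(1)] by (simp add: aff_irreducible_def)
  ultimately obtain Z where Z: "aff_chain (card J) Z" "Z (card J) \<subseteq> W"
    using chain_from_lifting[OF finite _ h(1) _ h(3)] by metis
  have le: "card I \<le> card J" using J(1) by (simp add: card_mono)
  have "Z i \<subseteq> Z k" if "i \<le> k" "k \<le> card J" for i k
    using that
  proof (induction k rule: dec_induct)
    case (step k)
    hence "Z i \<subseteq> Z k" "Z k \<subset> Z (Suc k)" using Z(1) by (simp_all add: aff_chain_def)
    thus ?case by blast
  qed simp
  hence "Z (card I) \<subseteq> Y" using le Z(2) W(1) F(3) by (meson Sup_upper order_refl subset_trans)
  thus ?thesis using Z(1) le by (intro exI[of _ Z]) (auto simp: aff_chain_def)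
qed

section \<open>Projective varieties\<close>

definition monom_eval :: "('n \<Rightarrow>\<^sub>0 nat) \<Rightarrow> 'k::field ^ 'n::finite \<Rightarrow> 'k" where
  "monom_eval m x = (\<Prod>i\<in>UNIV. x $ i ^ Poly_Mapping.lookup m i)"

definition monom_degree :: "('n::finite \<Rightarrow>\<^sub>0 nat) \<Rightarrow> nat" where
  "monom_degree m = (\<Sum>i\<in>UNIV. Poly_Mapping.lookup m i)"

lemma monom_eval_add: "monom_eval (m + m') x = monom_eval m x * monom_eval m' x"
  by (simp add: monom_eval_def lookup_add power_add prod.distrib)

lemma monom_degree_add: "monom_degree (m + m') = monom_degree m + monom_degree m'"
  by (simp add: monom_degree_def lookup_add sum.distrib)

lemma mpoly_eval_superset:
  assumes "finite S" "Poly_Mapping.keys f \<subseteq> S"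
  shows "mpoly_eval f x = (\<Sum>m\<in>S. Poly_Mapping.lookup f m * monom_eval m x)"
  unfolding mpoly_eval_def monom_eval_def[symmetric]
  by (rule sum.mono_neutral_left) (use assms in \<open>auto simp: in_keys_iff\<close>)

lemma mpoly_eval_add: "mpoly_eval (f + g) x = mpoly_eval f x + mpoly_eval g x"
proof -
  let ?S = "Poly_Mapping.keys f \<union> Poly_Mapping.keys g"
  have "mpoly_eval (f + g) x = (\<Sum>m\<in>?S. Poly_Mapping.lookup (f + g) m * monom_eval m x)"
    by (rule mpoly_eval_superset) (auto simp: keys_add)
  also have "\<dots> = mpoly_eval f x + mpoly_eval g x"
    by (subst (1 2) mpoly_eval_superset[of ?S]) (auto simp: lookup_add sum.distrib distrib_right)
  finally show ?thesis .
qed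

lemma mpoly_eval_single: "mpoly_eval (Poly_Mapping.single m c) x = c * monom_eval m x"
  by (subst mpoly_eval_superset[of "{m}"]) auto

lemma mpoly_eval_0: "mpoly_eval 0 x = 0"
  by (simp add: mpoly_eval_def)

lemma mpoly_eval_sum: "mpoly_eval (\<Sum>k\<in>K. f k) x = (\<Sum>k\<in>K. mpoly_eval (f k) x)"
  by (induction K rule: infinite_finite_induct) (auto simp: mpoly_eval_add mpoly_eval_0)

lemma sum_singles: "(\<Sum>m\<in>Poly_Mapping.keys f. Poly_Mapping.single m (Poly_Mapping.lookup f m)) = f"
proof (rule poly_mapping_eqI)
  fix k
  have "Poly_Mapping.lookup (\<Sum>m\<in>Poly_Mapping.keys f. Poly_Mapping.single m (Poly_Mapping.lookup f m)) k =
    (\<Sum>m\<in>Poly_Mapping.keys f. if m = k then Poly_Mapping.lookup f k else 0)"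
    unfolding lookup_sum by (rule sum.cong) (auto simp: lookup_single when_def)
  thus "Poly_Mapping.lookup (\<Sum>m\<in>Poly_Mapping.keys f. Poly_Mapping.single m (Poly_Mapping.lookup f m)) k =
    Poly_Mapping.lookup f k" by (simp add: in_keys_iff)
qed

lemma mpoly_eval_mult: "mpoly_eval (f * g) x = mpoly_eval f x * mpoly_eval g x"
proof -
  let ?s = Poly_Mapping.single and ?l = Poly_Mapping.lookup and ?k = Poly_Mapping.keys
  have "f * g = (\<Sum>m\<in>?k f. ?s m (?l f m)) * (\<Sum>n\<in>?k g. ?s n (?l g n))"
    by (simp add: sum_singles)
  also have "\<dots> = (\<Sum>m\<in>?k f. \<Sum>n\<in>?k g. ?s (m + n) (?l f m * ?l g n))"
    by (simp add: sum_product mult_single)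
  finally have "mpoly_eval (f * g) x = (\<Sum>m\<in>?k f. \<Sum>n\<in>?k g. (?l f m * monom_eval m x) * (?l g n * monom_eval n x))"
    by (simp add: mpoly_eval_sum mpoly_eval_single monom_eval_add mult_ac)
  also have "\<dots> = mpoly_eval f x * mpoly_eval g x"
    by (simp add: mpoly_eval_def monom_eval_def sum_product)
  finally show ?thesis .
qed

definition homogeneous_of :: "nat \<Rightarrow> ('k::field, 'n::finite) mpolynomial \<Rightarrow> bool" where
  "homogeneous_of d f \<longleftrightarrow> (\<forall>m\<in>Poly_Mapping.keys f. monom_degree m = d)"

lemma homogeneous_altdef: "homogeneous f \<longleftrightarrow> (\<exists>d. homogeneous_of d f)"
  unfolding homogeneous_def homogeneous_of_def monom_degree_def ..

lemma homogeneous_of_add: "homogeneous_of d f \<Longrightarrow> homogeneous_of d g \<Longrightarrow> homogeneous_of d (f + g)"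
  unfolding homogeneous_of_def using keys_add[of f g] by blast

lemma homogeneous_of_mult:
  "homogeneous_of d f \<Longrightarrow> homogeneous_of e g \<Longrightarrow> homogeneous_of (d + e) (f * g)"
  unfolding homogeneous_of_def using keys_mult[of f g] by (fastforce simp: monom_degree_add)

lemma monom_degree_single: "monom_degree (Poly_Mapping.single i k) = k"
  by (simp add: monom_degree_def lookup_single when_def)

lemma monom_eval_single: "monom_eval (Poly_Mapping.single i k) x = x $ i ^ k"
proof -
  have "monom_eval (Poly_Mapping.single i k) x = (\<Prod>j\<in>UNIV. if i = j then x $ j ^ k else 1)"
    unfolding monom_eval_def by (rule prod.cong) (auto simp: lookup_single when_def)
  thus ?thesis by simp
qed

lemma monom_eval_0: "monom_eval 0 x = 1"
  by (simp add: monom_eval_def)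

lemma homogeneous_of_single: "monom_degree m = d \<Longrightarrow> homogeneous_of d (Poly_Mapping.single m c)"
  by (simp add: homogeneous_of_def)

text \<open>The form is built along the construction of \<open>f\<close>; in a sum the two degrees
  are matched by powers of the coordinate \<open>i0\<close>, which equals 1 on the chart.\<close>

lemma homogenize:
  fixes f :: "'k::field ^ 'n::finite \<Rightarrow> 'k"
  assumes "f \<in> polyfun UNIV"
  shows "\<exists>d F. homogeneous_of d F \<and> (\<forall>x. x $ i0 = 1 \<longrightarrow> mpoly_eval F x = f x)"
  using assms
proof (induction rule: polyfun.induct)
  case (polyfun_const c)
  show ?case
    by (intro exI[of _ 0] exI[of _ "Poly_Mapping.single 0 c"])
       (auto simp: homogeneous_of_def monom_degree_def mpoly_eval_single monom_eval_0)
next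
  case (polyfun_coord i)
  show ?case
    by (intro exI[of _ 1] exI[of _ "Poly_Mapping.single (Poly_Mapping.single i 1) 1"])
       (auto simp: homogeneous_of_def monom_degree_single mpoly_eval_single monom_eval_single)
next
  case (polyfun_mult f g)
  then obtain d F e G where "homogeneous_of d F" "\<forall>x. x $ i0 = 1 \<longrightarrow> mpoly_eval F x = f x"
    "homogeneous_of e G" "\<forall>x. x $ i0 = 1 \<longrightarrow> mpoly_eval G x = g x" by (elim exE conjE)
  thus ?case
    by (intro exI[of _ "d + e"] exI[of _ "F * G"]) (simp add: homogeneous_of_mult mpoly_eval_mult)
next
  case (polyfun_add f g)
  then obtain d F e G where F: "homogeneous_of d F" "\<forall>x. x $ i0 = 1 \<longrightarrow> mpoly_eval F x = f x"
    and G: "homogeneous_of e G" "\<forall>x. x $ i0 = 1 \<longrightarrow> mpoly_eval G x = g x" by (elim exE conjE)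
  define X :: "nat \<Rightarrow> ('k, 'n) mpolynomial" where
    "X = (\<lambda>k. Poly_Mapping.single (Poly_Mapping.single i0 k) 1)"
  have X: "homogeneous_of k (X k)" "x $ i0 = 1 \<Longrightarrow> mpoly_eval (X k) x = 1" for k x
    by (auto simp: X_def mpoly_eval_single monom_eval_single homogeneous_of_single monom_degree_single)
  have "homogeneous_of (d + e) (F * X e + G * X d)"
    using homogeneous_of_mult[OF F(1) X(1)[of e]] homogeneous_of_mult[OF G(1) X(1)[of d]]
    by (intro homogeneous_of_add) (simp_all add: add.commute)
  thus ?case using F G X
    by (intro exI[of _ "d + e"] exI[of _ "F * X e + G * X d"]) (simp add: mpoly_eval_add mpoly_eval_mult)
qed

lemma mpoly_eval_in_polyfun: "mpoly_eval F \<in> polyfun UNIV"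
proof -
  have pow: "(\<lambda>x. x $ i ^ k) \<in> polyfun UNIV" for i k
  proof -
    have "(\<lambda>x. x $ i) ^ k \<in> polyfun UNIV" by (intro subring_ofD(7)[OF subring_of_polyfun] polyfun_coord) simp
    also have "(\<lambda>x. x $ i) ^ k = (\<lambda>x. x $ i ^ k)" by (rule ext) (rule power_fun_apply)
    finally show ?thesis .
  qed
  have prod: "(\<lambda>x. \<Prod>i\<in>K. x $ i ^ Poly_Mapping.lookup m i) \<in> polyfun UNIV" for K m
  proof (induction K rule: infinite_finite_induct)
    case (insert i K)
    thus ?case using polyfun_mult[OF pow insert.IH] by (simp add: func_times)
  qed (auto intro: polyfun_const)
  have "(\<lambda>x. \<Sum>m\<in>K. Poly_Mapping.lookup F m * (\<Prod>i\<in>UNIV. x $ i ^ Poly_Mapping.lookup m i)) \<in> polyfun UNIV" for K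
  proof (induction K rule: infinite_finite_induct)
    case (insert m K)
    have "(\<lambda>x. Poly_Mapping.lookup F m * (\<Prod>i\<in>UNIV. x $ i ^ Poly_Mapping.lookup m i)) \<in> polyfun UNIV"
      using polyfun_mult[OF polyfun_const prod] by (simp add: func_times)
    from polyfun_add[OF this insert.IH] show ?case using insert.hyps by (simp add: plus_fun_def)
  qed (auto intro: polyfun_const)
  thus ?thesis unfolding mpoly_eval_def[abs_def] .
qed

text \<open>The condition on the keys makes every exponent outside \<open>M\<close> zero, so that a
  monomial can later be recovered from its exponents in \<open>M\<close>.\<close>

lemma polyfun_as_mpoly_eval:
  fixes f :: "'k::field ^ 'n::finite \<Rightarrow> 'k"
  assumes "f \<in> polyfun M"
  shows "\<exists>F. (\<forall>m\<in>Poly_Mapping.keys F. Poly_Mapping.keys m \<subseteq> M) \<and> f = mpoly_eval F"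
  using assms
proof (induction rule: polyfun.induct)
  case (polyfun_const c)
  show ?case by (intro exI[of _ "Poly_Mapping.single 0 c"]) (auto simp: mpoly_eval_single monom_eval_0)
next
  case (polyfun_coord i)
  thus ?case
    by (intro exI[of _ "Poly_Mapping.single (Poly_Mapping.single i 1) 1"])
       (auto simp: mpoly_eval_single monom_eval_single)
next
  case (polyfun_add f g)
  then obtain F G where "\<forall>m\<in>Poly_Mapping.keys F. Poly_Mapping.keys m \<subseteq> M" "f = mpoly_eval F"
    "\<forall>m\<in>Poly_Mapping.keys G. Poly_Mapping.keys m \<subseteq> M" "g = mpoly_eval G" by (elim exE conjE)
  moreover from this have "\<forall>m\<in>Poly_Mapping.keys (F + G). Poly_Mapping.keys m \<subseteq> M" using keys_add[of F G] by blast
  ultimately show ?case by (intro exI[of _ "F + G"]) (auto simp: mpoly_eval_add fun_eq_iff)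
next
  case (polyfun_mult f g)
  then obtain F G where F: "\<forall>m\<in>Poly_Mapping.keys F. Poly_Mapping.keys m \<subseteq> M" "f = mpoly_eval F"
    and G: "\<forall>m\<in>Poly_Mapping.keys G. Poly_Mapping.keys m \<subseteq> M" "g = mpoly_eval G" by (elim exE conjE)
  have "Poly_Mapping.keys m \<subseteq> M" if m: "m \<in> Poly_Mapping.keys (F * G)" for m
  proof -
    obtain a b where "a \<in> Poly_Mapping.keys F" "b \<in> Poly_Mapping.keys G" "m = a + b"
      using keys_mult[of F G] m by blast
    thus ?thesis using F(1) G(1) keys_add[of a b] by blast
  qed
  thus ?case by (intro exI[of _ "F * G"]) (auto simp: F(2) G(2) mpoly_eval_mult fun_eq_iff)
qed

section \<open>Closed sets of projective space and their affine parts\<close>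

lemma mpoly_eval_scale:
  assumes "homogeneous_of d F"
  shows "mpoly_eval F (l *s x) = l ^ d * mpoly_eval F x"
proof -
  have "(\<Prod>i\<in>UNIV. (l *s x) $ i ^ Poly_Mapping.lookup m i) = l ^ d * (\<Prod>i\<in>UNIV. x $ i ^ Poly_Mapping.lookup m i)"
    if "m \<in> Poly_Mapping.keys F" for m
    using assms that by (simp add: power_mult_distrib prod.distrib power_sum[symmetric] homogeneous_of_def monom_degree_def)
  thus ?thesis unfolding mpoly_eval_def by (simp add: sum_distrib_left mult_ac cong: sum.cong)
qed

lemma proj_point_eq_iff:
  "proj_point x = proj_point y \<longleftrightarrow> (\<exists>l. l \<noteq> 0 \<and> x = l *s y)"
proof
  assume "proj_point x = proj_point y"
  moreover have "x \<in> proj_point x" unfolding proj_point_def by (rule CollectI, rule exI[of _ 1]) simp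
  ultimately show "\<exists>l. l \<noteq> 0 \<and> x = l *s y" unfolding proj_point_def by auto
next
  assume "\<exists>l. l \<noteq> 0 \<and> x = l *s y"
  then obtain l where l: "l \<noteq> 0" "x = l *s y" by blast
  show "proj_point x = proj_point y"
    unfolding proj_point_def l(2)
  proof (intro equalityI subsetI; clarify)
    fix k :: 'a assume "k \<noteq> 0"
    thus "\<exists>k'. k *s (l *s y) = k' *s y \<and> k' \<noteq> 0" using l(1) by (intro exI[of _ "k * l"]) (simp add: vector_smult_assoc)
    show "\<exists>k'. k *s y = k' *s (l *s y) \<and> k' \<noteq> 0"
      using l(1) \<open>k \<noteq> 0\<close> by (intro exI[of _ "k / l"]) (simp add: vector_smult_assoc)
  qed
qed

lemma in_projective_zeros_iff:
  assumes "\<forall>f\<in>E. homogeneous f" "x \<noteq> 0"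
  shows "proj_point x \<in> {proj_point x | x. x \<noteq> 0 \<and> (\<forall>f\<in>E. mpoly_eval f x = 0)} \<longleftrightarrow> (\<forall>f\<in>E. mpoly_eval f x = 0)"
proof
  assume "proj_point x \<in> {proj_point x | x. x \<noteq> 0 \<and> (\<forall>f\<in>E. mpoly_eval f x = 0)}"
  then obtain y where y: "proj_point x = proj_point y" "\<forall>f\<in>E. mpoly_eval f y = 0" by blast
  then obtain l where "x = l *s y" unfolding proj_point_eq_iff by blast
  thus "\<forall>f\<in>E. mpoly_eval f x = 0"
    using y(2) assms(1) by (auto simp: homogeneous_altdef dest!: mpoly_eval_scale)
      (metis mpoly_eval_scale homogeneous_altdef mult_zero_right)
qed (use assms(2) in blast)

lemma zariski_closed_Inter:
  assumes "\<And>Z. Z \<in> \<F> \<Longrightarrow> zariski_closed Z" "\<F> \<noteq> {}"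
  shows "zariski_closed (\<Inter>\<F>)"
proof -
  have "\<forall>Z\<in>\<F>. \<exists>E. (\<forall>f\<in>E. homogeneous f) \<and> Z = {proj_point x | x. x \<noteq> 0 \<and> (\<forall>f\<in>E. mpoly_eval f x = 0)}"
  proof
    fix Z assume "Z \<in> \<F>"
    from assms(1)[OF this] show "\<exists>E. (\<forall>f\<in>E. homogeneous f) \<and> Z = {proj_point x | x. x \<noteq> 0 \<and> (\<forall>f\<in>E. mpoly_eval f x = 0)}"
      unfolding zariski_closed_def .
  qed
  from bchoice[OF this] obtain E where
    E: "\<forall>Z\<in>\<F>. (\<forall>f\<in>E Z. homogeneous f) \<and> Z = {proj_point x | x. x \<noteq> 0 \<and> (\<forall>f\<in>E Z. mpoly_eval f x = 0)}" ..
  have mem: "proj_point x \<in> Z \<longleftrightarrow> (\<forall>f\<in>E Z. mpoly_eval f x = 0)" if "Z \<in> \<F>" "x \<noteq> 0" for x Z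
  proof -
    from E that(1) have EZ: "(\<forall>f\<in>E Z. homogeneous f) \<and> Z = {proj_point x | x. x \<noteq> 0 \<and> (\<forall>f\<in>E Z. mpoly_eval f x = 0)}"
      by (rule bspec)
    show ?thesis
      by (subst conjunct2[OF EZ]) (rule in_projective_zeros_iff[OF conjunct1[OF EZ] that(2)])
  qed
  have "\<Inter>\<F> = {proj_point x | x. x \<noteq> 0 \<and> (\<forall>f\<in>\<Union>(E ` \<F>). mpoly_eval f x = 0)}"
  proof (intro equalityI subsetI)
    fix a assume a: "a \<in> \<Inter>\<F>"
    obtain Z where Z: "Z \<in> \<F>" using assms(2) by blast
    hence "a \<in> {proj_point x | x. x \<noteq> 0 \<and> (\<forall>f\<in>E Z. mpoly_eval f x = 0)}" using a E by blast
    then obtain x where x: "a = proj_point x" "x \<noteq> 0" by blast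
    have "\<forall>f\<in>\<Union>(E ` \<F>). mpoly_eval f x = 0" using mem[OF _ x(2)] a x(1) by blast
    thus "a \<in> {proj_point x | x. x \<noteq> 0 \<and> (\<forall>f\<in>\<Union>(E ` \<F>). mpoly_eval f x = 0)}" using x by blast
  next
    fix a assume "a \<in> {proj_point x | x. x \<noteq> 0 \<and> (\<forall>f\<in>\<Union>(E ` \<F>). mpoly_eval f x = 0)}"
    thus "a \<in> \<Inter>\<F>" using mem by blast
  qed
  moreover have "\<forall>f\<in>\<Union>(E ` \<F>). homogeneous f" using E by blast
  ultimately show ?thesis unfolding zariski_closed_def by blast
qed

text \<open>Closed supersets exist because \<open>S\<close> consists of genuine points;
  \<open>proj_point 0\<close> lies in no closed set.\<close>

lemma zariski_closure:
  fixes S :: "('k::field, 'n::finite) proj_point set"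
  assumes "S \<subseteq> {proj_point x | x. x \<noteq> 0}"
  shows "zariski_closed (zariski_closure S)" "S \<subseteq> zariski_closure S"
    "zariski_closed Z \<Longrightarrow> S \<subseteq> Z \<Longrightarrow> zariski_closure S \<subseteq> Z"
proof -
  have "zariski_closed {proj_point x :: ('k, 'n) proj_point | x. x \<noteq> 0}"
    unfolding zariski_closed_def by (intro exI[of _ "{}"]) auto
  hence "{Z. zariski_closed Z \<and> S \<subseteq> Z} \<noteq> {}" using assms by blast
  thus "zariski_closed (zariski_closure S)" unfolding zariski_closure_def by (intro zariski_closed_Inter) auto
qed (auto simp: zariski_closure_def)

text \<open>The chart is kept as a subset of the full coordinate space, so the affine results apply
  at the same type.\<close>

definition affine_part :: "'n \<Rightarrow> ('k::field, 'n::finite) proj_point set \<Rightarrow> ('k ^ 'n) set" where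
  "affine_part i0 X = {x. x $ i0 = 1 \<and> proj_point x \<in> X}"

lemma aff_closed_affine_part:
  assumes "zariski_closed X"
  shows "aff_closed (affine_part i0 X)"
proof -
  obtain E where E: "\<forall>f\<in>E. homogeneous f" "X = {proj_point x | x. x \<noteq> 0 \<and> (\<forall>f\<in>E. mpoly_eval f x = 0)}"
    using assms unfolding zariski_closed_def by blast
  have "proj_point x \<in> X \<longleftrightarrow> (\<forall>f\<in>E. mpoly_eval f x = 0)" if "x $ i0 = 1" for x
    unfolding E(2) by (rule in_projective_zeros_iff[OF E(1)]) (use that in auto)
  hence "affine_part i0 X = {x. x $ i0 = 1} \<inter> {x. \<forall>g\<in>mpoly_eval ` E. g x = 0}"
    unfolding affine_part_def by blast
  moreover have "aff_closed {x. \<forall>g\<in>mpoly_eval ` E. g x = 0}"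
    unfolding aff_closed_def by (intro exI[of _ "mpoly_eval ` E"] conjI refl image_subsetI mpoly_eval_in_polyfun)
  ultimately show ?thesis by (simp only: aff_closed_Int[OF aff_closed_coord])
qed

text \<open>The Zariski closures of the members of an affine chain are irreducible. Strict inclusion
  survives: a polynomial function separating a point from \<open>Z i\<close> homogenizes to a form
  that vanishes on the closure of \<open>Z i\<close> but not at that point.\<close>

theorem independent_coords_variety_dim:
  fixes X :: "('k::{alg_closed_field, field_char_0}, 'n::finite) proj_point set"
  assumes X: "zariski_closed X" and indep: "coords_independent (affine_part i0 X) I"
  shows "enat (card I) \<le> variety_dim X"
proof -
  obtain Z where Z: "aff_chain (card I) Z" "Z (card I) \<subseteq> affine_part i0 X"
    using independent_coords_chain[OF aff_closed_affine_part[OF X] indep] by blast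
  have irr: "aff_irreducible (Z i)" if "i \<le> card I" for i
    using Z(1) that by (simp add: aff_chain_def)
  have sub: "Z i \<subseteq> affine_part i0 X" if "i \<le> card I" for i
    using that
  proof (induction rule: inc_induct)
    case (step k)
    hence "Z k \<subset> Z (Suc k)" using Z(1) by (simp add: aff_chain_def)
    thus ?case using step by blast
  qed (rule Z(2))
  have points: "proj_point ` Z i \<subseteq> {proj_point x | x. x \<noteq> 0}" if "i \<le> card I" for i
    using sub[OF that] by (force simp: affine_part_def)
  note cl = zariski_closure[OF points]
  define W where "W = (\<lambda>i. zariski_closure (proj_point ` Z i))"
  have "irreducible_closed (W i) \<and> W i \<subseteq> X" if i: "i \<le> card I" for i
  proof
    show "W i \<subseteq> X" unfolding W_def using sub[OF i] by (intro cl(3)[OF i X]) (auto simp: affine_part_def)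
    show "irreducible_closed (W i)"
      unfolding irreducible_closed_def
    proof (intro conjI allI impI)
      show "zariski_closed (W i)" unfolding W_def by (rule cl(1)[OF i])
      have "Z i \<noteq> {}" using irr[OF i] by (simp add: aff_irreducible_def)
      thus "W i \<noteq> {}" using cl(2)[OF i] unfolding W_def by blast
      fix Z1 Z2 assume *: "zariski_closed Z1 \<and> zariski_closed Z2 \<and> W i = Z1 \<union> Z2"
      have "Z i \<subseteq> affine_part i0 Z1 \<union> affine_part i0 Z2"
        using sub[OF i] cl(2)[OF i] * unfolding W_def affine_part_def by blast
      hence "Z i \<subseteq> affine_part i0 Z1 \<or> Z i \<subseteq> affine_part i0 Z2"
        using irr[OF i] aff_closed_affine_part * unfolding aff_irreducible_def by blast
      moreover have "W i = Y" if "Z i \<subseteq> affine_part i0 Y" "zariski_closed Y" "Y \<subseteq> W i" for Y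
      proof -
        have "W i \<subseteq> Y" unfolding W_def using that(1) by (intro cl(3)[OF i that(2)]) (auto simp: affine_part_def)
        thus ?thesis using that(3) by blast
      qed
      ultimately show "W i = Z1 \<or> W i = Z2" using * by blast
    qed
  qed
  moreover have "W i \<subset> W (Suc i)" if i: "i < card I" for i
  proof
    have Zi: "Z i \<subset> Z (Suc i)" using Z(1) i by (simp add: aff_chain_def)
    have i': "i \<le> card I" "Suc i \<le> card I" using i by auto
    show "W i \<subseteq> W (Suc i)"
      unfolding W_def using Zi cl(2)[OF i'(2)] by (intro cl(3)[OF i'(1) cl(1)[OF i'(2)]]) blast
    obtain z where z: "z \<in> Z (Suc i)" "z \<notin> Z i" using Zi by blast
    have "aff_closed (Z i)" using irr[OF i'(1)] by (simp add: aff_irreducible_def)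
    then obtain f where f: "f \<in> polyfun UNIV" "\<And>x. x \<in> Z i \<Longrightarrow> f x = 0" "f z \<noteq> 0"
      using aff_closed_separate z(2) by metis
    obtain d F where F: "homogeneous_of d F" "\<And>x. x $ i0 = 1 \<Longrightarrow> mpoly_eval F x = f x"
      using homogenize[OF f(1)] by blast
    define Y where "Y = {proj_point x | x. x \<noteq> 0 \<and> (\<forall>f\<in>{F}. mpoly_eval f x = 0)}"
    have hF: "\<forall>f\<in>{F}. homogeneous f" using F(1) by (auto simp: homogeneous_altdef)
    have Y: "zariski_closed Y" unfolding zariski_closed_def Y_def using hF by blast
    have one: "x $ i0 = 1" "x \<noteq> 0" if "x \<in> Z k" "k \<le> card I" for x k
      using sub[OF that(2)] that(1) by (force simp: affine_part_def)+
    have mem: "proj_point x \<in> Y \<longleftrightarrow> f x = 0" if "x \<in> Z k" "k \<le> card I" for x k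
      using in_projective_zeros_iff[OF hF one(2)[OF that]] F(2)[OF one(1)[OF that]] unfolding Y_def by simp
    have "W i \<subseteq> Y" unfolding W_def using mem i' f(2) by (intro cl(3)[OF i'(1) Y]) blast
    moreover have "proj_point z \<notin> Y" using mem[OF z(1) i'(2)] f(3) by simp
    moreover have "proj_point z \<in> W (Suc i)" using cl(2)[OF i'(2)] z(1) unfolding W_def by blast
    ultimately show "W i \<noteq> W (Suc i)" by blast
  qed
  ultimately have "enat (card I) \<in> {enat d | d. \<exists>Z. (\<forall>i\<le>d. irreducible_closed (Z i) \<and> Z i \<subseteq> X) \<and> (\<forall>i<d. Z i \<subset> Z (Suc i))}"
    by blast
  thus ?thesis unfolding variety_dim_def by (rule Sup_upper)
qed

section \<open>The dimension of a tropicalization\<close>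

lemma puiseux_val:
  assumes "c \<noteq> 0"
  shows "puiseux_coeff c (puiseux_val c) \<noteq> 0" "puiseux_coeff c \<tau> \<noteq> 0 \<Longrightarrow> \<tau> \<le> puiseux_val c"
proof -
  obtain a d where ad: "0 < d" "{\<tau>. puiseux_coeff c \<tau> \<noteq> 0} \<subseteq> range (\<lambda>k::nat. a - of_nat k * d)"
    using puiseux_coeff_locally_convergent[of c] unfolding locally_convergent_puiseux_def by blast
  have "\<exists>k::nat. puiseux_coeff c (a - of_nat k * d) \<noteq> 0"
  proof (rule ccontr)
    assume *: "\<not> ?thesis"
    have "puiseux_coeff c \<tau> = 0" for \<tau> using ad(2) * by blast
    hence "puiseux_coeff c = puiseux_coeff 0" by (simp add: fun_eq_iff zero_puiseux.rep_eq)
    thus False using assms by (simp add: puiseux_coeff_inject)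
  qed
  \<comment> \<open>Exponents descend from \<open>a\<close> in steps of \<open>d\<close>, so the
    least index with nonzero coefficient gives the largest exponent.\<close>
  then obtain k :: nat where k: "puiseux_coeff c (a - of_nat k * d) \<noteq> 0"
    and least: "\<And>j. puiseux_coeff c (a - of_nat j * d) \<noteq> 0 \<Longrightarrow> k \<le> j"
    using exists_least_iff[of "\<lambda>k. puiseux_coeff c (a - of_nat k * d) \<noteq> 0"] by (metis not_le)
  have le: "\<tau> \<le> a - of_nat k * d" if "puiseux_coeff c \<tau> \<noteq> 0" for \<tau>
  proof -
    from that have "\<tau> \<in> range (\<lambda>k::nat. a - of_nat k * d)" using ad(2) by blast
    then obtain j :: nat where j: "\<tau> = a - of_nat j * d" ..
    hence "k \<le> j" using that least by blast
    thus ?thesis using ad(1) by (simp add: j)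
  qed
  have "puiseux_val c = a - of_nat k * d"
    unfolding puiseux_val_def by (rule Greatest_equality) (use k le in auto)
  thus "puiseux_coeff c (puiseux_val c) \<noteq> 0" "puiseux_coeff c \<tau> \<noteq> 0 \<Longrightarrow> \<tau> \<le> puiseux_val c"
    using k le by auto
qed

lemma puiseux_val_eqI:
  assumes "puiseux_coeff c v \<noteq> 0" "\<And>\<tau>. puiseux_coeff c \<tau> \<noteq> 0 \<Longrightarrow> \<tau> \<le> v"
  shows "puiseux_val c = v"
  unfolding puiseux_val_def by (rule Greatest_equality) (use assms in auto)

lemma puiseux_val_mult:
  assumes "c \<noteq> 0" "d \<noteq> 0"
  shows "puiseux_val (c * d) = puiseux_val c + puiseux_val d"
proof (rule puiseux_val_eqI)
  have "{\<sigma>. puiseux_coeff c \<sigma> \<noteq> 0 \<and> puiseux_coeff d (puiseux_val c + puiseux_val d - \<sigma>) \<noteq> 0} = {puiseux_val c}"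
    using puiseux_val[OF assms(1)] puiseux_val[OF assms(2)] by force
  thus "puiseux_coeff (c * d) (puiseux_val c + puiseux_val d) \<noteq> 0"
    using puiseux_val(1)[OF assms(1)] puiseux_val(1)[OF assms(2)]
    by (simp add: times_puiseux.rep_eq puiseux_conv_def)
next
  fix \<tau> assume "puiseux_coeff (c * d) \<tau> \<noteq> 0"
  then obtain \<sigma> where "puiseux_coeff c \<sigma> \<noteq> 0" "puiseux_coeff d (\<tau> - \<sigma>) \<noteq> 0"
    unfolding times_puiseux.rep_eq puiseux_conv_def by (metis (mono_tags, lifting) mem_Collect_eq sum.neutral mult_eq_0_iff)
  hence "\<sigma> \<le> puiseux_val c" "\<tau> - \<sigma> \<le> puiseux_val d" using puiseux_val(2) assms by auto
  thus "\<tau> \<le> puiseux_val c + puiseux_val d" by simp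
qed

lemma puiseux_val_1: "puiseux_val 1 = 0"
  by (rule puiseux_val_eqI) (auto simp: one_puiseux.rep_eq split: if_splits)

lemma puiseux_val_power: "c \<noteq> 0 \<Longrightarrow> puiseux_val (c ^ n) = of_nat n * puiseux_val c"
  by (induction n) (simp_all add: puiseux_val_1 puiseux_val_mult algebra_simps)

lemma puiseux_val_divide: "c \<noteq> 0 \<Longrightarrow> d \<noteq> 0 \<Longrightarrow> puiseux_val (c / d) = puiseux_val c - puiseux_val d"
  using puiseux_val_mult[of "c / d" d] by simp

lemma puiseux_val_prod:
  "(\<And>i. i \<in> K \<Longrightarrow> f i \<noteq> 0) \<Longrightarrow> puiseux_val (\<Prod>i\<in>K. f i) = (\<Sum>i\<in>K. puiseux_val (f i))"
  by (induction K rule: infinite_finite_induct) (auto simp: puiseux_val_1 puiseux_val_mult)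

lemma puiseux_coeff_sum: "puiseux_coeff (\<Sum>i\<in>K. f i) \<tau> = (\<Sum>i\<in>K. puiseux_coeff (f i) \<tau>)"
  by (induction K rule: infinite_finite_induct) (auto simp: zero_puiseux.rep_eq plus_puiseux.rep_eq)

text \<open>If a single term attained the largest valuation \<open>v\<close>, the coefficient of t^v
  in the sum would be that of this term alone, hence nonzero.\<close>

lemma puiseux_sum_zero_val_tie:
  assumes "finite S" "S \<noteq> {}" "\<And>i. i \<in> S \<Longrightarrow> f i \<noteq> 0" "(\<Sum>i\<in>S. f i) = 0"
  shows "\<exists>i\<in>S. \<exists>j\<in>S. i \<noteq> j \<and> puiseux_val (f i) = puiseux_val (f j)"
proof (rule ccontr)
  assume no_tie: "\<not> ?thesis"
  define v where "v = Max ((\<lambda>i. puiseux_val (f i)) ` S)"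
  have "v \<in> (\<lambda>i. puiseux_val (f i)) ` S" unfolding v_def using assms(1,2) by (intro Max_in) auto
  then obtain i where i: "i \<in> S" "v = puiseux_val (f i)" by blast
  have "puiseux_coeff (f j) v = 0" if j: "j \<in> S - {i}" for j
  proof (rule ccontr)
    assume "puiseux_coeff (f j) v \<noteq> 0"
    hence "v \<le> puiseux_val (f j)" using j assms(3) by (intro puiseux_val(2)) auto
    moreover have "puiseux_val (f j) \<le> v" unfolding v_def using j assms(1) by (intro Max_ge) auto
    ultimately show False using no_tie i j by auto
  qed
  hence "(\<Sum>j\<in>S. puiseux_coeff (f j) v) = puiseux_coeff (f i) v"
    using assms(1) i(1) by (simp add: sum.remove)
  moreover have "(\<Sum>j\<in>S. puiseux_coeff (f j) v) = 0"
    using assms(4) puiseux_coeff_sum[of f S v] by (simp add: zero_puiseux.rep_eq)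
  ultimately show False using puiseux_val(1)[OF assms(3)[OF i(1)]] i(2) by simp
qed

text \<open>\<open>I\<close> is taken of greatest size such that no nonzero linear form in the
  coordinates \<open>I\<close> vanishes on \<open>U\<close>. By maximality every other coordinate is
  on \<open>U\<close> a combination of those in \<open>I\<close>, so the projection to
  \<open>I\<close> is injective on \<open>U\<close>.\<close>

lemma coordinates_detecting_subspace:
  fixes U :: "(real ^ 'n::finite) set"
  assumes "subspace U"
  obtains I where "dim U \<le> card I" "\<And>g. (\<And>i. i \<notin> I \<Longrightarrow> g $ i = 0) \<Longrightarrow> (\<And>u. u \<in> U \<Longrightarrow> g \<bullet> u = 0) \<Longrightarrow> g = 0"
proof -
  define P where "P = (\<lambda>I. \<forall>g. (\<forall>i. i \<notin> I \<longrightarrow> g $ i = 0) \<and> (\<forall>u\<in>U. g \<bullet> u = 0) \<longrightarrow> g = 0)"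
  have "P {}" by (auto simp: P_def vec_eq_iff)
  then obtain I where I: "P I" and max: "\<And>J. P J \<Longrightarrow> card J \<le> card I"
    using ex_has_greatest_nat[of P "{}" card "CARD('n) + 1"] by (auto simp: less_Suc_eq_le card_mono)
  have dep: "\<exists>g. (\<forall>i. i \<notin> insert j I \<longrightarrow> g $ i = 0) \<and> (\<forall>u\<in>U. g \<bullet> u = 0) \<and> g $ j \<noteq> 0" if j: "j \<notin> I" for j
  proof -
    have "\<not> P (insert j I)" using max[of "insert j I"] j by auto
    then obtain g where g: "\<forall>i. i \<notin> insert j I \<longrightarrow> g $ i = 0" "\<forall>u\<in>U. g \<bullet> u = 0" "g \<noteq> 0"
      unfolding P_def by blast
    have "g $ j \<noteq> 0"
    proof
      assume "g $ j = 0"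
      hence "\<forall>i. i \<notin> I \<longrightarrow> g $ i = 0" using g(1) by auto
      thus False using I g(2,3) unfolding P_def by blast
    qed
    thus ?thesis using g by blast
  qed
  define \<rho> :: "real ^ 'n \<Rightarrow> real ^ 'n" where "\<rho> = (\<lambda>x. \<chi> i. if i \<in> I then x $ i else 0)"
  have lin: "linear \<rho>" by (rule linearI) (auto simp: \<rho>_def vec_eq_iff)
  have inj: "inj_on \<rho> U"
  proof (rule linear_inj_on_iff_eq_0[OF lin assms, THEN iffD2], intro ballI impI)
    fix u assume u: "u \<in> U" "\<rho> u = 0"
    have uI: "u $ i = 0" if "i \<in> I" for i using u(2) that by (auto simp: \<rho>_def vec_eq_iff split: if_splits)
    have "u $ j = 0" if j: "j \<notin> I" for j
    proof -
      obtain g where g: "\<forall>i. i \<notin> insert j I \<longrightarrow> g $ i = 0" "\<forall>u\<in>U. g \<bullet> u = 0" "g $ j \<noteq> 0"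
        using dep[OF j] by blast
      have eq: "g $ i \<bullet> u $ i = (if i = j then g $ j * u $ j else 0)" for i
        using uI g(1) j by auto
      have "g \<bullet> u = (\<Sum>i\<in>UNIV. if i = j then g $ j * u $ j else 0)"
        unfolding inner_vec_def by (intro sum.cong refl eq)
      hence "g \<bullet> u = g $ j * u $ j" by simp
      thus ?thesis using g(2,3) u(1) by auto
    qed
    hence "u $ i = 0" for i using uI by (cases "i \<in> I") auto
    thus "u = 0" by (simp add: vec_eq_iff)
  qed
  have "dim U = dim (\<rho> ` U)" by (rule dim_image_eq[symmetric, OF lin]) (use inj assms in \<open>simp add: span_eq_iff[THEN iffD2]\<close>)
  also have "\<dots> \<le> card ((\<lambda>i. axis i 1 :: real ^ 'n) ` I)"
  proof (rule dim_le_card)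
    show "\<rho> ` U \<subseteq> span ((\<lambda>i. axis i 1) ` I)"
    proof
      fix y assume "y \<in> \<rho> ` U"
      then obtain x where y: "y = \<rho> x" by blast
      have "y = (\<Sum>i\<in>I. x $ i *\<^sub>R axis i 1)"
        by (auto simp: y \<rho>_def vec_eq_iff axis_def if_distrib[of "\<lambda>t. _ * t"] cong: if_cong)
      also have "\<dots> \<in> span ((\<lambda>i. axis i 1) ` I)"
        by (intro span_sum span_scale span_base) auto
      finally show "y \<in> span ((\<lambda>i. axis i 1) ` I)" .
    qed
  qed simp
  also have "\<dots> \<le> card I" by (rule card_image_le) simp
  finally show ?thesis using that[of I] I unfolding P_def by blast
qed

lemma abs_trop_torus_eq_iff: "abs_trop_torus x = abs_trop_torus y \<longleftrightarrow> (\<exists>c. \<forall>i. x $ i - y $ i = c)"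
  by (rule trop_torus.abs_eq_iff)

lemma linear_abs_trop_torus: "linear abs_trop_torus"
  by (rule linearI) (simp_all add: plus_trop_torus.abs_eq scaleR_trop_torus.abs_eq)

lemma monom_eval_val:
  fixes x :: "puiseux ^ 'n::finite"
  assumes "\<And>i. x $ i \<noteq> 0"
  shows "monom_eval m x \<noteq> 0"
    "puiseux_val (monom_eval m x) = (\<Sum>i\<in>UNIV. of_nat (Poly_Mapping.lookup m i) * puiseux_val (x $ i))"
  using assms by (simp_all add: monom_eval_def puiseux_val_prod puiseux_val_power)

text \<open>As the coefficients of each form sum to 0, the hyperplanes are invariant under adding
  constants. Their union is thus the full preimage of its image, and closedness descends to the
  quotient.\<close>

lemma closed_hyperplanes_image:
  fixes \<H> :: "((real ^ 'n::finite) \<times> real) set"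
  assumes "finite \<H>" "\<forall>(g, c)\<in>\<H>. (\<Sum>i\<in>UNIV. g $ i) = 0"
  defines "H \<equiv> {w. \<exists>(g, c)\<in>\<H>. g \<bullet> w = c}"
  shows "closed (abs_trop_torus ` H)" "abs_trop_torus w \<in> abs_trop_torus ` H \<longleftrightarrow> w \<in> H"
proof -
  have sat: "w' \<in> H" if w: "w \<in> H" and eq: "abs_trop_torus w = abs_trop_torus w'" for w w'
  proof -
    from w obtain g c where gc: "(g, c) \<in> \<H>" "g \<bullet> w = c" unfolding H_def by blast
    from eq obtain k where k: "\<And>i. w $ i - w' $ i = k" unfolding abs_trop_torus_eq_iff by blast
    have "g \<bullet> w - g \<bullet> w' = g \<bullet> (w - w')" by (simp add: inner_diff_right)
    also have "\<dots> = (\<Sum>i\<in>UNIV. g $ i) * k" by (simp add: inner_vec_def k sum_distrib_right)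
    finally have "g \<bullet> w' = c" using gc assms(2) by auto
    thus ?thesis using gc(1) unfolding H_def by blast
  qed
  show mem: "abs_trop_torus w \<in> abs_trop_torus ` H \<longleftrightarrow> w \<in> H" for w
  proof
    assume "abs_trop_torus w \<in> abs_trop_torus ` H"
    then obtain w' where "abs_trop_torus w = abs_trop_torus w'" "w' \<in> H" by (rule imageE)
    thus "w \<in> H" using sat[of w' w] by simp
  qed simp
  have "H = (\<Union>(g, c)\<in>\<H>. {w. g \<bullet> w = c})" unfolding H_def by auto
  moreover have "closed \<dots>" using assms(1) by (intro closed_UN) (auto intro: closed_hyperplane)
  ultimately have "closed H" by simp
  moreover have "abs_trop_torus -` (- abs_trop_torus ` H) = - H" using mem by auto
  ultimately show "closed (abs_trop_torus ` H)"
    unfolding closed_def open_trop_torus_def by simp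
qed

text \<open>A moment curve meets a hyperplane in infinitely many points only if the hyperplane contains all
  the vectors \<open>v k\<close>.\<close>

theorem tropical_dimension:
  fixes X :: "(puiseux, 'n::finite) proj_point set" and v :: "nat \<Rightarrow> real ^ 'n"
  assumes X: "zariski_closed X"
    and indep: "independent (insert (\<chi> i. 1) (v ` {..<r}))" "inj_on v {..<r}" "(\<chi> i. 1) \<notin> v ` {..<r}"
    and curve: "\<And>s. s > 0 \<Longrightarrow> abs_trop_torus (\<Sum>k<r. s ^ Suc k *\<^sub>R v k) \<in> tropicalization X"
  shows "enat r \<le> variety_dim X"
proof -
  let ?one = "(\<chi> i. 1) :: real ^ 'n"
  \<comment> \<open>The constant vector is included because the tropical torus divides by it; the
    extra dimension pays for removing the coordinate \<open>i0\<close> from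
    \<open>I\<close>.\<close>
  define U where "U = span (insert ?one (v ` {..<r}))"
  have dimU: "dim U = Suc r"
    unfolding U_def using indep by (simp add: dim_eq_card_independent card_image)
  obtain I where I: "dim U \<le> card I"
    "\<And>g. (\<And>i. i \<notin> I \<Longrightarrow> g $ i = 0) \<Longrightarrow> (\<And>u. u \<in> U \<Longrightarrow> g \<bullet> u = 0) \<Longrightarrow> g = 0"
    using coordinates_detecting_subspace[of U] unfolding U_def by (metis subspace_span)
  have "I \<noteq> {}" using I(1) dimU by auto
  then obtain i0 where i0: "i0 \<in> I" by blast
  define I' where "I' = I - {i0}"
  have card_I': "r \<le> card I'" using I(1) dimU i0 by (simp add: I'_def)
  have "coords_independent (affine_part i0 X) I'"
  proof (rule ccontr)
    assume "\<not> ?thesis"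
    then obtain f where f: "f \<in> polyfun I'" "f \<noteq> 0" "vanishes_on (affine_part i0 X) f"
      unfolding coords_independent_def by blast
    obtain F where F: "\<And>m. m \<in> Poly_Mapping.keys F \<Longrightarrow> Poly_Mapping.keys m \<subseteq> I'" "f = mpoly_eval F"
      using polyfun_as_mpoly_eval[OF f(1)] by blast
    let ?K = "Poly_Mapping.keys F"
    have K: "?K \<noteq> {}" using f(2) F(2) by (auto simp: mpoly_eval_def fun_eq_iff)
    define e where "e = (\<lambda>m (i::'n). real (Poly_Mapping.lookup m i))"
    \<comment> \<open>Normal of the hyperplane on which the monomials \<open>m\<close> and
      \<open>m'\<close> tie after division of the point by its coordinate \<open>i0\<close>. The
      entry at \<open>i0\<close> accounts for this division and makes the entries sum to 0;
      \<open>c\<close> below comes from the coefficients of the two monomials.\<close>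
    define g where "g = (\<lambda>m m'. (\<chi> i. if i = i0 then - (\<Sum>j\<in>UNIV. e m j - e m' j) else e m i - e m' i) :: real ^ 'n)"
    have e0: "e m i = 0" if "m \<in> ?K" "i \<notin> I'" for m i
      using F(1)[OF that(1)] that(2) by (auto simp: e_def in_keys_iff)
    have g_inner: "g m m' \<bullet> w = (\<Sum>i\<in>UNIV. (e m i - e m' i) * (w $ i - w $ i0))"
      if "m \<in> ?K" "m' \<in> ?K" for m m' w
    proof -
      have e00: "e m i0 = 0" "e m' i0 = 0" using e0 that by (auto simp: I'_def)
      have "g m m' \<bullet> w = (\<Sum>i\<in>UNIV. (e m i - e m' i) * w $ i - (if i = i0 then (\<Sum>j\<in>UNIV. e m j - e m' j) * w $ i0 else 0))"
        unfolding inner_vec_def by (rule sum.cong) (auto simp: g_def e00)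
      also have "\<dots> = (\<Sum>i\<in>UNIV. (e m i - e m' i) * w $ i) - (\<Sum>j\<in>UNIV. e m j - e m' j) * w $ i0"
        by (simp add: sum_subtractf)
      finally show ?thesis by (simp add: right_diff_distrib sum_subtractf[symmetric] sum_distrib_right)
    qed
    define c where "c = (\<lambda>m m'. of_rat (puiseux_val (Poly_Mapping.lookup F m') - puiseux_val (Poly_Mapping.lookup F m)) :: real)"
    define \<H> where "\<H> = {(g m m', c m m') | m m'. m \<in> ?K \<and> m' \<in> ?K \<and> m \<noteq> m'}"
    have "finite \<H>"
    proof (rule finite_subset)
      show "\<H> \<subseteq> (\<lambda>(m, m'). (g m m', c m m')) ` (?K \<times> ?K)"
      proof
        fix p assume "p \<in> \<H>"
        then obtain m m' where "m \<in> ?K" "m' \<in> ?K" "p = (g m m', c m m')" unfolding \<H>_def by blast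
        thus "p \<in> (\<lambda>(m, m'). (g m m', c m m')) ` (?K \<times> ?K)" by (intro image_eqI[of _ _ "(m, m')"]) auto
      qed
    qed simp
    have sum_g: "(\<Sum>i\<in>UNIV. h $ i) = 0" if hd: "(h, d) \<in> \<H>" for h d
    proof -
      obtain m m' where m: "m \<in> ?K" "m' \<in> ?K" "h = g m m'" using hd unfolding \<H>_def by blast
      have "(\<Sum>i\<in>UNIV. h $ i) = h \<bullet> ?one" by (simp add: inner_vec_def)
      also have "\<dots> = 0" unfolding m(3) g_inner[OF m(1,2)] by simp
      finally show ?thesis .
    qed
    define H where "H = {w. \<exists>(g, c)\<in>\<H>. g \<bullet> w = c}"
    have "\<forall>(g, c)\<in>\<H>. (\<Sum>i\<in>UNIV. g $ i) = 0" using sum_g by blast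
    note H = closed_hyperplanes_image[OF \<open>finite \<H>\<close> this, folded H_def]
    have "(\<chi> i. of_rat (puiseux_val (x $ i))) \<in> H" if x: "\<And>i. x $ i \<noteq> 0" "proj_point x \<in> X" for x :: "puiseux ^ 'n"
    proof -
      define y where "y = (1 / x $ i0) *s x"
      have y: "y $ i = x $ i / x $ i0" "y $ i \<noteq> 0" for i using x(1) by (auto simp: y_def)
      have "proj_point y = proj_point x" unfolding proj_point_eq_iff y_def using x(1) by (intro exI[of _ "1 / x $ i0"]) auto
      hence "y \<in> affine_part i0 X" using x y by (simp add: affine_part_def)
      hence "(\<Sum>m\<in>?K. Poly_Mapping.lookup F m * monom_eval m y) = 0"
        using f(3) unfolding vanishes_on_def F(2) mpoly_eval_def monom_eval_def by blast
      then obtain m m' where m: "m \<in> ?K" "m' \<in> ?K" "m \<noteq> m'"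
        and tie: "puiseux_val (Poly_Mapping.lookup F m * monom_eval m y) = puiseux_val (Poly_Mapping.lookup F m' * monom_eval m' y)"
        using puiseux_sum_zero_val_tie[OF finite_keys K, of "\<lambda>m. Poly_Mapping.lookup F m * monom_eval m y"]
          monom_eval_val(1)[OF y(2)] by (auto simp: in_keys_iff)
      have val: "of_rat (puiseux_val (Poly_Mapping.lookup F m * monom_eval m y)) =
         of_rat (puiseux_val (Poly_Mapping.lookup F m)) + (\<Sum>i\<in>UNIV. e m i * (of_rat (puiseux_val (x $ i)) - of_rat (puiseux_val (x $ i0))))"
        if "m \<in> ?K" for m
        using that monom_eval_val[OF y(2), of m] x(1)
        by (simp add: puiseux_val_mult in_keys_iff of_rat_add of_rat_sum of_rat_mult of_rat_diff e_def y(1) puiseux_val_divide)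
      have "g m m' \<bullet> (\<chi> i. of_rat (puiseux_val (x $ i))) = c m m'"
        using val[OF m(1)] val[OF m(2)] tie
        by (simp add: g_inner[OF m(1,2)] c_def of_rat_diff left_diff_distrib sum_subtractf)
      thus ?thesis using m unfolding H_def \<H>_def by blast
    qed
    hence "tropicalization X \<subseteq> abs_trop_torus ` H"
      unfolding tropicalization_def by (intro closure_minimal[OF _ H(1)]) blast
    hence in_H: "(\<Sum>k<r. s ^ Suc k *\<^sub>R v k) \<in> H" if "s > 0" for s
      using curve[OF that] H(2) by blast
    have "{0<..} \<subseteq> (\<Union>(h, d)\<in>\<H>. {s. h \<bullet> (\<Sum>k<r. s ^ Suc k *\<^sub>R v k) = d})"
      using in_H unfolding H_def by fastforce
    moreover have "infinite {0 :: real<..}" by (rule infinite_Ioi)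
    ultimately have "\<not> finite (\<Union>(h, d)\<in>\<H>. {s. h \<bullet> (\<Sum>k<r. s ^ Suc k *\<^sub>R v k) = d})"
      using finite_subset by blast
    then obtain p where p: "p \<in> \<H>" "infinite (case p of (h, d) \<Rightarrow> {s. h \<bullet> (\<Sum>k<r. s ^ Suc k *\<^sub>R v k) = d})"
      using finite_UN_I[OF \<open>finite \<H>\<close>] by blast
    obtain h d where hd': "p = (h, d)" by (cases p)
    from p have hd: "(h, d) \<in> \<H>" "infinite {s. h \<bullet> (\<Sum>k<r. s ^ Suc k *\<^sub>R v k) = d}"
      unfolding hd' by simp_all
    \<comment> \<open>One hyperplane contains the curve for infinitely many \<open>s\<close>, so
      this polynomial is 0. The exponents start at 1, which separates the
      \<open>h \<bullet> v k\<close> from the constant \<open>d\<close>.\<close>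
    define P where "P = (\<Sum>k<r. Polynomial.monom (h \<bullet> v k) (Suc k)) - [:d:]"
    have "poly P s = h \<bullet> (\<Sum>k<r. s ^ Suc k *\<^sub>R v k) - d" for s
      by (simp add: P_def poly_sum poly_monom inner_sum_right mult_ac)
    hence "P = 0" using hd(2) poly_roots_finite[of P] by auto
    have hv: "h \<bullet> v k = 0" if "k < r" for k
    proof -
      have "coeff P (Suc k) = (\<Sum>j<r. if j = k then h \<bullet> v k else 0)"
        unfolding P_def coeff_diff coeff_sum coeff_monom by (simp cong: sum.cong if_cong)
      thus ?thesis using that \<open>P = 0\<close> by simp
    qed
    obtain m m' where m: "m \<in> ?K" "m' \<in> ?K" "m \<noteq> m'" "h = g m m'" using hd(1) unfolding \<H>_def by blast
    \<comment> \<open>\<open>h\<close> is supported on \<open>I\<close> and orthogonal to the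
      constant vector and to all \<open>v k\<close>, hence to \<open>U\<close>.\<close>
    have "h = 0"
    proof (rule I(2))
      show "h $ i = 0" if "i \<notin> I" for i
        using that i0 e0[OF m(1), of i] e0[OF m(2), of i] by (auto simp: m(4) g_def I'_def)
      have "h \<bullet> ?one = 0" using sum_g[OF hd(1)] by (simp add: inner_vec_def)
      hence "\<forall>u\<in>insert ?one (v ` {..<r}). h \<bullet> u = 0" using hv by auto
      moreover have "subspace {u. h \<bullet> u = 0}" by (rule subspace_hyperplane)
      ultimately have "U \<subseteq> {u. h \<bullet> u = 0}" unfolding U_def by (intro span_minimal) auto
      thus "h \<bullet> u = 0" if "u \<in> U" for u using that by blast
    qed
    have "Poly_Mapping.lookup m i = Poly_Mapping.lookup m' i" for i
    proof (cases "i = i0")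
      case True
      thus ?thesis using e0[OF m(1), of i0] e0[OF m(2), of i0] by (simp add: e_def I'_def)
    next
      case False
      have "g m m' $ i = 0" using \<open>h = 0\<close> m(4) by simp
      thus ?thesis using False by (simp add: g_def e_def)
    qed
    thus False using m(3) poly_mapping_eqI by blast
  qed
  from independent_coords_variety_dim[OF X this] card_I' show ?thesis
    by (meson enat_ord_simps(1) order_trans)
qed

section \<open>Coherent subdivisions\<close>

text \<open>An affine function is stored as the pair of its gradient and its constant term, so that
  affine functions form a real vector space.\<close>

definition aff_val :: "(real \<times> real) \<times> real \<Rightarrow> real \<times> real \<Rightarrow> real" where
  "aff_val l x = fst l \<bullet> x + snd l"

lemma aff_val_add: "aff_val (l + m) x = aff_val l x + aff_val m x"
  by (simp add: aff_val_def inner_add_left)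

lemma aff_val_diff: "aff_val (l - m) x = aff_val l x - aff_val m x"
  by (simp add: aff_val_def inner_diff_left)

lemma aff_val_scaleR: "aff_val (c *\<^sub>R l) x = c * aff_val l x"
  by (simp add: aff_val_def algebra_simps)

lemma aff_val_uminus: "aff_val (- l) x = - aff_val l x"
  by (simp add: aff_val_def)

lemma aff_val_const: "aff_val (0, c) x = c"
  by (simp add: aff_val_def)

lemma aff_val_convex_sum:
  assumes "sum u T = 1"
  shows "aff_val l (\<Sum>i\<in>T. u i *\<^sub>R p i) = (\<Sum>i\<in>T. u i * aff_val l (p i))"
proof -
  have "aff_val l (\<Sum>i\<in>T. u i *\<^sub>R p i) = (\<Sum>i\<in>T. u i * (fst l \<bullet> p i)) + sum u T * snd l"
    using assms by (simp add: aff_val_def inner_sum_right)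
  thus ?thesis by (simp add: aff_val_def distrib_left sum.distrib sum_distrib_right)
qed

lemma aff_val_unique:
  assumes S: "aff_dim S = 2" and eq: "\<And>x. x \<in> S \<Longrightarrow> aff_val l x = aff_val m x"
  shows "l = m"
proof -
  have "affine hull S = UNIV" using S aff_dim_eq_full[of S] by simp
  moreover have "S \<subseteq> {x. (fst l - fst m) \<bullet> x = snd m - snd l}"
    using eq by (force simp: aff_val_def inner_diff_left)
  hence "affine hull S \<subseteq> {x. (fst l - fst m) \<bullet> x = snd m - snd l}"
    by (rule hull_minimal) (rule affine_hyperplane)
  ultimately have *: "(fst l - fst m) \<bullet> x = snd m - snd l" for x by blast
  have "snd m = snd l" using *[of 0] by simp
  moreover have "fst l - fst m = 0" using *[of "fst l - fst m"] calculation by simp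
  ultimately show ?thesis by (simp add: prod_eq_iff)
qed

text \<open>A small step from \<open>x\<close> against a nonzero gradient would stay in
  \<open>Q\<close> and make \<open>l\<close> negative.\<close>

lemma aff_val_zero_interior:
  assumes nonneg: "\<And>y. y \<in> Q \<Longrightarrow> 0 \<le> aff_val l y" and x: "x \<in> interior Q" "aff_val l x = 0"
  shows "l = 0"
proof -
  obtain \<epsilon> where \<epsilon>: "\<epsilon> > 0" "cball x \<epsilon> \<subseteq> Q" using x(1) unfolding mem_interior_cball by blast
  have "fst l = 0"
  proof (rule ccontr)
    assume d: "fst l \<noteq> 0"
    define y where "y = x - (\<epsilon> / norm (fst l)) *\<^sub>R fst l"
    have "y \<in> cball x \<epsilon>" using d \<epsilon>(1) by (simp add: y_def dist_norm)
    hence "0 \<le> aff_val l y" using \<epsilon>(2) nonneg by blast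
    also have "aff_val l y = aff_val l x - (\<epsilon> / norm (fst l)) * (fst l \<bullet> fst l)"
      by (simp add: aff_val_def y_def inner_diff_right)
    also have "\<dots> < 0" using x(2) d \<epsilon>(1) by simp
    finally show False by simp
  qed
  moreover from this have "snd l = 0" using x(2) by (simp add: aff_val_def)
  ultimately show ?thesis by (metis prod.collapse zero_prod_def)
qed

lemma interior_nonempty_of_aff_dim:
  fixes Q :: "(real \<times> real) set"
  assumes "convex Q" "aff_dim Q = 2"
  shows "interior Q \<noteq> {}"
proof -
  have "affine hull Q = UNIV" using assms(2) aff_dim_eq_full[of Q] by simp
  hence "rel_interior Q = interior Q" by (rule rel_interior_interior)
  moreover have "Q \<noteq> {}" using assms(2) by auto
  ultimately show ?thesis using assms(1) rel_interior_eq_empty by metis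
qed

locale polygon =
  fixes \<Delta> :: "(real \<times> real) set" and e :: "'n::finite \<Rightarrow> int \<times> int"
  assumes lattice_polygon: "lattice_polygon \<Delta>" and aff_dim_\<Delta>: "aff_dim \<Delta> = 2"
    and enum: "bij_betw e UNIV (lattice_points \<Delta>)"
begin

definition pt :: "'n \<Rightarrow> real \<times> real" where "pt i = of_lattice (e i)"

lemma inj_e: "inj e" using enum by (simp add: bij_betw_def)

lemma inj_of_lattice: "inj of_lattice"
  by (auto simp: inj_def of_lattice_def prod_eq_iff)

lemma inj_pt: "inj pt"
  using inj_compose[OF inj_of_lattice inj_e] by (simp add: pt_def[abs_def] o_def)

lemma polygon_eq_hull: "\<Delta> = convex hull (range pt)"
proof
  obtain V where V: "\<Delta> = convex hull (of_lattice ` V)"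
    using lattice_polygon unfolding lattice_polygon_def by blast
  have "of_lattice ` V \<subseteq> range pt"
  proof (rule image_subsetI)
    fix v assume "v \<in> V"
    hence "of_lattice v \<in> \<Delta>" unfolding V by (intro hull_inc imageI)
    hence "v \<in> range e" using enum by (auto simp: bij_betw_def lattice_points_def)
    thus "of_lattice v \<in> range pt" by (auto simp: pt_def)
  qed
  thus "\<Delta> \<subseteq> convex hull (range pt)" unfolding V by (rule hull_mono)
  have "pt i \<in> \<Delta>" for i using enum by (auto simp: bij_betw_def lattice_points_def pt_def)
  thus "convex hull (range pt) \<subseteq> \<Delta>" by (intro hull_minimal) (auto simp: V)
qed

lemma pt_in: "pt i \<in> \<Delta>" unfolding polygon_eq_hull by (intro hull_inc) simp

lemma convex_\<Delta>: "convex \<Delta>" unfolding polygon_eq_hull by (rule convex_convex_hull)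

lemma aff_dim_pts: "aff_dim (range pt) = 2"
  using aff_dim_\<Delta> unfolding polygon_eq_hull by (simp add: aff_dim_convex_hull)

lemma hull_pts_subset: "convex hull (pt ` T) \<subseteq> \<Delta>"
  unfolding polygon_eq_hull by (rule hull_mono) blast

lemma in_hull_ptsE:
  assumes "x \<in> convex hull (pt ` T)"
  obtains u where "\<And>i. i \<in> T \<Longrightarrow> 0 \<le> u i" "sum u T = 1" "x = (\<Sum>i\<in>T. u i *\<^sub>R pt i)"
proof -
  have fin: "finite (pt ` T)" by simp
  obtain w where w: "\<forall>y\<in>pt ` T. 0 \<le> w y" "sum w (pt ` T) = 1" "(\<Sum>y\<in>pt ` T. w y *\<^sub>R y) = x"
    using assms unfolding convex_hull_finite[OF fin] by blast
  have inj: "inj_on pt T" using inj_pt by (rule inj_on_subset) simp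
  show ?thesis
    by (rule that[of "\<lambda>i. w (pt i)"]) (use w in \<open>auto simp: sum.reindex[OF inj] o_def\<close>)
qed

lemma in_hull_ptsI:
  assumes "\<And>i. i \<in> T \<Longrightarrow> 0 \<le> u i" "sum u T = 1"
  shows "(\<Sum>i\<in>T. u i *\<^sub>R pt i) \<in> convex hull (pt ` T)"
  by (rule convex_sum) (use assms in \<open>auto intro: hull_inc\<close>)

lemma aff_val_nonpos_on_polygon:
  assumes "\<And>i. aff_val g (pt i) \<le> 0" "x \<in> \<Delta>"
  shows "aff_val g x \<le> 0"
proof -
  obtain u where u: "\<And>i. 0 \<le> u i" "sum u UNIV = 1" "x = (\<Sum>i\<in>UNIV. u i *\<^sub>R pt i)"
    using in_hull_ptsE[of x UNIV] assms(2) unfolding polygon_eq_hull by (metis UNIV_I)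
  show ?thesis unfolding u(3) aff_val_convex_sum[OF u(2)]
    by (intro sum_nonpos mult_nonneg_nonpos u assms(1))
qed

section \<open>Majorants and facets of the upper hull\<close>

definition majorant :: "real ^ 'n \<Rightarrow> (real \<times> real) \<times> real \<Rightarrow> bool" where
  "majorant \<omega> l \<longleftrightarrow> (\<forall>i. \<omega> $ i \<le> aff_val l (pt i))"

definition contact :: "real ^ 'n \<Rightarrow> (real \<times> real) \<times> real \<Rightarrow> 'n set" where
  "contact \<omega> l = {i. \<omega> $ i = aff_val l (pt i)}"

text \<open>A facet of the upper hull of the graph of \<open>\<omega>\<close> is represented by the affine function whose graph
  contains it.\<close>

definition facet :: "real ^ 'n \<Rightarrow> (real \<times> real) \<times> real \<Rightarrow> bool" where
  "facet \<omega> l \<longleftrightarrow> majorant \<omega> l \<and> aff_dim (pt ` contact \<omega> l) = 2"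

abbreviation cell :: "real ^ 'n \<Rightarrow> (real \<times> real) \<times> real \<Rightarrow> (real \<times> real) set" where
  "cell \<omega> l \<equiv> convex hull (pt ` contact \<omega> l)"

lemma aff_dim_pts_le: "aff_dim (pt ` T) \<le> 2"
  using aff_dim_subset[of "pt ` T" "range pt"] aff_dim_pts by auto

lemma facet_mono:
  assumes "facet \<omega> l" "majorant \<phi> m" "contact \<omega> l \<subseteq> contact \<phi> m"
  shows "facet \<phi> m"
  using assms aff_dim_subset[of "pt ` contact \<omega> l" "pt ` contact \<phi> m"] aff_dim_pts_le[of "contact \<phi> m"]
  by (auto simp: facet_def)



text \<open>A facet is determined by its contact set, whose points affinely span the plane, and
  there are finitely many index sets.\<close>

lemma finite_facets: "finite {l. facet \<omega> l}"
proof (rule finite_imageD)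
  show "finite (contact \<omega> ` {l. facet \<omega> l})" by (rule finite_subset[OF subset_UNIV]) simp
  show "inj_on (contact \<omega>) {l. facet \<omega> l}"
  proof (rule inj_onI)
    fix l m assume "l \<in> {l. facet \<omega> l}" "m \<in> {l. facet \<omega> l}" and eq: "contact \<omega> l = contact \<omega> m"
    hence "aff_dim (pt ` contact \<omega> l) = 2" by (simp add: facet_def)
    moreover have "aff_val l x = aff_val m x" if x: "x \<in> pt ` contact \<omega> l" for x
    proof -
      obtain i where "x = pt i" "i \<in> contact \<omega> l" "i \<in> contact \<omega> m" using x eq by blast
      thus ?thesis by (simp add: contact_def)
    qed
    ultimately show "l = m" by (rule aff_val_unique)
  qed
qed

text \<open>A majorant whose contact points lie on a line is tilted about that line, without rising
  at \<open>x\<close>, until it touches the graph at a further index. The contact set grows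
  strictly, so finitely many tilts reach a facet.\<close>

lemma tilt_to_facet:
  assumes "majorant \<omega> l" "x \<in> \<Delta>"
  shows "\<exists>l'. facet \<omega> l' \<and> aff_val l' x \<le> aff_val l x"
  using assms(1)
proof (induction "card (- contact \<omega> l)" arbitrary: l rule: less_induct)
  case less
  show ?case
  proof (cases "facet \<omega> l")
    case False
    hence "aff_dim (pt ` contact \<omega> l) < 2"
      using less.prems aff_dim_pts_le[of "contact \<omega> l"] by (auto simp: facet_def)
    hence "aff_dim (pt ` contact \<omega> l) < int DIM(real \<times> real)" by simp
    then obtain a b where ab: "a \<noteq> 0" "pt ` contact \<omega> l \<subseteq> {x. a \<bullet> x = b}"
      by (rule aff_lowdim_subset_hyperplane)
    define g0 :: "(real \<times> real) \<times> real" where "g0 = (a, - b)"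
    have g0: "g0 \<noteq> 0" "\<And>i. i \<in> contact \<omega> l \<Longrightarrow> aff_val g0 (pt i) = 0"
      using ab by (auto simp: g0_def aff_val_def zero_prod_def)
    define g1 where "g1 = (if aff_val g0 x \<ge> 0 then g0 else - g0)"
    have g1: "g1 \<noteq> 0" "\<And>i. i \<in> contact \<omega> l \<Longrightarrow> aff_val g1 (pt i) = 0" "aff_val g1 x \<ge> 0"
      using g0 by (auto simp: g1_def aff_val_uminus)
    \<comment> \<open>The tilt is stopped by an index where \<open>g\<close> is positive. If
      \<open>g1\<close> is positive at no lattice point, it is nonpositive on the polygon, hence 0
      at \<open>x\<close>, and its negative can be taken.\<close>
    have "\<exists>g. (\<forall>i\<in>contact \<omega> l. aff_val g (pt i) = 0) \<and> aff_val g x \<ge> 0 \<and> (\<exists>i. aff_val g (pt i) > 0)"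
    proof (cases "\<exists>i. aff_val g1 (pt i) > 0")
      case True
      thus ?thesis using g1 by blast
    next
      case False
      hence le: "aff_val g1 (pt i) \<le> 0" for i by (simp add: not_less)
      have "aff_val g1 x = 0" using aff_val_nonpos_on_polygon[OF le assms(2)] g1(3) by simp
      moreover have "\<exists>i. aff_val g1 (pt i) \<noteq> 0"
      proof (rule ccontr)
        assume "\<not> ?thesis"
        hence "g1 = 0" by (intro aff_val_unique[OF aff_dim_pts]) (auto simp: aff_val_def)
        thus False using g1(1) by simp
      qed
      then obtain i where "aff_val (- g1) (pt i) > 0" using le by (metis aff_val_uminus neg_0_less_iff_less order_le_less)
      ultimately show ?thesis using g1(2) by (intro exI[of _ "- g1"]) (auto simp: aff_val_uminus)
    qed
    then obtain g where g: "\<And>i. i \<in> contact \<omega> l \<Longrightarrow> aff_val g (pt i) = 0" "aff_val g x \<ge> 0"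
      and pos: "\<exists>i. aff_val g (pt i) > 0" by blast
    \<comment> \<open>The minimum of these ratios is the largest \<open>s\<close> for which
      \<open>l - s *\<^sub>R g\<close> is still a majorant; contact is gained where it is
      attained.\<close>
    define R where "R = (\<lambda>i. (aff_val l (pt i) - \<omega> $ i) / aff_val g (pt i)) ` {i. aff_val g (pt i) > 0}"
    define s where "s = Min R"
    have R: "finite R" "R \<noteq> {}" using pos by (auto simp: R_def)
    have "s \<in> R" unfolding s_def by (rule Min_in[OF R])
    then obtain j where j: "aff_val g (pt j) > 0" "s = (aff_val l (pt j) - \<omega> $ j) / aff_val g (pt j)"
      by (auto simp: R_def)
    have s_le: "s * aff_val g (pt i) \<le> aff_val l (pt i) - \<omega> $ i" if "aff_val g (pt i) > 0" for i
    proof -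
      have "s \<le> (aff_val l (pt i) - \<omega> $ i) / aff_val g (pt i)"
        unfolding s_def using that R(1) by (intro Min_le) (auto simp: R_def)
      thus ?thesis using that by (simp add: pos_le_divide_eq)
    qed
    have s0: "s \<ge> 0" using j less.prems by (simp add: majorant_def)
    define l' where "l' = l - s *\<^sub>R g"
    have l': "aff_val l' y = aff_val l y - s * aff_val g y" for y
      by (simp add: l'_def aff_val_diff aff_val_scaleR)
    have maj: "majorant \<omega> l'"
      unfolding majorant_def
    proof
      fix i
      show "\<omega> $ i \<le> aff_val l' (pt i)"
      proof (cases "aff_val g (pt i) > 0")
        case True
        thus ?thesis using s_le[OF True] by (simp add: l')
      next
        case False
        hence "s * aff_val g (pt i) \<le> 0" using s0 by (intro mult_nonneg_nonpos) auto
        thus ?thesis using less.prems unfolding majorant_def l' by (smt (verit))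
      qed
    qed
    have "contact \<omega> l \<subseteq> contact \<omega> l'" using g(1) by (auto simp: contact_def l')
    moreover have "j \<in> contact \<omega> l'" "j \<notin> contact \<omega> l" using j g(1)[of j] by (auto simp: contact_def l')
    ultimately have "- contact \<omega> l' \<subset> - contact \<omega> l" by blast
    hence "card (- contact \<omega> l') < card (- contact \<omega> l)" by (intro psubset_card_mono) auto
    from less.hyps[OF this maj] obtain l'' where "facet \<omega> l''" "aff_val l'' x \<le> aff_val l' x" by blast
    moreover have "aff_val l' x \<le> aff_val l x" using s0 g(2) by (simp add: l')
    ultimately show ?thesis by (meson order_trans)
  qed (use less.prems in blast)
qed

lemma majorant_exists: "\<exists>l. majorant \<omega> l"
proof -
  have "\<omega> $ i \<le> Max (range (\<lambda>i. \<omega> $ i))" for i by (rule Max_ge) auto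
  hence "majorant \<omega> (0, Max (range (\<lambda>i. \<omega> $ i)))" by (simp add: majorant_def aff_val_const)
  thus ?thesis ..
qed

text \<open>The facet lowest at \<open>x\<close> works: if its cell missed \<open>x\<close>, a line
  separating \<open>x\<close> from the cell would allow tilting it slightly to a majorant that is
  lower at \<open>x\<close>.\<close>

lemma facet_over_point:
  assumes x: "x \<in> \<Delta>"
  obtains l where "facet \<omega> l" "x \<in> cell \<omega> l" "\<And>m. majorant \<omega> m \<Longrightarrow> aff_val l x \<le> aff_val m x"
proof -
  let ?F = "{l. facet \<omega> l}"
  have "?F \<noteq> {}" using majorant_exists[of \<omega>] tilt_to_facet x by blast
  hence "Min ((\<lambda>l. aff_val l x) ` ?F) \<in> (\<lambda>l. aff_val l x) ` ?F"
    by (intro Min_in finite_imageI finite_facets) auto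
  then obtain l where l: "facet \<omega> l" and eq: "aff_val l x = Min ((\<lambda>l. aff_val l x) ` ?F)" by auto
  have least: "aff_val l x \<le> aff_val l' x" if "facet \<omega> l'" for l'
    unfolding eq using that by (intro Min_le finite_imageI finite_facets) auto
  have min: "aff_val l x \<le> aff_val m x" if "majorant \<omega> m" for m
    using tilt_to_facet[OF that x] least by (meson order_trans)
  have "x \<in> cell \<omega> l"
  proof (rule ccontr)
    assume nx: "x \<notin> cell \<omega> l"
    have "closed (cell \<omega> l)" by (intro compact_imp_closed finite_imp_compact_convex_hull) simp
    then obtain a b where ab: "a \<bullet> x < b" "\<And>y. y \<in> cell \<omega> l \<Longrightarrow> a \<bullet> y > b"
      using separating_hyperplane_closed_point[OF convex_convex_hull _ nx] by blast
    define g :: "(real \<times> real) \<times> real" where "g = (- a, b)"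
    have gx: "aff_val g x > 0" and gT: "\<And>i. i \<in> contact \<omega> l \<Longrightarrow> aff_val g (pt i) < 0"
    proof -
      show "aff_val g x > 0" using ab(1) by (simp add: g_def aff_val_def)
      fix i assume "i \<in> contact \<omega> l"
      hence "a \<bullet> pt i > b" by (intro ab(2) hull_inc imageI)
      thus "aff_val g (pt i) < 0" by (simp add: g_def aff_val_def)
    qed
    \<comment> \<open>The tilt is limited by the gaps at the indices without contact. Adding 1 keeps
      the denominators positive, and the inserted 1 covers the case of no such index.\<close>
    define R where "R = insert 1 ((\<lambda>i. (aff_val l (pt i) - \<omega> $ i) / (\<bar>aff_val g (pt i)\<bar> + 1)) ` (- contact \<omega> l))"
    define \<epsilon> where "\<epsilon> = Min R"
    have R: "finite R" by (simp add: R_def)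
    have maj: "\<omega> $ i \<le> aff_val l (pt i)" for i using l by (simp add: facet_def majorant_def)
    have "r > 0" if "r \<in> R" for r
    proof -
      have "aff_val l (pt i) - \<omega> $ i > 0" if "i \<notin> contact \<omega> l" for i
        using maj[of i] that by (auto simp: contact_def)
      thus ?thesis using that by (auto simp: R_def intro!: divide_pos_pos)
    qed
    hence \<epsilon>0: "\<epsilon> > 0" unfolding \<epsilon>_def using R by (subst Min_gr_iff) (auto simp: R_def)
    have "majorant \<omega> (l - \<epsilon> *\<^sub>R g)"
      unfolding majorant_def
    proof
      fix i
      show "\<omega> $ i \<le> aff_val (l - \<epsilon> *\<^sub>R g) (pt i)"
      proof (cases "i \<in> contact \<omega> l")
        case True
        hence "\<epsilon> * aff_val g (pt i) \<le> 0" using gT[OF True] \<epsilon>0 by (intro mult_nonneg_nonpos) auto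
        thus ?thesis using maj[of i] by (simp add: aff_val_diff aff_val_scaleR)
      next
        case False
        have "\<epsilon> \<le> (aff_val l (pt i) - \<omega> $ i) / (\<bar>aff_val g (pt i)\<bar> + 1)"
          unfolding \<epsilon>_def using False R by (intro Min_le) (auto simp: R_def)
        hence "\<epsilon> * (\<bar>aff_val g (pt i)\<bar> + 1) \<le> aff_val l (pt i) - \<omega> $ i"
          by (simp add: pos_le_divide_eq)
        moreover have "\<epsilon> * aff_val g (pt i) \<le> \<epsilon> * (\<bar>aff_val g (pt i)\<bar> + 1)"
          using \<epsilon>0 by (intro mult_left_mono) auto
        ultimately show ?thesis by (simp add: aff_val_diff aff_val_scaleR)
      qed
    qed
    from min[OF this] show False using mult_pos_pos[OF \<epsilon>0 gx] by (simp add: aff_val_diff aff_val_scaleR)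
  qed
  thus ?thesis using that l min by blast
qed

section \<open>The concave hull and its domains of linearity\<close>

lemma concave_hull_eq:
  assumes "majorant \<omega> l" "x \<in> cell \<omega> l"
  shows "concave_hull e \<omega> x = aff_val l x"
  unfolding concave_hull_def
proof (rule Greatest_equality)
  obtain u where u: "\<And>i. i \<in> contact \<omega> l \<Longrightarrow> 0 \<le> u i" "sum u (contact \<omega> l) = 1"
    "x = (\<Sum>i\<in>contact \<omega> l. u i *\<^sub>R pt i)" using in_hull_ptsE[OF assms(2)] by blast
  have "(\<Sum>i\<in>contact \<omega> l. u i *\<^sub>R (pt i, \<omega> $ i)) \<in> subgraph_hull e \<omega>"
    unfolding subgraph_hull_def
    by (rule convex_sum) (use u in \<open>auto intro!: hull_inc simp: pt_def\<close>)
  also have "(\<Sum>i\<in>contact \<omega> l. u i *\<^sub>R (pt i, \<omega> $ i)) = (x, aff_val l x)"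
    unfolding u(3) aff_val_convex_sum[OF u(2)]
    by (auto simp: prod_eq_iff fst_sum snd_sum contact_def intro!: sum.cong)
  finally show "(x, aff_val l x) \<in> subgraph_hull e \<omega>" .
next
  fix y assume y: "(x, y) \<in> subgraph_hull e \<omega>"
  \<comment> \<open>The half space below the graph of \<open>l\<close> is convex and contains the
    generators of the hull.\<close>
  have "subgraph_hull e \<omega> \<subseteq> {p. (- fst l, 1) \<bullet> p \<le> snd l}"
    unfolding subgraph_hull_def
  proof (rule hull_minimal)
    show "{(of_lattice (e i), y) |i y. y \<le> \<omega> $ i} \<subseteq> {p. (- fst l, 1) \<bullet> p \<le> snd l}"
    proof
      fix p assume "p \<in> {(of_lattice (e i), y) |i y. y \<le> \<omega> $ i}"
      then obtain i y where p: "p = (pt i, y)" and "y \<le> \<omega> $ i" by (auto simp: pt_def)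
      note this(2)
      also have "\<omega> $ i \<le> aff_val l (pt i)" using assms(1) by (simp add: majorant_def)
      finally show "p \<in> {p. (- fst l, 1) \<bullet> p \<le> snd l}" by (simp add: p aff_val_def inner_prod_def)
    qed
  qed (rule convex_halfspace_le)
  thus "y \<le> aff_val l x" using y by (auto simp: aff_val_def inner_prod_def)
qed

lemma concave_hull_le:
  assumes "majorant \<omega> l" "x \<in> \<Delta>"
  shows "concave_hull e \<omega> x \<le> aff_val l x"
proof -
  obtain l0 where "facet \<omega> l0" "x \<in> cell \<omega> l0" "\<And>m. majorant \<omega> m \<Longrightarrow> aff_val l0 x \<le> aff_val m x"
    using facet_over_point[OF assms(2)] by blast
  thus ?thesis using concave_hull_eq[of \<omega> l0 x] assms(1) by (simp add: facet_def)
qed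

text \<open>For the converse, \<open>x\<close> is a convex combination of contact points of a facet
  over \<open>x\<close>. At these points the gaps between \<open>l\<close> and \<omega> are
  nonnegative with weighted sum 0, so only points in contact with \<open>l\<close> carry
  weight.\<close>

lemma in_cell_iff:
  assumes l: "majorant \<omega> l"
  shows "x \<in> cell \<omega> l \<longleftrightarrow> x \<in> \<Delta> \<and> concave_hull e \<omega> x = aff_val l x"
proof
  assume "x \<in> cell \<omega> l"
  thus "x \<in> \<Delta> \<and> concave_hull e \<omega> x = aff_val l x" using concave_hull_eq[OF l] hull_pts_subset by blast
next
  assume x: "x \<in> \<Delta> \<and> concave_hull e \<omega> x = aff_val l x"
  obtain l0 where l0: "facet \<omega> l0" "x \<in> cell \<omega> l0" using facet_over_point x by blast
  have fx: "concave_hull e \<omega> x = aff_val l0 x" using concave_hull_eq l0 by (simp add: facet_def)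
  let ?T = "contact \<omega> l0"
  obtain u where u: "\<And>i. i \<in> ?T \<Longrightarrow> 0 \<le> u i" "sum u ?T = 1" "x = (\<Sum>i\<in>?T. u i *\<^sub>R pt i)"
    using in_hull_ptsE[OF l0(2)] by blast
  have nonneg: "0 \<le> u i * (aff_val l (pt i) - \<omega> $ i)" if "i \<in> ?T" for i
    using u(1)[OF that] l by (simp add: majorant_def)
  have "(\<Sum>i\<in>?T. u i * (aff_val l (pt i) - \<omega> $ i)) = aff_val l x - (\<Sum>i\<in>?T. u i * \<omega> $ i)"
    unfolding u(3) aff_val_convex_sum[OF u(2)] by (simp add: right_diff_distrib sum_subtractf)
  also have "(\<Sum>i\<in>?T. u i * \<omega> $ i) = aff_val l0 x"
    unfolding u(3) aff_val_convex_sum[OF u(2)] by (intro sum.cong) (auto simp: contact_def)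
  finally have "(\<Sum>i\<in>?T. u i * (aff_val l (pt i) - \<omega> $ i)) = 0" using x fx by simp
  hence zero: "\<forall>i\<in>?T. u i * (aff_val l (pt i) - \<omega> $ i) = 0"
    using nonneg by (subst (asm) sum_nonneg_eq_0_iff) auto
  hence u0: "u i = 0" if "i \<in> ?T - contact \<omega> l" for i using that by (auto simp: contact_def)
  have "sum u (?T \<inter> contact \<omega> l) = sum u ?T"
    by (rule sum.mono_neutral_left) (use u0 in auto)
  moreover have "(\<Sum>i\<in>?T \<inter> contact \<omega> l. u i *\<^sub>R pt i) = x"
    unfolding u(3) by (rule sum.mono_neutral_left) (use u0 in auto)
  ultimately have "x \<in> convex hull (pt ` (?T \<inter> contact \<omega> l))"
    using in_hull_ptsI[of "?T \<inter> contact \<omega> l" u] u(1,2) by simp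
  thus "x \<in> cell \<omega> l" using hull_mono[of "pt ` (?T \<inter> contact \<omega> l)" "pt ` contact \<omega> l"] by blast
qed

lemma concave_hull_concave:
  assumes "x \<in> \<Delta>" "y \<in> \<Delta>" "0 \<le> t" "t \<le> 1"
  shows "(1 - t) * concave_hull e \<omega> x + t * concave_hull e \<omega> y \<le> concave_hull e \<omega> ((1 - t) *\<^sub>R x + t *\<^sub>R y)"
proof -
  let ?z = "(1 - t) *\<^sub>R x + t *\<^sub>R y"
  have z: "?z \<in> \<Delta>" using convexD_alt[OF convex_\<Delta> assms] .
  obtain l where l: "facet \<omega> l" "?z \<in> cell \<omega> l" using facet_over_point[OF z] by blast
  have maj: "majorant \<omega> l" using l by (simp add: facet_def)
  have "(1 - t) * concave_hull e \<omega> x + t * concave_hull e \<omega> y \<le> (1 - t) * aff_val l x + t * aff_val l y"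
    using concave_hull_le[OF maj] assms by (intro add_mono mult_left_mono) auto
  also have "\<dots> = aff_val l ?z" by (simp add: aff_val_def algebra_simps)
  also have "\<dots> = concave_hull e \<omega> ?z" using concave_hull_eq[OF maj l(2)] by simp
  finally show ?thesis .
qed

lemma linearity_domain_cell:
  assumes "facet \<omega> l"
  shows "linearity_domain \<Delta> (concave_hull e \<omega>) (cell \<omega> l)"
  unfolding linearity_domain_def
proof (intro conjI allI impI)
  have maj: "majorant \<omega> l" using assms by (simp add: facet_def)
  show "cell \<omega> l \<subseteq> \<Delta>" by (rule hull_pts_subset)
  show "convex (cell \<omega> l)" by simp
  show dim: "aff_dim (cell \<omega> l) = 2" using assms by (simp add: facet_def aff_dim_convex_hull)
  show "affine_on (cell \<omega> l) (concave_hull e \<omega>)"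
    unfolding affine_on_def using concave_hull_eq[OF maj]
    by (intro exI[of _ "fst l"] exI[of _ "snd l"]) (simp add: aff_val_def)
  fix Q assume Q: "cell \<omega> l \<subseteq> Q \<and> Q \<subseteq> \<Delta> \<and> convex Q \<and> affine_on Q (concave_hull e \<omega>)"
  then obtain u c where "\<forall>x\<in>Q. concave_hull e \<omega> x = u \<bullet> x + c" unfolding affine_on_def by blast
  hence m: "concave_hull e \<omega> x = aff_val (u, c) x" if "x \<in> Q" for x using that by (simp add: aff_val_def)
  have "l = (u, c)"
    by (rule aff_val_unique[OF dim]) (use m Q concave_hull_eq[OF maj] in fastforce)
  hence "Q \<subseteq> cell \<omega> l" using in_cell_iff[OF maj] m Q by auto
  thus "Q = cell \<omega> l" using Q by blast
qed

text \<open>The affine function \<open>l\<close> on \<open>P\<close> must be shown to be a majorant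
  at every lattice point \<open>a\<close>. An interior point \<open>p\<close> of \<open>P\<close>
  lies between \<open>a\<close> and some \<open>q\<close> in \<open>P\<close>, and concavity along
  this segment bounds the hull at \<open>a\<close> by \<open>l\<close>. Maximality of
  \<open>P\<close> then identifies it with the cell.\<close>

lemma linearity_domainE:
  assumes P: "linearity_domain \<Delta> (concave_hull e \<omega>) P"
  obtains l where "facet \<omega> l" "P = cell \<omega> l"
proof -
  from P have sub: "P \<subseteq> \<Delta>" and conv: "convex P" and dim: "aff_dim P = 2"
    and aff: "affine_on P (concave_hull e \<omega>)"
    and max: "\<And>Q. P \<subseteq> Q \<Longrightarrow> Q \<subseteq> \<Delta> \<Longrightarrow> convex Q \<Longrightarrow> affine_on Q (concave_hull e \<omega>) \<Longrightarrow> Q = P"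
    unfolding linearity_domain_def by auto
  obtain u c where "\<forall>x\<in>P. concave_hull e \<omega> x = u \<bullet> x + c" using aff unfolding affine_on_def by blast
  define l where "l = (u, c)"
  have l: "concave_hull e \<omega> x = aff_val l x" if "x \<in> P" for x
    using that \<open>\<forall>x\<in>P. _\<close> by (simp add: aff_val_def l_def)
  obtain p where p: "p \<in> interior P" using interior_nonempty_of_aff_dim[OF conv dim] by blast
  obtain \<epsilon> where \<epsilon>: "\<epsilon> > 0" "cball p \<epsilon> \<subseteq> P" using p unfolding mem_interior_cball by blast
  have pP: "p \<in> P" using p interior_subset by blast
  have hull_le: "\<omega> $ i \<le> concave_hull e \<omega> (pt i)" for i
  proof -
    obtain l0 where "facet \<omega> l0" "pt i \<in> cell \<omega> l0" using facet_over_point[OF pt_in] by blast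
    thus ?thesis using concave_hull_eq[of \<omega> l0 "pt i"] by (simp add: facet_def majorant_def)
  qed
  have "majorant \<omega> l"
    unfolding majorant_def
  proof
    fix i
    define a where "a = pt i"
    define t where "t = min 1 (\<epsilon> / (norm (a - p) + 1))"
    have t: "0 < t" "t \<le> 1" using \<epsilon>(1) by (auto simp: t_def add_nonneg_pos)
    \<comment> \<open>Beyond \<open>p\<close> on the ray from \<open>a\<close>, at distance at most
      \<epsilon> from \<open>p\<close>.\<close>
    define q where "q = (1 - t) *\<^sub>R p + t *\<^sub>R (2 *\<^sub>R p - a)"
    have q_eq: "q = p - t *\<^sub>R (a - p)" by (simp add: q_def algebra_simps scaleR_2)
    have "norm (t *\<^sub>R (a - p)) \<le> \<epsilon>"
    proof -
      have "t * norm (a - p) \<le> t * (norm (a - p) + 1)" using t by (intro mult_left_mono) auto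
      also have "\<dots> \<le> \<epsilon> / (norm (a - p) + 1) * (norm (a - p) + 1)"
        by (intro mult_right_mono) (auto simp: t_def)
      also have "\<dots> = \<epsilon>" by (smt (verit) norm_ge_zero nonzero_eq_divide_eq)
      finally show ?thesis using t by simp
    qed
    hence "q \<in> P" using \<epsilon>(2) unfolding q_eq by (intro subsetD[OF \<epsilon>(2)]) (simp add: dist_norm)
    \<comment> \<open>The position of \<open>p\<close> on the segment from \<open>q\<close> to
      \<open>a\<close>.\<close>
    define \<sigma> where "\<sigma> = t / (1 + t)"
    have \<sigma>: "0 < \<sigma>" "\<sigma> \<le> 1" using t by (auto simp: \<sigma>_def)
    have "p = (1 - \<sigma>) *\<^sub>R q + \<sigma> *\<^sub>R a"
    proof -
      have "(1 + t) *\<^sub>R ((1 - \<sigma>) *\<^sub>R q + \<sigma> *\<^sub>R a) = ((1 + t) * (1 - \<sigma>)) *\<^sub>R q + ((1 + t) * \<sigma>) *\<^sub>R a"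
        by (simp add: scaleR_add_right)
      also have "(1 + t) * (1 - \<sigma>) = 1" using t by (simp add: \<sigma>_def field_simps)
      also have "(1 + t) * \<sigma> = t" using t by (simp add: \<sigma>_def)
      also have "1 *\<^sub>R q + t *\<^sub>R a = (1 + t) *\<^sub>R p" by (simp add: q_eq algebra_simps)
      finally show ?thesis using t by simp
    qed
    moreover have "(1 - \<sigma>) * concave_hull e \<omega> q + \<sigma> * concave_hull e \<omega> a \<le> concave_hull e \<omega> ((1 - \<sigma>) *\<^sub>R q + \<sigma> *\<^sub>R a)"
      using \<open>q \<in> P\<close> sub \<sigma> pt_in by (intro concave_hull_concave) (auto simp: a_def)
    ultimately have "(1 - \<sigma>) * aff_val l q + \<sigma> * concave_hull e \<omega> a \<le> aff_val l ((1 - \<sigma>) *\<^sub>R q + \<sigma> *\<^sub>R a)"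
      using l[OF \<open>q \<in> P\<close>] l[OF pP] by simp
    also have "\<dots> = (1 - \<sigma>) * aff_val l q + \<sigma> * aff_val l a" by (simp add: aff_val_def algebra_simps)
    finally have "concave_hull e \<omega> a \<le> aff_val l a" using \<sigma> by simp
    thus "\<omega> $ i \<le> aff_val l (pt i)" using hull_le[of i] by (simp add: a_def)
  qed
  hence P_sub: "P \<subseteq> cell \<omega> l" using in_cell_iff l sub by blast
  have eq: "cell \<omega> l = P"
  proof (rule max[OF P_sub hull_pts_subset])
    show "affine_on (cell \<omega> l) (concave_hull e \<omega>)"
      unfolding affine_on_def using concave_hull_eq[OF \<open>majorant \<omega> l\<close>]
      by (intro exI[of _ "fst l"] exI[of _ "snd l"]) (simp add: aff_val_def)
  qed simp
  have "aff_dim (pt ` contact \<omega> l) = 2" using dim unfolding eq[symmetric] by (simp add: aff_dim_convex_hull)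
  thus ?thesis using that[of l] eq \<open>majorant \<omega> l\<close> by (simp add: facet_def)
qed

text \<open>A lattice point of a cell is marked exactly if \<omega> meets the affine function of the
  cell there, so the polygon and its marks are both read off from the contact set.\<close>

lemma induced_subdivision_eq:
  "induced_subdivision \<Delta> e \<omega> = {(cell \<omega> l, e ` contact \<omega> l) | l. facet \<omega> l}"
proof -
  have marks: "{e i |i. of_lattice (e i) \<in> cell \<omega> l \<and> concave_hull e \<omega> (of_lattice (e i)) = \<omega> $ i} = e ` contact \<omega> l"
    if "facet \<omega> l" for l
  proof -
    have maj: "majorant \<omega> l" using that by (simp add: facet_def)
    have "pt i \<in> cell \<omega> l \<and> concave_hull e \<omega> (pt i) = \<omega> $ i \<longleftrightarrow> i \<in> contact \<omega> l" for i
    proof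
      assume "i \<in> contact \<omega> l"
      hence "pt i \<in> cell \<omega> l" by (intro hull_inc imageI)
      thus "pt i \<in> cell \<omega> l \<and> concave_hull e \<omega> (pt i) = \<omega> $ i"
        using concave_hull_eq[OF maj] \<open>i \<in> contact \<omega> l\<close> by (simp add: contact_def)
    next
      assume "pt i \<in> cell \<omega> l \<and> concave_hull e \<omega> (pt i) = \<omega> $ i"
      thus "i \<in> contact \<omega> l" using concave_hull_eq[OF maj, of "pt i"] unfolding contact_def by simp
    qed
    thus ?thesis unfolding pt_def[symmetric] by auto
  qed
  show ?thesis
    unfolding induced_subdivision_def
    using marks linearity_domain_cell by (auto elim!: linearity_domainE) blast+
qed

end

section \<open>Secondary cones\<close>

context polygon
begin

text \<open>Membership of \<phi> in the secondary cone of the subdivision induced by \<omega>, freed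
  from polygons; see \<open>secondary_cone_eq\<close>. The majorant of \<phi> is itself a facet by
  \<open>facet_mono\<close>.\<close>

definition dominates :: "real ^ 'n \<Rightarrow> real ^ 'n \<Rightarrow> bool" where
  "dominates \<omega> \<phi> \<longleftrightarrow> (\<forall>l. facet \<omega> l \<longrightarrow> (\<exists>m. majorant \<phi> m \<and> contact \<omega> l \<subseteq> contact \<phi> m))"

lemma facet_majorant: "facet \<omega> l \<Longrightarrow> majorant \<omega> l"
  by (simp add: facet_def)

lemma aff_dim_cell: "facet \<omega> l \<Longrightarrow> aff_dim (cell \<omega> l) = 2"
  by (simp add: facet_def aff_dim_convex_hull)

lemma majorant_ge_on_cell:
  assumes "facet \<omega> l" "majorant \<omega> m" "x \<in> cell \<omega> l"
  shows "aff_val l x \<le> aff_val m x"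
  using concave_hull_eq[OF facet_majorant[OF assms(1)] assms(3)] concave_hull_le[OF assms(2)] hull_pts_subset assms(3)
  by fastforce

text \<open>On the cell of \<open>l\<close> the difference \<open>m - l\<close> is a nonnegative
  affine function with an interior zero.\<close>

lemma facet_eq_interior:
  assumes l: "facet \<omega> l" and m: "majorant \<omega> m" and x: "x \<in> interior (cell \<omega> l)" "x \<in> cell \<omega> m"
  shows "l = m"
proof -
  have "aff_val m x = aff_val l x"
    using in_cell_iff[OF m] in_cell_iff[OF facet_majorant[OF l]] x interior_subset by (metis subsetD)
  hence "m - l = 0"
    by (intro aff_val_zero_interior[OF _ x(1)]) (use majorant_ge_on_cell[OF l m] in \<open>auto simp: aff_val_diff\<close>)
  thus ?thesis by simp
qed

lemma facet_eq_subcell: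
  assumes "facet \<omega> l" "contact \<omega> l \<subseteq> contact \<phi> m'" "majorant \<phi> m'" "facet \<phi> m" "cell \<omega> l \<subseteq> cell \<phi> m"
  shows "m = m'"
proof (rule aff_val_unique[OF aff_dim_cell[OF assms(1)]])
  fix x assume x: "x \<in> cell \<omega> l"
  hence "x \<in> cell \<phi> m'" using hull_mono[OF image_mono[OF assms(2)], of convex pt] by blast
  thus "aff_val m x = aff_val m' x"
    using concave_hull_eq[OF assms(3)] concave_hull_eq[OF facet_majorant[OF assms(4)], of x] x assms(5) by auto
qed

text \<open>The difference \<open>m - l\<close> is nonnegative on the cell of \<open>l\<close>, and
  the intersection is its zero set there.\<close>

lemma cell_Int_face:
  assumes "facet \<omega> l" "facet \<omega> m"
  shows "cell \<omega> l \<inter> cell \<omega> m face_of cell \<omega> l"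
proof -
  have "cell \<omega> l \<inter> cell \<omega> m = cell \<omega> l \<inter> {x. (fst m - fst l) \<bullet> x = snd l - snd m}"
  proof (intro equalityI subsetI IntI)
    fix x assume x: "x \<in> cell \<omega> l \<inter> cell \<omega> m"
    hence "aff_val l x = aff_val m x"
      using concave_hull_eq[OF facet_majorant] assms by (metis IntD1 IntD2)
    thus "x \<in> {x. (fst m - fst l) \<bullet> x = snd l - snd m}" by (simp add: aff_val_def inner_diff_left)
  next
    fix x assume x: "x \<in> cell \<omega> l \<inter> {x. (fst m - fst l) \<bullet> x = snd l - snd m}"
    hence "aff_val l x = aff_val m x" by (simp add: aff_val_def inner_diff_left)
    thus "x \<in> cell \<omega> m" using x in_cell_iff[OF facet_majorant[OF assms(1)], of x] in_cell_iff[OF facet_majorant[OF assms(2)], of x] by simp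
  qed auto
  also have "\<dots> face_of cell \<omega> l"
  proof (rule face_of_Int_supporting_hyperplane_ge)
    fix x assume "x \<in> cell \<omega> l"
    from majorant_ge_on_cell[OF assms(1) facet_majorant[OF assms(2)] this]
    show "snd l - snd m \<le> (fst m - fst l) \<bullet> x" by (simp add: aff_val_def inner_diff_left)
  qed simp
  finally show ?thesis .
qed

lemma marked_polygon_cell:
  assumes "facet \<omega> l"
  shows "marked_polygon (cell \<omega> l, e ` contact \<omega> l)"
proof -
  have pt: "pt ` T = of_lattice ` e ` T" for T by (simp add: pt_def image_image)
  have "pt ` contact \<omega> l \<noteq> {}" using assms by (auto simp: facet_def)
  hence "lattice_polygon (cell \<omega> l)"
    unfolding lattice_polygon_def by (intro exI[of _ "e ` contact \<omega> l"]) (simp add: pt)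
  moreover have "e ` contact \<omega> l \<subseteq> lattice_points (cell \<omega> l)"
    by (auto simp: lattice_points_def pt_def intro!: hull_inc)
  moreover have "{x. x extreme_point_of cell \<omega> l} \<subseteq> of_lattice ` e ` contact \<omega> l"
    using extreme_point_of_convex_hull[of _ "pt ` contact \<omega> l"] unfolding pt by blast
  ultimately show ?thesis by (simp add: marked_polygon_def)
qed

lemma marks_Int:
  assumes "facet \<omega> l" "facet \<omega> m"
  shows "e ` contact \<omega> l \<inter> lattice_points (cell \<omega> l \<inter> cell \<omega> m) =
         e ` contact \<omega> m \<inter> lattice_points (cell \<omega> l \<inter> cell \<omega> m)"
proof -
  have "i \<in> contact \<omega> l \<longleftrightarrow> i \<in> contact \<omega> m" if "pt i \<in> cell \<omega> l" "pt i \<in> cell \<omega> m" for i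
  proof -
    have "aff_val l (pt i) = aff_val m (pt i)"
      using concave_hull_eq[OF facet_majorant[OF assms(1)] that(1)] concave_hull_eq[OF facet_majorant[OF assms(2)] that(2)] by simp
    thus ?thesis by (simp add: contact_def)
  qed
  thus ?thesis by (auto simp: lattice_points_def pt_def)
qed

text \<open>Over an interior point of a cell of \<omega>, the piece supplied by the refinement must
  be that cell itself; its marks are then marks of the surrounding cell of \<phi>.\<close>

lemma refines_imp_dominates:
  assumes "refines (induced_subdivision \<Delta> e \<omega>) (induced_subdivision \<Delta> e \<phi>)"
  shows "dominates \<omega> \<phi>"
  unfolding dominates_def
proof (intro allI impI)
  fix l assume l: "facet \<omega> l"
  obtain x where x: "x \<in> interior (cell \<omega> l)"
    using interior_nonempty_of_aff_dim[OF convex_convex_hull aff_dim_cell[OF l]] by blast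
  hence "x \<in> \<Delta>" using interior_subset hull_pts_subset by blast
  then obtain m where m: "facet \<phi> m" "x \<in> cell \<phi> m" using facet_over_point by blast
  let ?S = "{(Q, N) \<in> induced_subdivision \<Delta> e \<omega>. Q \<subseteq> cell \<phi> m}"
  have "(cell \<phi> m, e ` contact \<phi> m) \<in> induced_subdivision \<Delta> e \<phi>"
    unfolding induced_subdivision_eq using m(1) by blast
  hence sub: "is_subdivision ?S (cell \<phi> m, e ` contact \<phi> m)"
    using assms unfolding refines_def by blast
  hence "x \<in> \<Union>(fst ` ?S)" using m(2) by (simp add: is_subdivision_def)
  then obtain Q N where QN: "(Q, N) \<in> ?S" "x \<in> Q" by auto
  then obtain l' where l': "facet \<omega> l'" "Q = cell \<omega> l'" "N = e ` contact \<omega> l'"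
    unfolding induced_subdivision_eq by blast
  have "l = l'" by (rule facet_eq_interior[OF l facet_majorant[OF l'(1)] x]) (use QN l' in simp)
  have "N \<subseteq> e ` contact \<phi> m" using sub QN(1) unfolding is_subdivision_def by blast
  hence "contact \<omega> l \<subseteq> contact \<phi> m"
    unfolding l'(3) \<open>l = l'\<close> using inj_e by (simp add: inj_image_subset_iff)
  thus "\<exists>m. majorant \<phi> m \<and> contact \<omega> l \<subseteq> contact \<phi> m" using facet_majorant[OF m(1)] by blast
qed

text \<open>A cell of \<omega> containing an interior point of a cell \<open>P\<close> of \<phi>
  lies in \<open>P\<close>, since its majorant must be that of \<open>P\<close>. These cells cover
  the interior of \<open>P\<close>, and their finite union is closed, so they cover
  \<open>P\<close>.\<close>

lemma dominates_imp_refines: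
  assumes dom: "dominates \<omega> \<phi>"
  shows "refines (induced_subdivision \<Delta> e \<omega>) (induced_subdivision \<Delta> e \<phi>)"
  unfolding refines_def
proof (rule ballI, clarify)
  fix P M assume "(P, M) \<in> induced_subdivision \<Delta> e \<phi>"
  then obtain m where m: "facet \<phi> m" and P: "P = cell \<phi> m" and M: "M = e ` contact \<phi> m"
    unfolding induced_subdivision_eq by blast
  let ?S = "{(Q, N). (Q, N) \<in> induced_subdivision \<Delta> e \<omega> \<and> Q \<subseteq> P}"
  have elem: "\<exists>l. facet \<omega> l \<and> Q = cell \<omega> l \<and> N = e ` contact \<omega> l \<and> Q \<subseteq> P" if "(Q, N) \<in> ?S" for Q N
    using that unfolding induced_subdivision_eq by blast
  have contact_sub: "contact \<omega> l \<subseteq> contact \<phi> m" if l: "facet \<omega> l" "cell \<omega> l \<subseteq> P" for l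
  proof -
    obtain m' where m': "majorant \<phi> m'" "contact \<omega> l \<subseteq> contact \<phi> m'" using dom l(1) unfolding dominates_def by blast
    have "m = m'" by (rule facet_eq_subcell[OF l(1) m'(2,1) m]) (use l(2) P in simp)
    thus ?thesis using m' by simp
  qed
  have fin: "finite ?S"
  proof (rule finite_subset)
    show "?S \<subseteq> (\<lambda>l. (cell \<omega> l, e ` contact \<omega> l)) ` {l. facet \<omega> l}"
      unfolding induced_subdivision_eq by blast
  qed (intro finite_imageI finite_facets)
  have union: "\<Union>(fst ` ?S) = P"
  proof
    show "\<Union>(fst ` ?S) \<subseteq> P" by auto
    have "closed (\<Union>(fst ` ?S))"
    proof (rule closed_Union)
      show "finite (fst ` ?S)" using fin by (rule finite_imageI)
      show "\<forall>T\<in>fst ` ?S. closed T"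
      proof
        fix T assume "T \<in> fst ` ?S"
        then obtain N where "(T, N) \<in> ?S" by auto
        then obtain l where "T = cell \<omega> l" using elem by blast
        thus "closed T" by (auto intro!: compact_imp_closed finite_imp_compact_convex_hull)
      qed
    qed
    moreover have "interior P \<subseteq> \<Union>(fst ` ?S)"
    proof
      fix x assume x: "x \<in> interior P"
      hence "x \<in> \<Delta>" using interior_subset hull_pts_subset unfolding P by blast
      then obtain l where l: "facet \<omega> l" "x \<in> cell \<omega> l" using facet_over_point by blast
      obtain m' where m': "majorant \<phi> m'" "contact \<omega> l \<subseteq> contact \<phi> m'" using dom l(1) unfolding dominates_def by blast
      have sub: "cell \<omega> l \<subseteq> cell \<phi> m'" by (intro hull_mono image_mono m')
      have "m = m'" by (rule facet_eq_interior[OF m m'(1)]) (use x l(2) sub P in auto)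
      hence "(cell \<omega> l, e ` contact \<omega> l) \<in> ?S" using sub l(1) unfolding P induced_subdivision_eq by blast
      thus "x \<in> \<Union>(fst ` ?S)" using l(2) by force
    qed
    ultimately have "closure (interior P) \<subseteq> \<Union>(fst ` ?S)" by (intro closure_minimal)
    moreover have "closure (interior P) = closure P"
      unfolding P by (intro convex_closure_interior interior_nonempty_of_aff_dim aff_dim_cell[OF m] convex_convex_hull)
    ultimately show "P \<subseteq> \<Union>(fst ` ?S)" using closure_subset by blast
  qed
  have cells: "marked_polygon (Q, N) \<and> N \<subseteq> M \<and> aff_dim Q = 2" if QN: "(Q, N) \<in> ?S" for Q N
  proof -
    obtain l where l: "facet \<omega> l" "Q = cell \<omega> l" "N = e ` contact \<omega> l" "Q \<subseteq> P" using elem[OF QN] by blast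
    have "N \<subseteq> M" unfolding l(3) M using contact_sub[OF l(1)] l(2,4) by (intro image_mono) simp
    thus ?thesis using marked_polygon_cell[OF l(1)] aff_dim_cell[OF l(1)] unfolding l(2,3) by blast
  qed
  have faces: "Q \<inter> Q' face_of Q \<and> Q \<inter> Q' face_of Q' \<and> N \<inter> lattice_points (Q \<inter> Q') = N' \<inter> lattice_points (Q \<inter> Q')"
    if QN: "(Q, N) \<in> ?S" "(Q', N') \<in> ?S" for Q N Q' N'
  proof -
    obtain l where l: "facet \<omega> l" "Q = cell \<omega> l" "N = e ` contact \<omega> l" using elem[OF QN(1)] by blast
    obtain l' where l': "facet \<omega> l'" "Q' = cell \<omega> l'" "N' = e ` contact \<omega> l'" using elem[OF QN(2)] by blast
    show ?thesis
      using cell_Int_face[OF l(1) l'(1)] cell_Int_face[OF l'(1) l(1)] marks_Int[OF l(1) l'(1)]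
      unfolding l l' by (simp add: Int_commute)
  qed
  show "is_subdivision ?S (P, M)"
    unfolding is_subdivision_def prod.case
  proof (intro conjI fin union ballI)
    fix x assume "x \<in> ?S"
    thus "case x of (Q, N) \<Rightarrow> marked_polygon (Q, N) \<and> N \<subseteq> M \<and> aff_dim Q = 2"
      by (cases x) (simp only: prod.case cells)
  next
    fix x assume x: "x \<in> ?S"
    obtain Q N where xQ: "x = (Q, N)" by (cases x)
    show "case x of (Q, N) \<Rightarrow> \<forall>(Q', N')\<in>?S.
        Q \<inter> Q' face_of Q \<and> Q \<inter> Q' face_of Q' \<and> N \<inter> lattice_points (Q \<inter> Q') = N' \<inter> lattice_points (Q \<inter> Q')"
      unfolding xQ prod.case
    proof
      fix y assume y: "y \<in> ?S"
      obtain Q' N' where yQ: "y = (Q', N')" by (cases y)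
      show "case y of (Q', N') \<Rightarrow>
        Q \<inter> Q' face_of Q \<and> Q \<inter> Q' face_of Q' \<and> N \<inter> lattice_points (Q \<inter> Q') = N' \<inter> lattice_points (Q \<inter> Q')"
        unfolding yQ prod.case by (rule faces[OF x[unfolded xQ] y[unfolded yQ]])
    qed
  qed
qed

lemma secondary_cone_eq: "secondary_cone \<Delta> e (induced_subdivision \<Delta> e \<omega>) = {\<phi>. dominates \<omega> \<phi>}"
  unfolding secondary_cone_def using refines_imp_dominates dominates_imp_refines by blast

section \<open>Secondary cones are convex cones\<close>

lemma dominates_add:
  assumes "dominates \<omega> \<phi>" "dominates \<omega> \<phi>'"
  shows "dominates \<omega> (\<phi> + \<phi>')"
  unfolding dominates_def
proof (intro allI impI)
  fix l assume "facet \<omega> l"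
  then obtain m m' where "majorant \<phi> m" "contact \<omega> l \<subseteq> contact \<phi> m" "majorant \<phi>' m'" "contact \<omega> l \<subseteq> contact \<phi>' m'"
    using assms unfolding dominates_def by meson
  thus "\<exists>m. majorant (\<phi> + \<phi>') m \<and> contact \<omega> l \<subseteq> contact (\<phi> + \<phi>') m"
    by (intro exI[of _ "m + m'"]) (auto simp: majorant_def contact_def aff_val_add add_mono subset_iff)
qed

lemma dominates_scale:
  assumes "dominates \<omega> \<phi>" "c \<ge> 0"
  shows "dominates \<omega> (c *\<^sub>R \<phi>)"
  unfolding dominates_def
proof (intro allI impI)
  fix l assume "facet \<omega> l"
  then obtain m where "majorant \<phi> m" "contact \<omega> l \<subseteq> contact \<phi> m"
    using assms unfolding dominates_def by meson
  thus "\<exists>m. majorant (c *\<^sub>R \<phi>) m \<and> contact \<omega> l \<subseteq> contact (c *\<^sub>R \<phi>) m"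
    using assms(2) by (intro exI[of _ "c *\<^sub>R m"]) (auto simp: majorant_def contact_def aff_val_scaleR mult_left_mono subset_iff)
qed

lemma dominates_const:
  assumes "\<And>i. \<phi> $ i = c"
  shows "dominates \<omega> \<phi>"
  unfolding dominates_def
  by (intro allI impI exI[of _ "(0, c)"]) (auto simp: majorant_def contact_def aff_val_const assms)

lemma dominates_sum:
  "finite K \<Longrightarrow> (\<And>k. k \<in> K \<Longrightarrow> dominates \<omega> (f k)) \<Longrightarrow> dominates \<omega> (\<Sum>k\<in>K. f k)"
proof (induction K rule: finite_induct)
  case empty
  show ?case by (rule dominates_const[of _ 0]) simp
qed (simp add: dominates_add)

section \<open>The cone of the concave hull of a fixed function\<close>

context
  fixes \<psi> :: "real ^ 'n"
begin

definition \<kappa> :: "real ^ 'n" where "\<kappa> = concave_hull_restr e \<psi>"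

lemma \<kappa>_nth: "\<kappa> $ i = concave_hull e \<psi> (pt i)"
  by (simp add: \<kappa>_def concave_hull_restr_def pt_def)

lemma majorant_\<kappa>: "majorant \<psi> l \<Longrightarrow> majorant \<kappa> l"
  using concave_hull_le[OF _ pt_in] by (simp add: majorant_def[of \<kappa>] \<kappa>_nth)

lemma contact_\<kappa>:
  assumes "majorant \<psi> l"
  shows "contact \<kappa> l = {i. pt i \<in> cell \<psi> l}" "contact \<psi> l \<subseteq> contact \<kappa> l"
proof -
  show eq: "contact \<kappa> l = {i. pt i \<in> cell \<psi> l}"
    using in_cell_iff[OF assms] pt_in by (auto simp: contact_def[of \<kappa>] \<kappa>_nth)
  show "contact \<psi> l \<subseteq> contact \<kappa> l" unfolding eq by (auto intro: hull_inc)
qed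

lemma facet_\<kappa>: "facet \<psi> l \<Longrightarrow> facet \<kappa> l"
  by (rule facet_mono[OF _ majorant_\<kappa> contact_\<kappa>(2)]) (simp_all add: facet_majorant)

text \<open>The majorant of \<psi> attached to a facet of \<omega> is a facet of \<psi> and of
  \<kappa>, with at least as many contacts for \<kappa>. Hence a secondary cone through \<psi>
  contains the cone of \<kappa>.\<close>

lemma dominates_trans_\<kappa>:
  assumes "dominates \<omega> \<psi>" "dominates \<kappa> \<phi>"
  shows "dominates \<omega> \<phi>"
  unfolding dominates_def
proof (intro allI impI)
  fix l assume l: "facet \<omega> l"
  then obtain m where m: "majorant \<psi> m" "contact \<omega> l \<subseteq> contact \<psi> m" using assms(1) unfolding dominates_def by blast
  have "facet \<kappa> m" by (rule facet_\<kappa>[OF facet_mono[OF l m]])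
  then obtain m' where "majorant \<phi> m'" "contact \<kappa> m \<subseteq> contact \<phi> m'" using assms(2) unfolding dominates_def by blast
  thus "\<exists>m. majorant \<phi> m \<and> contact \<omega> l \<subseteq> contact \<phi> m" using m(2) contact_\<kappa>(2)[OF m(1)] by blast
qed

text \<open>A linear space around the cone of \<kappa>, obtained by dropping the concavity
  conditions between cells.\<close>

definition cellwise_affine :: "(real ^ 'n) set" where
  "cellwise_affine = {\<phi>. \<forall>l. facet \<psi> l \<longrightarrow> (\<exists>m. \<forall>i\<in>contact \<kappa> l. \<phi> $ i = aff_val m (pt i))}"

lemma subspace_cellwise_affine: "subspace cellwise_affine"
  unfolding subspace_def
proof (intro conjI ballI allI)
  show "0 \<in> cellwise_affine"
    unfolding cellwise_affine_def by (intro CollectI allI impI exI[of _ "(0, 0)"]) (simp add: aff_val_const)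
next
  fix x y assume xy: "x \<in> cellwise_affine" "y \<in> cellwise_affine"
  show "x + y \<in> cellwise_affine"
    unfolding cellwise_affine_def
  proof (intro CollectI allI impI)
    fix l assume "facet \<psi> l"
    then obtain m m' where "\<forall>i\<in>contact \<kappa> l. x $ i = aff_val m (pt i)" "\<forall>i\<in>contact \<kappa> l. y $ i = aff_val m' (pt i)"
      using xy unfolding cellwise_affine_def by blast
    thus "\<exists>m. \<forall>i\<in>contact \<kappa> l. (x + y) $ i = aff_val m (pt i)" by (intro exI[of _ "m + m'"]) (simp add: aff_val_add)
  qed
next
  fix c x assume x: "x \<in> cellwise_affine"
  show "c *\<^sub>R x \<in> cellwise_affine"
    unfolding cellwise_affine_def
  proof (intro CollectI allI impI)
    fix l assume "facet \<psi> l"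
    then obtain m where "\<forall>i\<in>contact \<kappa> l. x $ i = aff_val m (pt i)"
      using x unfolding cellwise_affine_def by blast
    thus "\<exists>m. \<forall>i\<in>contact \<kappa> l. (c *\<^sub>R x) $ i = aff_val m (pt i)" by (intro exI[of _ "c *\<^sub>R m"]) (simp add: aff_val_scaleR)
  qed
qed

lemma const_cellwise_affine: "(\<chi> i. 1) \<in> cellwise_affine"
  unfolding cellwise_affine_def by (intro CollectI allI impI exI[of _ "(0, 1)"]) (simp add: aff_val_const)

lemma dominated_cellwise_affine: "dominates \<kappa> \<phi> \<Longrightarrow> \<phi> \<in> cellwise_affine"
  unfolding cellwise_affine_def dominates_def using facet_\<kappa> by (fastforce simp: contact_def[of \<phi>])

text \<open>Take a cell over a point where \<psi> differs from its hull. An affine function equal to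
  \<psi> at all lattice points of the cell equals \<open>l\<close> at the contact points, which span
  the plane, so it is \<open>l\<close>; then \<psi> would meet its hull at the given point.\<close>

lemma not_effective_not_cellwise_affine:
  assumes "\<not> effective e \<psi>"
  shows "\<psi> \<notin> cellwise_affine"
proof
  assume \<psi>: "\<psi> \<in> cellwise_affine"
  obtain i where i: "\<psi> $ i \<noteq> \<kappa> $ i" using assms unfolding effective_def \<kappa>_def[symmetric] by (auto simp: vec_eq_iff)
  obtain l where l: "facet \<psi> l" "pt i \<in> cell \<psi> l" using facet_over_point[OF pt_in] by blast
  note maj = facet_majorant[OF l(1)]
  obtain m where m: "\<forall>i\<in>contact \<kappa> l. \<psi> $ i = aff_val m (pt i)"
    using \<psi> l(1) unfolding cellwise_affine_def by blast
  have "l = m"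
  proof (rule aff_val_unique[of "pt ` contact \<psi> l"])
    show "aff_dim (pt ` contact \<psi> l) = 2" using l(1) by (simp add: facet_def)
    fix x assume "x \<in> pt ` contact \<psi> l"
    then obtain j where j: "x = pt j" "j \<in> contact \<psi> l" by blast
    thus "aff_val l x = aff_val m x" using m contact_\<kappa>(2)[OF maj] by (force simp: contact_def[of \<psi>])
  qed
  moreover have "i \<in> contact \<kappa> l" using contact_\<kappa>(1)[OF maj] l(2) by blast
  ultimately show False using m i by (auto simp: contact_def[of \<kappa>])
qed

end

end

section \<open>Secondary fans and tropical Severi varieties\<close>

text \<open>The constant vector is completed to a basis \<open>C\<close> of the span of the cone of
  the concave hull and itself; at least \<open>trop_rank\<close> further vectors occur. \<psi> is
  independent of \<open>C\<close>, as it is not cellwise affine, and lies with the further vectors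
  in the cone of \<omega>, where the curve of \<open>tropical_dimension\<close> can be
  drawn.\<close>

lemma (in polygon) dominates_dim_bound:
  fixes \<psi> \<omega> :: "real ^ 'n"
  assumes X: "zariski_closed X" and dom: "dominates \<omega> \<psi>" and not_eff: "\<not> effective e \<psi>"
    and trop: "abs_trop_torus ` {\<phi>. dominates \<omega> \<phi>} \<subseteq> tropicalization X"
  shows "enat (Suc (trop_rank \<Delta> e \<psi>)) \<le> variety_dim X"
proof -
  let ?one = "(\<chi> i. 1) :: real ^ 'n"
  define Q where "Q = {\<phi>. dominates (\<kappa> \<psi>) \<phi>}"
  have rank: "trop_rank \<Delta> e \<psi> = dim (abs_trop_torus ` Q)"
    unfolding trop_rank_def Q_def secondary_cone_eq[symmetric] \<kappa>_def ..
  have "?one \<noteq> 0" by (simp add: vec_eq_iff)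
  hence one: "independent {?one}" by (simp add: dependent_single)
  have Q_sub: "insert ?one Q \<subseteq> cellwise_affine \<psi>"
    unfolding Q_def using const_cellwise_affine dominated_cellwise_affine by blast
  obtain C where C: "{?one} \<subseteq> C" "C \<subseteq> insert ?one Q" "independent C" "insert ?one Q \<subseteq> span C"
    using maximal_independent_subset_extend[OF _ one, of "insert ?one Q"] by auto
  have finC: "finite C" using C(3) by (rule independent_imp_finite)
  have zero: "abs_trop_torus ?one = 0"
    unfolding zero_trop_torus_def abs_trop_torus_eq_iff by (intro exI[of _ 1]) simp
  \<comment> \<open>The constant vector maps to 0, so the remaining elements of \<open>C\<close>
    already span the image.\<close>
  have "abs_trop_torus ` Q \<subseteq> span (abs_trop_torus ` C)"
    unfolding linear_span_image[OF linear_abs_trop_torus] using C(4) by blast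
  also have "abs_trop_torus ` C = insert 0 (abs_trop_torus ` (C - {?one}))"
  proof -
    have "C = insert ?one (C - {?one})" using C(1) by blast
    from arg_cong[OF this, of "image abs_trop_torus"] show ?thesis by (simp only: image_insert zero)
  qed
  also have "span \<dots> = span (abs_trop_torus ` (C - {?one}))" by (rule span_insert_0)
  finally have "dim (abs_trop_torus ` Q) \<le> card (abs_trop_torus ` (C - {?one}))"
    by (rule dim_le_card) (use finC in simp)
  also have "\<dots> \<le> card (C - {?one})" by (rule card_image_le) (use finC in simp)
  finally have rank_le: "trop_rank \<Delta> e \<psi> \<le> card (C - {?one})" unfolding rank .
  have "span C \<subseteq> cellwise_affine \<psi>"
    using C(2) Q_sub by (intro span_minimal subspace_cellwise_affine) blast
  hence \<psi>: "\<psi> \<notin> span C" using not_effective_not_cellwise_affine[OF not_eff] by blast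
  \<comment> \<open>\<psi> takes the place of the constant vector, which gives at least one vector
    more than the rank.\<close>
  define B where "B = insert \<psi> (C - {?one})"
  have indep: "independent (insert ?one B)"
  proof -
    have "insert ?one B = insert \<psi> C" using C(1) by (auto simp: B_def)
    thus ?thesis using independent_insertI[OF \<psi> C(3)] by simp
  qed
  have one_B: "?one \<notin> B"
    using \<psi> C(1) span_base[of ?one C] by (auto simp: B_def)
  have "\<psi> \<notin> C - {?one}" using \<psi> span_base[of \<psi> C] by blast
  hence card_B: "card B = Suc (card (C - {?one}))" using finC by (simp add: B_def)
  have finB: "finite B" using finC by (simp add: B_def)
  have dom_B: "dominates \<omega> b" if "b \<in> B" for b
    using that C(2) dom dominates_trans_\<kappa>[OF dom] by (auto simp: B_def Q_def)
  obtain v where v: "bij_betw v {..<card B} B"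
    using ex_bij_betw_nat_finite[OF finB] by (auto simp: atLeast0LessThan)
  have "enat (card B) \<le> variety_dim X"
  proof (rule tropical_dimension[OF X])
    show "independent (insert ?one (v ` {..<card B}))" using v indep by (simp add: bij_betw_def)
    show "inj_on v {..<card B}" using v by (simp add: bij_betw_def)
    show "?one \<notin> v ` {..<card B}" using v one_B by (simp add: bij_betw_def)
    fix s :: real assume "s > 0"
    \<comment> \<open>For positive \<open>s\<close> all coefficients are positive, so the curve
      stays in the cone of \<omega>.\<close>
    hence "dominates \<omega> (\<Sum>k<card B. s ^ Suc k *\<^sub>R v k)"
      using v by (intro dominates_sum dominates_scale dom_B) (auto simp: bij_betw_def)
    thus "abs_trop_torus (\<Sum>k<card B. s ^ Suc k *\<^sub>R v k) \<in> tropicalization X" using trop by blast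
  qed
  moreover have "enat (Suc (trop_rank \<Delta> e \<psi>)) \<le> enat (card B)" using rank_le card_B by simp
  ultimately show ?thesis by (rule order_trans[rotated])
qed

lemma zariski_closed_severi_variety: "zariski_closed (severi_variety \<Delta> e \<delta>)"
  unfolding severi_variety_def by (rule zariski_closure(1)) blast

theorem theorem3p1:
  fixes \<Delta> :: "(real \<times> real) set"
    and e :: "'n::finite \<Rightarrow> int \<times> int"
    and \<delta> :: nat
  assumes "lattice_polygon \<Delta>" and "aff_dim \<Delta> = 2"
    and "bij_betw e UNIV (lattice_points \<Delta>)"
    and "\<delta> \<le> card (lattice_points (interior \<Delta>))"
    and "\<exists>\<psi> :: real ^ 'n.
           abs_trop_torus \<psi> \<in> tropicalization (severi_variety \<Delta> e \<delta>) \<and>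
           \<not> effective e \<psi> \<and>
           enat (trop_rank \<Delta> e \<psi>) = variety_dim (severi_variety \<Delta> e \<delta>)"
  shows "\<not> (\<exists>F. is_fan F \<and> \<Union>F = tropicalization (severi_variety \<Delta> e \<delta>) \<and>
           (\<forall>C\<in>F. \<exists>G \<subseteq> secondary_fan \<Delta> e. C = \<Union>G))"
proof
  let ?X = "severi_variety \<Delta> e \<delta>"
  interpret polygon \<Delta> e by unfold_locales (use assms in auto)
  obtain \<psi> :: "real ^ 'n" where \<psi>: "abs_trop_torus \<psi> \<in> tropicalization ?X" "\<not> effective e \<psi>"
    "enat (trop_rank \<Delta> e \<psi>) = variety_dim ?X" using assms(5) by blast
  assume "\<exists>F. is_fan F \<and> \<Union>F = tropicalization ?X \<and> (\<forall>C\<in>F. \<exists>G \<subseteq> secondary_fan \<Delta> e. C = \<Union>G)"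
  then obtain F where F: "\<Union>F = tropicalization ?X" "\<forall>C\<in>F. \<exists>G \<subseteq> secondary_fan \<Delta> e. C = \<Union>G" by blast
  then obtain C where C: "C \<in> F" "abs_trop_torus \<psi> \<in> C" using \<psi>(1) by blast
  then obtain G where G: "G \<subseteq> secondary_fan \<Delta> e" "C = \<Union>G" using F(2) by blast
  then obtain K where K: "K \<in> G" "abs_trop_torus \<psi> \<in> K" using C(2) by blast
  then obtain \<omega> where K_eq: "K = abs_trop_torus ` {\<phi>. dominates \<omega> \<phi>}"
    using G(1) unfolding secondary_fan_def coherent_def by (auto simp: secondary_cone_eq)
  have "K \<subseteq> tropicalization ?X" using F(1) C(1) G(2) K(1) by blast
  obtain \<phi> where \<phi>: "dominates \<omega> \<phi>" "abs_trop_torus \<psi> = abs_trop_torus \<phi>" using K(2) unfolding K_eq by blast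
  then obtain c where c: "\<And>i. \<psi> $ i - \<phi> $ i = c" unfolding abs_trop_torus_eq_iff by blast
  \<comment> \<open>Only the class of \<psi> is known to lie in the cone; \<psi> differs from \<phi>
    by a constant vector, which every \<omega> dominates.\<close>
  have "dominates \<omega> (\<phi> + (\<psi> - \<phi>))" by (intro dominates_add \<phi>(1) dominates_const[of _ c]) (simp add: c)
  hence "dominates \<omega> \<psi>" by simp
  from dominates_dim_bound[OF zariski_closed_severi_variety this \<psi>(2)] \<open>K \<subseteq> _\<close>
  have "enat (Suc (trop_rank \<Delta> e \<psi>)) \<le> variety_dim ?X" unfolding K_eq by blast
  thus False unfolding \<psi>(3)[symmetric] by simp
qed

end
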